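(* Consider the map $$\Phi:U_M(F)\times F^6\to N(F),\qquad (u,\dot n)\mapsto u\dot nu^{-1},$$ where $F^6$ is identified with $\prod_{i=0}^5U_{\gamma_i}(F)$ via $(c_0,\dots,c_5)\mapsto\dot n=\prod_{i=0}^5x_{\gamma_i}(c_i)$. Let $dn$ (resp. $du$) be the Haar measure on $N(F)$ (resp. $U_M(F)$), normalized so that $\mathrm{Vol}(N(\mathcal O_F),dn)=1$ (resp. $\mathrm{Vol}(U_M(\mathcal O_F),du)=1$). Then $$\Phi^*(dn)=J_\Phi(c_0,\dots,c_5)\,du\wedge\prod_{i=0}^5dc_i,\qquad J_\Phi(c_0,\dots,c_5)=|c_3|^2|c_4|^4|c_5|^9.$$
   Context: $F$ is a $p$-adic field with ring of integers $\mathcal O_F$. $G$ is the split simply connected group of type $E_6$ over $F$ with a fixed $F$-splitting $(B=AU,A,\{x_\alpha\})$ and one-parameter root subgroups $x_\beta:\mathbb G_a\to U_\beta$ for all roots $\beta$. Simple roots $\alpha_1,\dots,\alpha_6$ are in Bourbaki's labelling (chain $\alpha_1,\alpha_3,\alpha_4,\alpha_5,\alpha_6$, with $\alpha_2$ attached to $\alpha_4$), and $(abcdef)$ denotes $a\alpha_1+b\alpha_2+c\alpha_3+d\alpha_4+e\alpha_5+f\alpha_6$. $P=MN$ is the standard maximal parabolic subgroup obtained by deleting $\alpha_2$, and $U_M=U\cap M$. The roots $\gamma_i$ are $\gamma_0=(122321)$, $\gamma_1=(112321)$, $\gamma_2=(112221)$, $\gamma_3=(111211)$, $\gamma_4=(011210)$,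 $\gamma_5=(010000)$. $dc_i$ is the restriction of the Haar measure to the root subgroup $U_{\gamma_i}(F)\simeq F$ (Haar measure on $F$ giving $\mathcal O_F$ volume $1$). The identity expresses the Jacobian of $\Phi$ with respect to these measures. *)

theory Defs
  imports "HOL-Analysis.Analysis" "HOL-Algebra.Elementary_Groups"
begin

section \<open>p-adic fields\<close>

text \<open>
  A p-adic field, i.e. a finite extension of some field of p-adic numbers, is the same as a field of
  characteristic zero that is complete for a discrete valuation with finite residue field.
  The absolute value is the normalized one: a uniformizer has absolute value \<open>1/q\<close>, where \<open>q\<close> is the
  cardinality of the residue field (the quotient set in \<open>absv_normalized\<close>).
\<close>

class padic_field = field_char_0 + complete_space +
  fixes absv :: "'a \<Rightarrow> real"
  assumes dist_absv: "dist x y = absv (x - y)"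
    and absv_mult: "absv (x * y) = absv x * absv y"
    and absv_ultrametric: "absv (x + y) \<le> max (absv x) (absv y)"
    and finite_residue_field: "finite ({x. absv x \<le> 1} // {(x, y). absv (x - y) < 1})"
    and absv_normalized:
      "\<exists>\<pi>. absv \<pi> = 1 / real (card ({x. absv x \<le> 1} // {(x, y). absv (x - y) < 1})) \<and>
           (\<forall>x. absv x < 1 \<longrightarrow> absv x \<le> absv \<pi>)"

definition ring_of_integers :: "'a::padic_field set" where
  "ring_of_integers = {x. absv x \<le> 1}"

section \<open>The root system and the minuscule weights of type $E_6$\<close>

text \<open>
  Elements of the root lattice are given by their coordinates with respect to the simple roots,
  weights by their coordinates with respect to the fundamental weights. Coordinates are indexed by
  the elements \<open>1, \<dots>, 6\<close> of the type \<open>6\<close>, in Bourbaki's labelling (in this type \<open>6 = 0\<close>). Hence the root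
  $(abcdef)$ is \<open>vector [a, b, c, d, e, f]\<close>.
\<close>

definition cartan :: "int^6^6" where
  "cartan = (\<chi> i j. if i = j then 2
     else if {i, j} \<in> {{1, 3}, {3, 4}, {4, 5}, {5, 6}, {2, 4}} then -1 else 0)"

definition simple_root :: "6 \<Rightarrow> int^6" where
  "simple_root i = axis i 1"

inductive_set roots :: "(int^6) set" where
  simple: "simple_root i \<in> roots"
| reflect: "\<beta> \<in> roots \<Longrightarrow> \<beta> - (cartan *v \<beta>) $ i *s simple_root i \<in> roots"

definition positive_roots :: "(int^6) set" where
  "positive_roots = {\<beta> \<in> roots. \<forall>i. 0 \<le> \<beta> $ i}"

text \<open>
  The weights of the 27-dimensional representation with highest weight the first fundamental weight;
  as it is minuscule, they form one Weyl orbit. The simple root \<open>i\<close> has fundamental weight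
  coordinates \<open>cartan $ i\<close>.
\<close>

inductive_set minuscule_weights :: "(int^6) set" where
  highest: "axis 1 1 \<in> minuscule_weights"
| reflect: "\<nu> \<in> minuscule_weights \<Longrightarrow> \<nu> - (\<nu> $ i) *s cartan $ i \<in> minuscule_weights"

typedef weight = minuscule_weights
  by (rule exI, rule minuscule_weights.highest)

lemma UNIV_6: "(UNIV :: 6 set) = {1, 2, 3, 4, 5, 6}"
proof (rule sym, rule card_subset_eq)
  show "card {1, 2, 3, 4, 5, 6::6} = card (UNIV :: 6 set)" by simp
qed simp_all

lemma forall_6: "(\<forall>i::6. P i) \<longleftrightarrow> P 1 \<and> P 2 \<and> P 3 \<and> P 4 \<and> P 5 \<and> P 6"
proof -
  have "(\<forall>i. P i) \<longleftrightarrow> (\<forall>i\<in>(UNIV :: 6 set). P i)" by simp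
  then show ?thesis unfolding UNIV_6 by simp
qed

lemma vector_6 [simp]:
  "(vector [a, b, c, d, e, f] :: int^6) $ 1 = a"
  "(vector [a, b, c, d, e, f] :: int^6) $ 2 = b"
  "(vector [a, b, c, d, e, f] :: int^6) $ 3 = c"
  "(vector [a, b, c, d, e, f] :: int^6) $ 4 = d"
  "(vector [a, b, c, d, e, f] :: int^6) $ 5 = e"
  "(vector [a, b, c, d, e, f] :: int^6) $ 6 = f"
  unfolding vector_def by simp_all

definition weight_list :: "int list list" where
  "weight_list = [
    [1,0,0,0,0,0], [-1,0,1,0,0,0], [0,0,-1,1,0,0], [0,1,0,-1,1,0],
    [0,-1,0,0,1,0], [0,1,0,0,-1,1], [0,-1,0,1,-1,1], [0,1,0,0,0,-1],
    [0,0,1,-1,0,1], [0,-1,0,1,0,-1], [1,0,-1,0,0,1], [0,0,1,-1,1,-1],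
    [-1,0,0,0,0,1], [1,0,-1,0,1,-1], [0,0,1,0,-1,0], [-1,0,0,0,1,-1],
    [1,0,-1,1,-1,0], [-1,0,0,1,-1,0], [1,1,0,-1,0,0], [-1,1,1,-1,0,0],
    [1,-1,0,0,0,0], [-1,-1,1,0,0,0], [0,1,-1,0,0,0], [0,-1,-1,1,0,0],
    [0,0,0,-1,1,0], [0,0,0,0,-1,1], [0,0,0,0,0,-1]]"

fun reflections :: "int list \<Rightarrow> int list list" where
  "reflections [a, b, c, d, e, f] =
    [[- a, b, c + a, d, e, f], [a, - b, c, d + b, e, f], [a + c, b, - c, d + c, e, f],
     [a, b + d, c + d, - d, e + d, f], [a, b, c, d + e, - e, f + e], [a, b, c, d, e + f, - f]]"
| "reflections _ = []"

lemma weight_list_closed: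
  "\<forall>l\<in>set weight_list. length l = 6 \<and> (\<forall>m\<in>set (reflections l). m \<in> set weight_list)"
  by code_simp

lemma minuscule_weights_subset: "minuscule_weights \<subseteq> vector ` set weight_list"
proof
  fix \<nu> assume "\<nu> \<in> minuscule_weights"
  then show "\<nu> \<in> vector ` set weight_list"
  proof (induction rule: minuscule_weights.induct)
    case highest
    have "(axis 1 1 :: int^6) = vector [1, 0, 0, 0, 0, 0]"
      by (simp add: vec_eq_iff forall_6 axis_def)
    moreover have "[1, 0, 0, 0, 0, 0] \<in> set weight_list"
      by (simp add: weight_list_def)
    ultimately show ?case by blast
  next
    case (reflect \<nu> i)
    then obtain l where l: "l \<in> set weight_list" "\<nu> = vector l" by blast
    with weight_list_closed have "length l = 6" by blast
    then obtain a b c d e f where abc: "l = [a, b, c, d, e, f]"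
      by (auto simp: length_Suc_conv eval_nat_numeral)
    have "\<forall>i. \<nu> - (\<nu> $ i) *s cartan $ i \<in> vector ` set (reflections l)"
      unfolding forall_6 l(2) abc
      by (simp add: image_iff vec_eq_iff forall_6 cartan_def doubleton_eq_iff)
    with weight_list_closed l(1) show ?case by blast
  qed
qed

instance weight :: finite
proof
  have "finite minuscule_weights"
    using minuscule_weights_subset by (rule finite_subset) simp
  then show "finite (UNIV :: weight set)"
    by (metis finite_imageI type_definition.univ type_definition_weight)
qed

section \<open>The split simply connected group of type $E_6$\<close>

text \<open>
  The Chevalley construction in the minuscule representation. On the basis
  \<open>v\<^sub>\<nu>\<close> of weight vectors, the simple root vectors \<open>e\<^sub>i\<close>, \<open>f\<^sub>i\<close> map \<open>v\<^sub>\<nu>\<close> to the basis vector of weight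
  \<open>\<nu> + \<alpha>\<^sub>i\<close>, \<open>\<nu> - \<alpha>\<^sub>i\<close>, or to zero if that is not a weight; rows of the matrices are indexed by the
  target. The weights of this representation generate the whole weight lattice, so that the Chevalley
  group is the simply connected one.
\<close>

definition raising :: "6 \<Rightarrow> 'a::field ^ weight ^ weight" where
  "raising i = (\<chi> \<mu> \<nu>. if Rep_weight \<mu> = Rep_weight \<nu> + cartan $ i then 1 else 0)"

definition lowering :: "6 \<Rightarrow> 'a::field ^ weight ^ weight" where
  "lowering i = (\<chi> \<mu> \<nu>. if Rep_weight \<mu> = Rep_weight \<nu> - cartan $ i then 1 else 0)"

text \<open>
  As the root system is simply laced, the coroot of \<open>\<beta>\<close> has the same coordinates (with respect to the
  simple coroots) as \<open>\<beta>\<close>, and the structure constants of a Chevalley basis are \<open>\<plusminus>1\<close>.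
  A Chevalley system extends the simple root vectors given by the splitting, and is
  unique up to the signs of the remaining root vectors.
\<close>

definition coroot_matrix :: "int^6 \<Rightarrow> 'a::field ^ weight ^ weight" where
  "coroot_matrix \<beta> = (\<chi> \<mu> \<nu>. if \<mu> = \<nu> then of_int (\<Sum>i\<in>UNIV. Rep_weight \<nu> $ i * \<beta> $ i) else 0)"

definition chevalley_system :: "(int^6 \<Rightarrow> 'a::field ^ weight ^ weight) \<Rightarrow> bool" where
  "chevalley_system E \<longleftrightarrow>
     (\<forall>i. E (simple_root i) = raising i \<and> E (- simple_root i) = lowering i) \<and>
     (\<forall>\<beta>\<in>roots. E \<beta> ** E (- \<beta>) - E (- \<beta>) ** E \<beta> = coroot_matrix \<beta>) \<and>
     (\<forall>\<beta>\<in>roots. \<forall>\<gamma>\<in>roots. \<beta> + \<gamma> \<in> roots \<longrightarrow>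
        E \<beta> ** E \<gamma> - E \<gamma> ** E \<beta> \<in> {E (\<beta> + \<gamma>), - E (\<beta> + \<gamma>)})"

text \<open>The exponential of \<open>t E\<^sub>\<beta>\<close>; there are no further terms since \<open>E\<^sub>\<beta>\<close> has square zero.\<close>

definition root_elem ::
  "(int^6 \<Rightarrow> 'a::field ^ weight ^ weight) \<Rightarrow> int^6 \<Rightarrow> 'a \<Rightarrow> 'a ^ weight ^ weight" where
  "root_elem E \<beta> t = mat 1 + mat t ** E \<beta>"

definition GL :: "('a::field ^ 'n ^ 'n) monoid" where
  "GL = \<lparr>carrier = {g. invertible g}, mult = (**), one = mat 1\<rparr>"

definition E6_group ::
  "(int^6 \<Rightarrow> 'a::field ^ weight ^ weight) \<Rightarrow> ('a ^ weight ^ weight) monoid" where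
  "E6_group E = subgroup_generated GL (\<Union>\<beta>\<in>roots. range (root_elem E \<beta>))"

text \<open>The value at \<open>t\<close> of the simple coroot \<open>i\<close>; the simple coroots are a basis of the cocharacters.\<close>

definition torus_elem :: "6 \<Rightarrow> 'a::field \<Rightarrow> 'a ^ weight ^ weight" where
  "torus_elem i t = (\<chi> \<mu> \<nu>. if \<mu> = \<nu> then t powi (Rep_weight \<nu> $ i) else 0)"

definition torus_A ::
  "(int^6 \<Rightarrow> 'a::field ^ weight ^ weight) \<Rightarrow> ('a ^ weight ^ weight) monoid" where
  "torus_A E = subgroup_generated (E6_group E) {torus_elem i t | i t. t \<noteq> 0}"

definition unipotent_U ::
  "(int^6 \<Rightarrow> 'a::field ^ weight ^ weight) \<Rightarrow> ('a ^ weight ^ weight) monoid" where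
  "unipotent_U E = subgroup_generated (E6_group E) (\<Union>\<beta>\<in>positive_roots. range (root_elem E \<beta>))"

definition levi_M ::
  "(int^6 \<Rightarrow> 'a::field ^ weight ^ weight) \<Rightarrow> ('a ^ weight ^ weight) monoid" where
  "levi_M E = subgroup_generated (E6_group E)
     (carrier (torus_A E) \<union> (\<Union>\<beta>\<in>{\<beta> \<in> roots. \<beta> $ 2 = 0}. range (root_elem E \<beta>)))"

definition radical_N ::
  "(int^6 \<Rightarrow> 'a::field ^ weight ^ weight) \<Rightarrow> ('a ^ weight ^ weight) monoid" where
  "radical_N E = subgroup_generated (E6_group E)
     (\<Union>\<beta>\<in>{\<beta> \<in> positive_roots. \<beta> $ 2 > 0}. range (root_elem E \<beta>))"

definition unipotent_U_M ::
  "(int^6 \<Rightarrow> 'a::field ^ weight ^ weight) \<Rightarrow> ('a ^ weight ^ weight) monoid" where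
  "unipotent_U_M E = (E6_group E)\<lparr>carrier := carrier (unipotent_U E) \<inter> carrier (levi_M E)\<rparr>"

text \<open>
  Integral points with respect to the lattice spanned by the weight vectors; this is the integral
  structure given by the splitting.
\<close>

definition integral_points ::
  "('a::padic_field ^ 'n ^ 'n) monoid \<Rightarrow> ('a ^ 'n ^ 'n) set" where
  "integral_points H = {g \<in> carrier H. \<forall>i j. g $ i $ j \<in> ring_of_integers \<and>
     (inv\<^bsub>H\<^esub> g) $ i $ j \<in> ring_of_integers}"

section \<open>Haar measures and pullbacks of measures\<close>

text \<open>
  The group carries the subspace topology. Regularity need not be required: it is automatic in the
  second countable locally compact groups considered here.
\<close>

definition haar_measure :: "('g::topological_space) monoid \<Rightarrow> 'g measure \<Rightarrow> bool" where
  "haar_measure H \<mu> \<longleftrightarrow>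
     space \<mu> = carrier H \<and>
     sets \<mu> = sets (restrict_space borel (carrier H)) \<and>
     (\<forall>g\<in>carrier H. \<forall>X\<in>sets \<mu>. emeasure \<mu> ((\<lambda>h. g \<otimes>\<^bsub>H\<^esub> h) ` X) = emeasure \<mu> X) \<and>
     (\<forall>K\<subseteq>carrier H. compact K \<longrightarrow> emeasure \<mu> K < \<infinity>) \<and>
     (\<forall>V. open V \<and> V \<inter> carrier H \<noteq> {} \<longrightarrow> emeasure \<mu> (V \<inter> carrier H) > 0)"

definition additive_group :: "'a::ab_group_add monoid" where
  "additive_group = \<lparr>carrier = UNIV, mult = (+), one = 0\<rparr>"

text \<open>
  The pullback of a measure \<open>\<mu>\<close> under a map \<open>f\<close> defined on the measurable space of \<open>D\<close> (only the space
  and the sigma-algebra of \<open>D\<close> matter): points of the target are counted with the number of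
  their preimages, so that a set on which \<open>f\<close> is injective has the measure of its image. For a
  morphism \<open>f\<close> between analytic manifolds of the same dimension, with \<open>\<mu>\<close> the measure of a volume form
  \<open>\<omega>\<close>, it is the measure of the form \<open>f\<^sup>*\<omega>\<close>, by change of variables.
  If the expression below were not countably additive, the result would be the zero measure.
\<close>

definition pullback_measure :: "'b measure \<Rightarrow> ('b \<Rightarrow> 'c) \<Rightarrow> 'c measure \<Rightarrow> 'b measure" where
  "pullback_measure D f \<mu> = measure_of (space D) (sets D)
     (\<lambda>X. \<integral>\<^sup>+ y. emeasure (count_space UNIV) {x \<in> X. f x = y} \<partial>\<mu>)"

section \<open>The map and its Jacobian\<close>

definition gamma :: "nat \<Rightarrow> int^6" where
  "gamma i = [vector [1,2,2,3,2,1], vector [1,1,2,3,2,1], vector [1,1,2,2,2,1],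
              vector [1,1,1,2,1,1], vector [0,1,1,2,1,0], vector [0,1,0,0,0,0]] ! i"

definition n_dot ::
  "(int^6 \<Rightarrow> 'a::field ^ weight ^ weight) \<Rightarrow> (nat \<Rightarrow> 'a) \<Rightarrow> 'a ^ weight ^ weight" where
  "n_dot E c = foldr (\<lambda>i g. root_elem E (gamma i) (c i) \<otimes>\<^bsub>E6_group E\<^esub> g) [0..<6] \<one>\<^bsub>E6_group E\<^esub>"

definition Phi ::
  "(int^6 \<Rightarrow> 'a::field ^ weight ^ weight) \<Rightarrow> ('a ^ weight ^ weight) \<times> (nat \<Rightarrow> 'a) \<Rightarrow> 'a ^ weight ^ weight" where
  "Phi E = (\<lambda>(u, c). u \<otimes>\<^bsub>E6_group E\<^esub> n_dot E c \<otimes>\<^bsub>E6_group E\<^esub> inv\<^bsub>E6_group E\<^esub> u)"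

definition J_Phi :: "(nat \<Rightarrow> 'a::padic_field) \<Rightarrow> real" where
  "J_Phi c = absv (c 3) ^ 2 * absv (c 4) ^ 4 * absv (c 5) ^ 9"

end

theory Submission
  imports Defs
begin

text \<open>
  The map is brought into triangular form in suitable coordinates, and its Jacobian is the product of the
  diagonal entries.

  The group \<open>N\<close> is a Heisenberg group: its 21 roots are the highest root \<open>\<gamma>\<^sub>0\<close>, which spans the centre, and 20 roots
  in which \<open>\<alpha>\<^sub>2\<close> has coefficient one. On the quotient of \<open>N\<close> by its centre, conjugation by \<open>U\<^sub>M\<close> is linear. The
  coefficient of \<open>\<alpha>\<^sub>4\<close> splits this quotient further, into pieces of dimension 1, 9, 9, 1 with coefficient 0, 1, 2, 3.
  Here \<open>\<gamma>\<^sub>5\<close> spans the first piece, \<open>\<gamma>\<^sub>4, \<gamma>\<^sub>3, \<gamma>\<^sub>2\<close> lie in the third, and \<open>\<gamma>\<^sub>1\<close> spans the last. Correspondingly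
  an element of \<open>U\<^sub>M\<close> is a product \<open>v w\<close>, where \<open>v\<close> involves the 9 positive roots of the Levi subgroup that contain
  \<open>\<alpha>\<^sub>4\<close>, and \<open>w\<close> the 6 positive roots of the remaining system of type \<open>A\<^sub>2 \<times> A\<^sub>2\<close>.

  The element \<open>w\<close> fixes the coordinates \<open>c\<^sub>5\<close> and \<open>c\<^sub>1\<close> and acts on the third piece, which is a space of 3 by 3 matrices,
  by row and column operations. Applied to the diagonal matrix with entries \<open>c\<^sub>4, c\<^sub>3, c\<^sub>2\<close> this is a Gauss decomposition; the
  pivot \<open>c\<^sub>4\<close> multiplies four coordinates of \<open>w\<close> and the pivot \<open>c\<^sub>3\<close> two. The element \<open>v\<close> then moves the first
  piece into the second one, where its 9 coordinates appear multiplied by \<open>c\<^sub>5\<close>, and adds to the later pieces only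
  terms in variables that are known by then. Finally \<open>c\<^sub>0\<close> translates the central coordinate. This gives the
  Jacobian \<open>|c\<^sub>5|\<^sup>9 |c\<^sub>4|\<^sup>4 |c\<^sub>3|\<^sup>2\<close>. Triangularity is a finite combinatorial statement about the monomials that
  can occur in the coordinates, and is checked by evaluation (\<open>eliminates_elimination_order\<close>).

  To make this a statement about measures, the normalized Haar measures of \<open>N\<close> and \<open>U\<^sub>M\<close> are identified with products
  of additive Haar measures in the coordinates given by ordered products of root elements (\<open>haar_measure_xprod\<close>).
  This rests on a uniqueness theorem proved by counting cosets of congruence subgroups (\<open>haar_measure_eqI\<close>). A triangular
  map is a composition of affine substitutions in single coordinates (\<open>change_of_variables_triangular\<close>), each of which scales
  Haar measure by the absolute value of its coefficient. The triangular map has an inverse where the pivots do not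
  vanish, which is almost everywhere, and for such a map the pullback of a measure is the measure with the Jacobian as density
  (\<open>pullback_measure_eq_density\<close>). Structure constants matter only up to sign, as they are \<open>1\<close> or \<open>-1\<close>; that every Chevalley
  system consists of the same explicit matrices up to signs is \<open>chevalley_system_positive\<close>.
\<close>

section \<open>The absolute value and the topology of a p-adic field\<close>

lemma absv_nonneg [simp]: "0 \<le> absv (x::'a::padic_field)"
  using zero_le_dist[of x 0] by (simp add: dist_absv)

lemma absv_eq_0_iff [simp]: "absv (x::'a::padic_field) = 0 \<longleftrightarrow> x = 0"
  using dist_eq_0_iff[of x 0] by (simp add: dist_absv)

lemma absv_pos_iff [simp]: "0 < absv (x::'a::padic_field) \<longleftrightarrow> x \<noteq> 0"
  using absv_nonneg absv_eq_0_iff by (simp add: less_le)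

lemma absv_minus [simp]: "absv (- x) = absv (x::'a::padic_field)"
  using dist_commute[of 0 x] by (simp add: dist_absv)

lemma absv_minus_commute: "absv (x - y) = absv (y - x::'a::padic_field)"
  by (metis dist_absv dist_commute)

lemma absv_ultrametric_diff: "absv (x - y::'a::padic_field) \<le> max (absv x) (absv y)"
  using absv_ultrametric[of x "- y"] by simp

lemma absv_0 [simp]: "absv (0::'a::padic_field) = 0"
  by simp

lemma absv_1 [simp]: "absv (1::'a::padic_field) = 1"
proof -
  have "absv (1::'a) * absv (1::'a) = absv (1::'a)" using absv_mult[of "1::'a" 1] by simp
  moreover have "absv (1::'a) \<noteq> 0" by simp
  ultimately show ?thesis by (metis mult_cancel_left1)
qed

lemma absv_inverse: "absv (inverse x) = inverse (absv (x::'a::padic_field))"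
proof (cases "x = 0")
  case False
  then have "absv x * absv (inverse x) = 1" by (simp flip: absv_mult)
  then show ?thesis by (metis inverse_unique)
qed simp

lemma absv_divide: "absv (x / y) = absv x / absv (y::'a::padic_field)"
  by (simp add: divide_inverse absv_mult absv_inverse)

lemma absv_power: "absv (x ^ n) = absv (x::'a::padic_field) ^ n"
  by (induction n) (simp_all add: absv_mult)

instance padic_field \<subseteq> topological_ab_group_add
proof
  fix a b :: 'a
  show "LIM x (nhds a \<times>\<^sub>F nhds b). fst x + snd x :> nhds (a + b)"
  proof (rule tendstoI)
    fix e :: real
    assume e: "e > 0"
    have "\<forall>\<^sub>F p in nhds a \<times>\<^sub>F nhds b. dist (fst p) a < e \<and> dist (snd p) b < e"
      using e by (intro eventually_prodI) (simp_all add: eventually_nhds_metric, auto)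
    then show "\<forall>\<^sub>F p in nhds a \<times>\<^sub>F nhds b. dist (fst p + snd p) (a + b) < e"
    proof (rule eventually_mono)
      fix p :: "'a \<times> 'a"
      assume "dist (fst p) a < e \<and> dist (snd p) b < e"
      moreover have "(fst p - a) + (snd p - b) = fst p + snd p - (a + b)" by simp
      ultimately show "dist (fst p + snd p) (a + b) < e"
        unfolding dist_absv using absv_ultrametric[of "fst p - a" "snd p - b"]
        by (simp only: max_less_iff_conj order.strict_trans1)
    qed
  qed
  show "(uminus \<longlongrightarrow> - a) (nhds a)"
  proof (rule tendstoI)
    fix e :: real
    assume e: "e > 0"
    have "dist (- x) (- a) = dist x a" for x
      by (simp add: dist_absv absv_minus_commute[of a])
    then show "\<forall>\<^sub>F x in nhds a. dist (- x) (- a) < e"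
      using e by (auto simp: eventually_nhds_metric)
  qed
qed

instance padic_field \<subseteq> topological_semigroup_mult
proof
  fix a b :: 'a
  show "LIM x (nhds a \<times>\<^sub>F nhds b). fst x * snd x :> nhds (a * b)"
  proof (rule tendstoI)
    fix e :: real
    assume e: "e > 0"
    define d where "d = min 1 (e / (1 + absv a + absv b))"
    have pos: "1 + absv a + absv b > 0" using absv_nonneg[of a] absv_nonneg[of b] by linarith
    have d: "d > 0" using e pos by (simp add: d_def)
    have de: "d * (1 + absv a + absv b) \<le> e"
    proof -
      have "d \<le> e / (1 + absv a + absv b)" by (simp add: d_def)
      with pos show ?thesis by (simp only: pos_le_divide_eq)
    qed
    have "\<forall>\<^sub>F p in nhds a \<times>\<^sub>F nhds b. dist (fst p) a < d \<and> dist (snd p) b < d"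
      using d by (intro eventually_prodI) (simp_all add: eventually_nhds_metric, auto)
    then show "\<forall>\<^sub>F p in nhds a \<times>\<^sub>F nhds b. dist (fst p * snd p) (a * b) < e"
    proof (rule eventually_mono)
      fix p :: "'a \<times> 'a"
      assume p: "dist (fst p) a < d \<and> dist (snd p) b < d"
      define x y where "x = fst p - a" and "y = snd p - b"
      have xy: "absv x < d" "absv y < d" using p by (simp_all add: x_def y_def dist_absv)
      have "fst p * snd p - a * b = x * y + (x * b + a * y)"
        by (simp add: x_def y_def algebra_simps)
      then have "dist (fst p * snd p) (a * b) \<le> max (absv (x * y)) (max (absv (x * b)) (absv (a * y)))"
        unfolding dist_absv
        using absv_ultrametric[of "x * y" "x * b + a * y"] absv_ultrametric[of "x * b" "a * y"] by simp
      also have "\<dots> < d * (1 + absv a + absv b)"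
      proof -
        have "absv (x * y) < d"
        proof -
          have "absv x * absv y \<le> absv x * 1"
            using xy(2) by (intro mult_left_mono) (simp_all add: d_def)
          then show ?thesis using xy(1) by (simp add: absv_mult)
        qed
        moreover have "absv (x * b) \<le> d * absv b" "absv (a * y) \<le> d * absv a"
          using xy by (simp_all add: absv_mult mult_right_mono mult.commute[of "absv a"])
        moreover have "d * absv b \<ge> 0" "d * absv a \<ge> 0" using d by simp_all
        moreover have "d * (1 + absv a + absv b) = d + d * absv a + d * absv b" by (simp add: distrib_left)
        ultimately have "absv (x * y) < d * (1 + absv a + absv b)" "absv (x * b) < d * (1 + absv a + absv b)"
            "absv (a * y) < d * (1 + absv a + absv b)"
          using d by linarith+
        then show ?thesis by simp
      qed
      finally show "dist (fst p * snd p) (a * b) < e" using de by simp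
    qed
  qed
qed

text \<open>
  The residue field as a set of open balls of radius one. Its cardinality is the only arithmetic input to
  the scaling of Haar measure.
\<close>

definition residue_classes :: "'a::padic_field set set" where
  "residue_classes = {x. absv x \<le> 1} // {(x, y). absv (x - y) < 1}"

lemma residue_classes_altdef:
  "residue_classes = (\<lambda>x::'a::padic_field. {y. absv (x - y) < 1}) ` {x. absv x \<le> 1}"
  by (auto simp: residue_classes_def quotient_def Image_def)

lemma finite_residue_classes: "finite (residue_classes :: 'a::padic_field set set)"
  using finite_residue_field unfolding residue_classes_def .

lemma card_residue_classes: "2 \<le> card (residue_classes :: 'a::padic_field set set)"
proof -
  have "{{y::'a. absv (0 - y) < 1}, {y. absv (1 - y) < 1}} \<subseteq> residue_classes"
  proof -
    have "{y::'a. absv (x - y) < 1} \<in> residue_classes" if "absv x \<le> 1" for x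
      using that by (auto simp: residue_classes_altdef)
    from this[of 0] this[of 1] show ?thesis by (simp del: diff_0)
  qed
  moreover have "{y::'a. absv (0 - y) < 1} \<noteq> {y. absv (1 - y) < 1}"
  proof
    assume "{y::'a. absv (0 - y) < 1} = {y. absv (1 - y) < 1}"
    then have "(1::'a) \<in> {y. absv (0 - y) < 1}" by simp
    then show False by simp
  qed
  ultimately show ?thesis
    using card_mono[OF finite_residue_classes] by (metis card_2_iff)
qed

definition uniformizer :: "'a::padic_field" where
  "uniformizer = (SOME \<pi>. absv \<pi> = 1 / real (card (residue_classes :: 'a set set)) \<and>
     (\<forall>x::'a. absv x < 1 \<longrightarrow> absv x \<le> absv \<pi>))"

lemma absv_uniformizer:
    "absv (uniformizer :: 'a::padic_field) = 1 / real (card (residue_classes :: 'a set set))"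
  and absv_le_uniformizer: "absv (x::'a) < 1 \<Longrightarrow> absv x \<le> absv (uniformizer :: 'a)"
  using someI_ex[OF absv_normalized[where 'a = 'a, folded residue_classes_def]]
  unfolding uniformizer_def by blast+

lemma absv_uniformizer_pos: "0 < absv (uniformizer :: 'a::padic_field)"
  and absv_uniformizer_less_1: "absv (uniformizer :: 'a::padic_field) < 1"
  using card_residue_classes[where 'a = 'a] by (simp_all add: absv_uniformizer del: absv_pos_iff)

lemma uniformizer_nonzero [simp]: "(uniformizer :: 'a::padic_field) \<noteq> 0"
  using absv_uniformizer_pos[where 'a = 'a] by simp

lemma absv_eq_power_uniformizer:
  assumes "(a::'a::padic_field) \<noteq> 0" "absv a \<le> 1"
  obtains u and n :: nat where "absv u = 1" "a = u * uniformizer ^ n"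
proof -
  let ?p = "absv (uniformizer :: 'a)"
  obtain N where N: "?p ^ N < absv a"
    using real_arch_pow_inv[of "absv a" ?p] assms absv_uniformizer_less_1 by auto
  define n where "n = (LEAST n. ?p ^ Suc n < absv a)"
  have ex: "?p ^ Suc N < absv a"
    using N absv_uniformizer_less_1[where 'a = 'a] absv_uniformizer_pos[where 'a = 'a]
      power_decreasing[of N "Suc N" ?p] by linarith
  have n1: "?p ^ Suc n < absv a" unfolding n_def by (rule LeastI[of _ N], rule ex)
  have n2: "absv a \<le> ?p ^ n"
  proof (cases n)
    case 0
    then show ?thesis using assms by simp
  next
    case (Suc k)
    then show ?thesis using not_less_Least[of k "\<lambda>n. ?p ^ Suc n < absv a"]
      unfolding n_def by force
  qed
  define u where "u = a / uniformizer ^ n"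
  have pn: "?p ^ n > 0" using absv_uniformizer_pos[where 'a = 'a] by (simp del: absv_pos_iff)
  have u: "absv u = absv a / ?p ^ n" by (simp add: u_def absv_divide absv_power)
  have "\<not> absv u < 1"
  proof
    assume "absv u < 1"
    then have "absv u \<le> ?p" by (rule absv_le_uniformizer)
    with pn have "absv a \<le> ?p * ?p ^ n" unfolding u by (simp add: field_simps)
    with n1 show False by simp
  qed
  moreover have "absv u \<le> 1" using n2 pn unfolding u by simp
  ultimately have "absv u = 1" by simp
  moreover have "a = u * uniformizer ^ n" by (simp add: u_def)
  ultimately show thesis by (rule that)
qed

definition max_ideal_power :: "nat \<Rightarrow> 'a::padic_field set" where
  "max_ideal_power n = {x. absv x \<le> absv (uniformizer :: 'a) ^ n}"

lemma max_ideal_power_0: "max_ideal_power 0 = ring_of_integers"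
  by (simp add: max_ideal_power_def ring_of_integers_def)

lemma
  shows max_ideal_power_zero [simp]: "0 \<in> max_ideal_power n"
    and max_ideal_power_add: "x \<in> max_ideal_power n \<Longrightarrow> y \<in> max_ideal_power n \<Longrightarrow> x + y \<in> max_ideal_power n"
    and max_ideal_power_minus: "x \<in> max_ideal_power n \<Longrightarrow> - x \<in> max_ideal_power n"
    and max_ideal_power_diff: "x \<in> max_ideal_power n \<Longrightarrow> y \<in> max_ideal_power n \<Longrightarrow> x - y \<in> max_ideal_power n"
  using absv_ultrametric[of x y] absv_ultrametric_diff[of x y] absv_uniformizer_pos[where 'a = 'a]
  by (auto simp: max_ideal_power_def simp del: absv_pos_iff)

lemma max_ideal_power_mult:
  "absv x \<le> 1 \<Longrightarrow> y \<in> max_ideal_power n \<Longrightarrow> x * y \<in> max_ideal_power n"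
  using mult_mono[of "absv x" 1 "absv y"] by (fastforce simp: max_ideal_power_def absv_mult)

lemma max_ideal_power_sum:
  "(\<And>i. i \<in> S \<Longrightarrow> f i \<in> max_ideal_power n) \<Longrightarrow> sum f S \<in> max_ideal_power n"
  by (induction S rule: infinite_finite_induct) (auto intro: max_ideal_power_add)

lemma max_ideal_power_le: "x \<in> max_ideal_power n \<Longrightarrow> m \<le> n \<Longrightarrow> x \<in> max_ideal_power m"
  using power_decreasing[of m n "absv (uniformizer :: 'a::padic_field)"] absv_uniformizer_less_1[where 'a = 'a]
  unfolding max_ideal_power_def mem_Collect_eq by (meson absv_nonneg less_imp_le order_trans)

lemma max_ideal_power_eq_image:
  "max_ideal_power n = (*) (uniformizer ^ n :: 'a::padic_field) ` ring_of_integers" (is "_ = ?R")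
proof (intro equalityI subsetI)
  fix x :: 'a
  assume "x \<in> max_ideal_power n"
  then have "x / uniformizer ^ n \<in> ring_of_integers"
    using absv_uniformizer_pos[where 'a = 'a]
    by (simp add: max_ideal_power_def ring_of_integers_def absv_divide absv_power)
  then show "x \<in> ?R" by (intro image_eqI[of _ _ "x / uniformizer ^ n"]) simp_all
next
  fix x :: 'a
  assume "x \<in> ?R"
  then show "x \<in> max_ideal_power n"
    using absv_uniformizer_pos[where 'a = 'a]
    by (auto simp: max_ideal_power_def ring_of_integers_def absv_mult absv_power mult_left_le)
qed

lemma max_ideal_power_1: "max_ideal_power 1 = {x::'a::padic_field. absv x < 1}"
  using absv_le_uniformizer absv_uniformizer_less_1[where 'a = 'a] by (fastforce simp: max_ideal_power_def)

lemma uniformizer_power_arch: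
  assumes "e > 0"
  obtains n where "absv (uniformizer :: 'a::padic_field) ^ n < e"
  using real_arch_pow_inv[of e "absv (uniformizer :: 'a)"] assms absv_uniformizer_less_1 by blast

lemma open_max_ideal_power: "open (max_ideal_power n :: 'a::padic_field set)"
  unfolding open_dist
proof
  fix x :: 'a
  assume x: "x \<in> max_ideal_power n"
  show "\<exists>e>0. \<forall>y. dist y x < e \<longrightarrow> y \<in> max_ideal_power n"
  proof (intro exI[of _ "absv (uniformizer :: 'a) ^ n"] conjI allI impI)
    fix y assume "dist y x < absv (uniformizer :: 'a) ^ n"
    then have "y - x \<in> max_ideal_power n" by (simp add: dist_absv max_ideal_power_def)
    then show "y \<in> max_ideal_power n" using max_ideal_power_add[OF _ x] by fastforce
  qed (use absv_uniformizer_pos[where 'a = 'a] in \<open>simp del: absv_pos_iff\<close>)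
qed

text \<open>
  Total boundedness of the ring of integers: representatives of the finitely many residue classes serve
  as the next digit of an expansion in powers of the uniformizer.
\<close>

lemma max_ideal_power_finite_net:
  "\<exists>D::'a::padic_field set. finite D \<and> (\<forall>x\<in>ring_of_integers. \<exists>d\<in>D. x - d \<in> max_ideal_power n)"
proof (induction n)
  case 0
  show ?case by (intro exI[of _ "{0}"]) (simp add: max_ideal_power_0)
next
  case (Suc n)
  then obtain D :: "'a set" where D: "finite D" "\<forall>x\<in>ring_of_integers. \<exists>d\<in>D. x - d \<in> max_ideal_power n"
    by blast
  define rep where "rep C = (SOME y. y \<in> C)" for C :: "'a set"
  let ?R = "rep ` residue_classes"
  let ?D = "(\<lambda>(d, r). d + uniformizer ^ n * r) ` (D \<times> ?R)"
  have "\<exists>d\<in>?D. x - d \<in> max_ideal_power (Suc n)" if x: "x \<in> ring_of_integers" for x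
  proof -
    obtain d where d: "d \<in> D" "x - d \<in> max_ideal_power n" using D(2) x by blast
    then obtain z where z: "z \<in> ring_of_integers" "x - d = uniformizer ^ n * z"
      unfolding max_ideal_power_eq_image by blast
    let ?C = "{y. absv (z - y) < 1}"
    have C: "?C \<in> residue_classes" using z(1) by (auto simp: residue_classes_altdef ring_of_integers_def)
    have "rep ?C \<in> ?C" unfolding rep_def by (rule someI[of _ z]) simp
    then have "z - rep ?C \<in> max_ideal_power 1" by (simp only: max_ideal_power_1 mem_Collect_eq)
    then have "uniformizer ^ n * (z - rep ?C) \<in> max_ideal_power (Suc n)"
      using absv_uniformizer_pos[where 'a = 'a] by (auto simp: max_ideal_power_def absv_mult absv_power)
    moreover have "uniformizer ^ n * (z - rep ?C) = x - (d + uniformizer ^ n * rep ?C)"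
      using z(2) by (simp add: algebra_simps)
    ultimately show ?thesis using d(1) C by fastforce
  qed
  moreover have "finite ?D" using D(1) finite_residue_classes[where 'a = 'a] by (intro finite_imageI finite_SigmaI)
  ultimately show ?case by blast
qed

lemma exists_scaled_integral:
  "\<exists>k. uniformizer ^ k * x \<in> (ring_of_integers :: 'a::padic_field set)"
proof (cases "x = 0")
  case False
  then obtain k where "absv (uniformizer :: 'a) ^ k < 1 / absv x"
    using uniformizer_power_arch[of "1 / absv x", where 'a = 'a] by auto
  then show ?thesis using False
    by (intro exI[of _ k]) (simp add: ring_of_integers_def absv_mult absv_power field_simps)
qed (simp add: ring_of_integers_def)

instance padic_field \<subseteq> second_countable_topology
proof
  define D where "D n = (SOME D::'a set. finite D \<and> (\<forall>x\<in>ring_of_integers. \<exists>d\<in>D. x - d \<in> max_ideal_power n))" for n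
  have D: "finite (D n)" "\<And>x. x \<in> ring_of_integers \<Longrightarrow> \<exists>d\<in>D n. x - d \<in> max_ideal_power n" for n
    using someI_ex[OF max_ideal_power_finite_net[of n, where 'a = 'a]] unfolding D_def by blast+
  define S where "S = (\<Union>n. \<Union>k. (\<lambda>d. d / uniformizer ^ k) ` D n)"
  have S: "countable S" unfolding S_def
    by (intro countable_UN[OF countableI_type] countable_image countable_finite[OF D(1)])
  define B where "B = (\<lambda>(s, n). {y. absv (y - s) < absv (uniformizer :: 'a) ^ n}) ` (S \<times> (UNIV :: nat set))"
  have "topological_basis B"
  proof (rule topological_basisI)
    fix b assume "b \<in> B"
    then obtain s n where b: "b = ball s (absv (uniformizer :: 'a) ^ n)"
      by (auto simp: B_def ball_def dist_absv absv_minus_commute)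
    show "open b" unfolding b by simp
  next
    fix U :: "'a set" and x
    assume "open U" "x \<in> U"
    then obtain e where e: "e > 0" "\<And>y. dist y x < e \<Longrightarrow> y \<in> U" unfolding open_dist by blast
    obtain n where n: "absv (uniformizer :: 'a) ^ n < e" using uniformizer_power_arch[OF e(1)] .
    obtain k where k: "uniformizer ^ k * x \<in> ring_of_integers" using exists_scaled_integral by blast
    \<comment> \<open>The net has to be finer by the factor that is lost when \<open>x\<close> is scaled back from the integers.\<close>
    obtain d where d: "d \<in> D (Suc (n + k))" "uniformizer ^ k * x - d \<in> max_ideal_power (Suc (n + k))"
      using D(2)[OF k] by blast
    define s where "s = d / uniformizer ^ k"
    have "uniformizer ^ k * x - d = uniformizer ^ k * (x - s)" by (simp add: s_def algebra_simps)
    with d(2) have "absv (x - s) \<le> absv (uniformizer :: 'a) ^ Suc n"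
      using absv_uniformizer_pos[where 'a = 'a]
      by (simp add: max_ideal_power_def absv_mult absv_power power_add)
    also have "\<dots> < absv (uniformizer :: 'a) ^ n"
      using absv_uniformizer_pos[where 'a = 'a] absv_uniformizer_less_1[where 'a = 'a] by simp
    finally have xs: "absv (x - s) < absv (uniformizer :: 'a) ^ n" .
    have "s \<in> S" using d(1) by (auto simp: S_def s_def)
    then have "{y. absv (y - s) < absv (uniformizer :: 'a) ^ n} \<in> B" by (auto simp: B_def)
    moreover have "{y. absv (y - s) < absv (uniformizer :: 'a) ^ n} \<subseteq> U"
    proof
      fix y assume "y \<in> {y. absv (y - s) < absv (uniformizer :: 'a) ^ n}"
      then have "absv (y - x) < e"
        using xs n absv_ultrametric_diff[of "y - s" "x - s"] by simp
      then show "y \<in> U" using e(2) by (simp add: dist_absv)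
    qed
    ultimately show "\<exists>B'\<in>B. x \<in> B' \<and> B' \<subseteq> U"
      using xs by (intro bexI[of _ "{y. absv (y - s) < absv (uniformizer :: 'a) ^ n}"] conjI) simp_all
  qed
  moreover have "countable B" unfolding B_def using S by simp
  ultimately show "\<exists>B::'a set set. countable B \<and> open = generate_topology B"
    using topological_basis_imp_subbasis by blast
qed

text \<open>
  For metric spaces this instance applies to matrices as well, and so makes Lindelof's theorem available in
  matrix groups over a p-adic field.
\<close>

instance vec :: ("{metric_space, second_countable_topology}", finite) second_countable_topology
proof
  obtain B :: "'a set set" where B: "countable B" "topological_basis B"
    using ex_countable_basis by blast
  define C where "C = (\<lambda>X. {x :: ('a, 'b) vec. \<forall>i. x $ i \<in> X i}) ` (PiE UNIV (\<lambda>_. B))"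
  have "topological_basis C"
  proof (rule topological_basisI)
    fix c assume "c \<in> C"
    then obtain X where X: "X \<in> PiE UNIV (\<lambda>_. B)" "c = {x. \<forall>i. x $ i \<in> X i}" by (auto simp: C_def)
    have "open (X i)" for i using X(1) B(2) topological_basis_open by (metis PiE_mem UNIV_I)
    then have "\<forall>i. open (X i)" ..
    then show "open c" unfolding X(2) by (rule open_vector_box)
  next
    fix U :: "('a, 'b) vec set" and x
    assume "open U" "x \<in> U"
    then obtain A where A: "\<And>i. open (A i) \<and> x $ i \<in> A i" "\<And>y. (\<forall>i. y $ i \<in> A i) \<Longrightarrow> y \<in> U"
      unfolding open_vec_def by metis
    have "\<forall>i. \<exists>b\<in>B. x $ i \<in> b \<and> b \<subseteq> A i" using A(1) topological_basisE[OF B(2)] by metis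
    then obtain b where b: "\<And>i. b i \<in> B \<and> x $ i \<in> b i \<and> b i \<subseteq> A i" by metis
    have "{x. \<forall>i. x $ i \<in> b i} \<in> C" using b by (auto simp: C_def)
    moreover have "x \<in> {x. \<forall>i. x $ i \<in> b i}" "{x. \<forall>i. x $ i \<in> b i} \<subseteq> U"
      using b A(2) by (blast, blast)
    ultimately show "\<exists>B'\<in>C. x \<in> B' \<and> B' \<subseteq> U" by (intro bexI conjI)
  qed
  moreover have "countable C" unfolding C_def
    by (rule countable_image, rule countable_PiE) (simp_all add: B(1))
  ultimately show "\<exists>B::('a, 'b) vec set set. countable B \<and> open = generate_topology B"
    using topological_basis_imp_subbasis by blast
qed

section \<open>Uniqueness of Haar measure by counting cosets\<close>

text \<open>
  By the Lindelof property every relatively open set is a countable union of members of \<open>\<E>\<close>.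
\<close>

lemma sets_restrict_borel_eq_sigma_sets:
  fixes H :: "'g::second_countable_topology set"
  assumes opens: "\<And>X. X \<in> \<E> \<Longrightarrow> \<exists>V. open V \<and> X = V \<inter> H"
    and base: "\<And>U x. open U \<Longrightarrow> x \<in> U \<Longrightarrow> x \<in> H \<Longrightarrow> \<exists>X\<in>\<E>. x \<in> X \<and> X \<subseteq> U"
  shows "sets (restrict_space borel H) = sigma_sets H \<E>"
proof -
  have "sets (restrict_space borel H) = {(\<lambda>x. x) -` A \<inter> H | A. A \<in> sigma_sets UNIV {S. open S}}"
    by (auto simp: sets_restrict_space borel_def)
  also have "\<dots> = sigma_sets H {(\<lambda>x. x) -` A \<inter> H | A. A \<in> {S. open S}}"
    by (rule sigma_sets_vimage_commute) simp
  also have "\<dots> = sigma_sets H \<E>"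
  proof (intro sigma_sets_eqI)
    fix X assume "X \<in> \<E>"
    then obtain V where "open V" "X = V \<inter> H" using opens by blast
    then show "X \<in> sigma_sets H {(\<lambda>x. x) -` A \<inter> H | A. A \<in> {S. open S}}"
      by (intro sigma_sets.Basic) auto
  next
    fix A assume "A \<in> {(\<lambda>x. x) -` A \<inter> H | A. A \<in> {S. open S}}"
    then obtain U where U: "open U" "A = U \<inter> H" by auto
    define \<F> where "\<F> = {V. open V \<and> V \<inter> H \<in> \<E> \<and> V \<inter> H \<subseteq> U}"
    obtain \<F>' where \<F>': "\<F>' \<subseteq> \<F>" "countable \<F>'" "\<Union>\<F>' = \<Union>\<F>"
      using Lindelof[of \<F>] by (auto simp: \<F>_def)
    have "A \<subseteq> \<Union>((\<lambda>V. V \<inter> H) ` \<F>)"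
    proof
      fix x assume x: "x \<in> A"
      then obtain X where X: "X \<in> \<E>" "x \<in> X" "X \<subseteq> U" using base[of U x] U by blast
      obtain V where "open V" "X = V \<inter> H" using opens[OF X(1)] by blast
      with X show "x \<in> \<Union>((\<lambda>V. V \<inter> H) ` \<F>)" by (auto simp: \<F>_def)
    qed
    moreover have "\<Union>((\<lambda>V. V \<inter> H) ` \<F>) \<subseteq> A" unfolding U(2) by (auto simp: \<F>_def)
    moreover have "\<Union>((\<lambda>V. V \<inter> H) ` \<G>) = \<Union>\<G> \<inter> H" for \<G> by auto
    ultimately have "A = \<Union>((\<lambda>V. V \<inter> H) ` \<F>')" using \<F>'(3) by auto
    also have "\<dots> \<in> sigma_sets H \<E>"
    proof (rule sigma_sets_UNION)
      show "countable ((\<lambda>V. V \<inter> H) ` \<F>')" using \<F>'(2) by simp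
      show "B \<in> sigma_sets H \<E>" if B: "B \<in> (\<lambda>V. V \<inter> H) ` \<F>'" for B
      proof -
        obtain V where "V \<in> \<F>'" "B = V \<inter> H" using B by blast
        then have "B \<in> \<E>" using \<F>'(1) by (auto simp: \<F>_def)
        then show ?thesis by (rule sigma_sets.Basic)
      qed
    qed
    finally show "A \<in> sigma_sets H \<E>" .
  qed
  finally show ?thesis .
qed

lemma (in group) mem_l_coset_iff:
  assumes "subgroup K G" "g \<in> carrier G"
  shows "x \<in> g <# K \<longleftrightarrow> x \<in> carrier G \<and> inv g \<otimes> x \<in> K"
proof
  assume "x \<in> g <# K"
  then obtain h where h: "h \<in> K" "x = g \<otimes> h" by (auto simp: l_coset_def)
  then have "h \<in> carrier G" using assms(1) subgroup.mem_carrier by metis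
  with h assms(2) show "x \<in> carrier G \<and> inv g \<otimes> x \<in> K" by (simp flip: m_assoc)
next
  assume x: "x \<in> carrier G \<and> inv g \<otimes> x \<in> K"
  then have "x = g \<otimes> (inv g \<otimes> x)" using assms(2) by (simp flip: m_assoc)
  with x show "x \<in> g <# K" unfolding l_coset_def by blast
qed

text \<open>
  The part of the Haar property that can be checked for a measure given in coordinates: invariance only
  on the cosets of a decreasing chain of open compact subgroups, together with the normalization on the
  largest of them.
\<close>

definition invariant_on_cosets :: "('g, 'b) monoid_scheme \<Rightarrow> (nat \<Rightarrow> 'g set) \<Rightarrow> 'g measure \<Rightarrow> bool" where
  "invariant_on_cosets G K \<mu> \<longleftrightarrow> (\<forall>g\<in>carrier G. \<forall>n. g <#\<^bsub>G\<^esub> K n \<in> sets \<mu> \<and>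
     emeasure \<mu> (g <#\<^bsub>G\<^esub> K n) = emeasure \<mu> (K n)) \<and>
     (\<forall>n. emeasure \<mu> (K n) > 0) \<and> emeasure \<mu> (K 0) = 1"

text \<open>
  \<open>K 0\<close> is the disjoint union of the cosets of \<open>K n\<close> that it contains, and these all have the same
  positive measure; hence there are finitely many of them, and their number determines the measure.
\<close>

lemma (in group) invariant_on_cosets_value:
  assumes K: "\<And>n. subgroup (K n) G" "\<And>n. K n \<subseteq> K 0"
    and \<mu>: "invariant_on_cosets G K \<mu>"
  shows "of_nat (card ((\<lambda>g. g <# K n) ` K 0)) * emeasure \<mu> (K n) = 1"
proof -
  have K_carrier: "K m \<subseteq> carrier G" for m using K(1) subgroup.subset by blast
  have sets: "g <# K m \<in> sets \<mu>" "emeasure \<mu> (g <# K m) = emeasure \<mu> (K m)" if "g \<in> carrier G" for g m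
    using \<mu> that by (auto simp: invariant_on_cosets_def)
  have unit: "emeasure \<mu> (K 0) = 1" and pos: "emeasure \<mu> (K n) > 0"
    using \<mu> by (auto simp: invariant_on_cosets_def)
  have one_coset: "\<one> <# K m = K m" for m by (rule lcos_mult_one[OF K_carrier])
  have sets0: "K m \<in> sets \<mu>" for m using sets(1)[OF one_closed] by (simp add: one_coset)
  let ?C = "(\<lambda>g. g <# K n) ` K 0"
  have union: "\<Union>?C = K 0"
  proof
    show "\<Union>?C \<subseteq> K 0"
    proof
      fix x assume "x \<in> \<Union>?C"
      then obtain g h where "g \<in> K 0" "h \<in> K n" "x = g \<otimes> h" by (auto simp: l_coset_def)
      then show "x \<in> K 0" using K(2)[of n] subgroup.m_closed[OF K(1)[of 0]] by auto
    qed
    show "K 0 \<subseteq> \<Union>?C"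
    proof
      fix x assume x: "x \<in> K 0"
      then have "x \<in> carrier G" using K_carrier[of 0] by auto
      then have "x \<in> x <# K n" using K(1)[of n] by (simp add: mem_l_coset_iff subgroup.one_closed)
      with x show "x \<in> \<Union>?C" by blast
    qed
  qed
  have disj: "X \<inter> Y = {}" if XY: "X \<in> ?C" "Y \<in> ?C" "X \<noteq> Y" for X Y
  proof (rule ccontr)
    assume "X \<inter> Y \<noteq> {}"
    then obtain x where x: "x \<in> X" "x \<in> Y" by blast
    obtain g where g: "g \<in> K 0" "X = g <# K n" using XY(1) by auto
    obtain h where h: "h \<in> K 0" "Y = h <# K n" using XY(2) by auto
    have "g \<in> carrier G" "h \<in> carrier G" using g(1) h(1) K_carrier[of 0] by auto
    then have "X = x <# K n" "Y = x <# K n"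
      using x l_repr_independence[OF _ _ K(1)] unfolding g(2) h(2) by blast+
    with XY(3) show False by simp
  qed
  have C_sets: "X \<in> sets \<mu>" "emeasure \<mu> X = emeasure \<mu> (K n)" if X: "X \<in> ?C" for X
  proof -
    obtain g where g: "g \<in> K 0" "X = g <# K n" using X by auto
    then have "g \<in> carrier G" using K_carrier[of 0] by auto
    then show "X \<in> sets \<mu>" "emeasure \<mu> X = emeasure \<mu> (K n)" using sets g(2) by simp_all
  qed
  have finite_union: "emeasure \<mu> (\<Union>D) = of_nat (card D) * emeasure \<mu> (K n)" if "D \<subseteq> ?C" "finite D" for D
  proof -
    have "(\<Sum>X\<in>D. emeasure \<mu> X) = emeasure \<mu> (\<Union>X\<in>D. X)"
    proof (rule sum_emeasure)
      show "(\<lambda>X. X) ` D \<subseteq> sets \<mu>" using that(1) C_sets(1) by auto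
      show "disjoint_family_on (\<lambda>X. X) D"
        unfolding disjoint_family_on_def using that(1) disj by (meson subsetD)
    qed (rule that)
    moreover have "(\<Sum>X\<in>D. emeasure \<mu> X) = (\<Sum>X\<in>D. emeasure \<mu> (K n))"
      using that(1) C_sets(2) by (intro sum.cong refl) (meson subsetD)
    ultimately show ?thesis by simp
  qed
  have le1: "emeasure \<mu> (K n) \<le> 1" using emeasure_mono[OF K(2) sets0] unit by simp
  then obtain r where r: "emeasure \<mu> (K n) = ennreal r" "r > 0"
    using pos by (cases "emeasure \<mu> (K n)") (auto simp: top_unique)
  have "card D \<le> nat \<lceil>1 / r\<rceil>" if "D \<subseteq> ?C" "finite D" for D
  proof -
    have "of_nat (card D) * emeasure \<mu> (K n) \<le> emeasure \<mu> (K 0)"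
      using Union_mono[OF that(1)] unfolding finite_union[OF that, symmetric] union
      by (rule emeasure_mono[OF _ sets0])
    then have "ennreal (card D * r) \<le> 1"
      using r by (simp add: unit ennreal_mult ennreal_of_nat_eq_real_of_nat)
    then have "card D * r \<le> 1" using r(2) by simp
    then have "real (card D) \<le> 1 / r" using r(2) by (simp add: field_simps)
    then show ?thesis by linarith
  qed
  then have fin: "finite ?C" using finite_if_finite_subsets_card_bdd by blast
  show ?thesis
    using finite_union[OF subset_refl fin] union unit by simp
qed

text \<open>
  Uniqueness of Haar measure for a totally disconnected group. The cosets of the subgroups \<open>K n\<close>, together
  with the empty set, form an intersection-stable generator of the Borel sets, because two of them are
  disjoint or nested. On this generator both measures are given by counting cosets.
\<close>

theorem haar_measure_eqI:
  fixes G :: "('g::second_countable_topology) monoid" and K :: "nat \<Rightarrow> 'g set"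
  assumes G: "group G" and K: "\<And>n. subgroup (K n) G" and dec: "\<And>m n. m \<le> n \<Longrightarrow> K n \<subseteq> K m"
    and opens: "\<And>g n. g \<in> carrier G \<Longrightarrow> \<exists>V. open V \<and> g <#\<^bsub>G\<^esub> K n = V \<inter> carrier G"
    and base: "\<And>U g. open U \<Longrightarrow> g \<in> U \<Longrightarrow> g \<in> carrier G \<Longrightarrow> \<exists>n. g <#\<^bsub>G\<^esub> K n \<subseteq> U"
    and M: "haar_measure G M" "emeasure M (K 0) = 1"
    and N: "sets N = sets (restrict_space borel (carrier G))" "invariant_on_cosets G K N"
  shows "M = N"
proof -
  interpret group G by (rule G)
  have K_carrier: "K m \<subseteq> carrier G" for m using K(1) subgroup.subset by blast
  have one_coset: "\<one>\<^bsub>G\<^esub> <#\<^bsub>G\<^esub> K m = K m" for m by (rule lcos_mult_one[OF K_carrier])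
  have self: "g \<in> g <#\<^bsub>G\<^esub> K n" if "g \<in> carrier G" for g n
    using that K[of n] by (subst mem_l_coset_iff) (auto simp: subgroup.one_closed)
  let ?E = "{g <#\<^bsub>G\<^esub> K n | g n. g \<in> carrier G}"
  let ?E' = "insert {} ?E"
  have opens': "\<exists>V. open V \<and> X = V \<inter> carrier G" if "X \<in> ?E'" for X
  proof (cases "X = {}")
    case True
    then show ?thesis by (intro exI[of _ "{}"]) simp
  next
    case False
    with that obtain g n where "g \<in> carrier G" "X = g <#\<^bsub>G\<^esub> K n" by blast
    then show ?thesis using opens by simp
  qed
  have sets: "sets (restrict_space borel (carrier G)) = sigma_sets (carrier G) ?E'"
  proof (rule sets_restrict_borel_eq_sigma_sets)
    fix U x assume *: "open U" "x \<in> U" "x \<in> carrier G"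
    then obtain n where "x <#\<^bsub>G\<^esub> K n \<subseteq> U" using base by blast
    with self[OF *(3)] *(3) show "\<exists>X\<in>?E'. x \<in> X \<and> X \<subseteq> U" by blast
  qed (rule opens')
  have M_sets: "sets M = sets (restrict_space borel (carrier G))"
    using M(1) by (simp add: haar_measure_def)
  have inE: "X \<in> sets M" if "X \<in> ?E" for X
    using that unfolding M_sets sets by (intro sigma_sets.Basic) simp
  have l_coset_image: "(\<lambda>h. g \<otimes>\<^bsub>G\<^esub> h) ` X = g <#\<^bsub>G\<^esub> X" for g X by (auto simp: l_coset_def)
  have M': "invariant_on_cosets G K M"
    unfolding invariant_on_cosets_def
  proof (intro conjI ballI allI M(2))
    fix n
    have Kn: "K n \<in> ?E" using one_closed by (subst one_coset[symmetric]) blast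
    then obtain V where V: "open V" "K n = V \<inter> carrier G" using opens'[of "K n"] by auto
    moreover have "K n \<noteq> {}" using subgroup.one_closed[OF K] by blast
    ultimately show "emeasure M (K n) > 0" using M(1) by (simp add: haar_measure_def)
    fix g assume g: "g \<in> carrier G"
    then show "g <#\<^bsub>G\<^esub> K n \<in> sets M" by (intro inE) blast
    show "emeasure M (g <#\<^bsub>G\<^esub> K n) = emeasure M (K n)"
      using M(1) g inE[OF Kn] by (simp add: haar_measure_def flip: l_coset_image)
  qed
  have eq: "emeasure M (K n) = emeasure N (K n)" for n
  proof -
    define k where "k = (of_nat (card ((\<lambda>g. g <#\<^bsub>G\<^esub> K n) ` K 0)) :: ennreal)"
    have k: "k * emeasure M (K n) = 1" "k * emeasure N (K n) = 1"
      unfolding k_def using dec M' N(2) by (auto intro!: invariant_on_cosets_value K)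
    have "emeasure M (K n) = (k * emeasure N (K n)) * emeasure M (K n)" by (simp add: k(2))
    also have "\<dots> = (k * emeasure M (K n)) * emeasure N (K n)" by (simp only: mult_ac)
    finally show ?thesis by (simp add: k(1))
  qed
  have cover: "\<exists>A\<subseteq>(\<lambda>g. g <#\<^bsub>G\<^esub> K 0) ` carrier G. countable A \<and> \<Union>A = carrier G"
  proof -
    define \<F> where "\<F> = {V. open V \<and> V \<inter> carrier G \<in> (\<lambda>g. g <#\<^bsub>G\<^esub> K 0) ` carrier G}"
    obtain \<F>' where \<F>': "\<F>' \<subseteq> \<F>" "countable \<F>'" "\<Union>\<F>' = \<Union>\<F>"
      using Lindelof[of \<F>] by (auto simp: \<F>_def)
    have "carrier G \<subseteq> \<Union>\<F>"
    proof
      fix g assume g: "g \<in> carrier G"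
      obtain V where "open V" "g <#\<^bsub>G\<^esub> K 0 = V \<inter> carrier G" using opens[OF g] by blast
      with self[OF g, of 0] g show "g \<in> \<Union>\<F>" by (auto simp: \<F>_def)
    qed
    then show ?thesis using \<F>'
      by (intro exI[of _ "(\<lambda>V. V \<inter> carrier G) ` \<F>'"]) (auto simp: \<F>_def)
  qed
  then obtain A where A: "A \<subseteq> (\<lambda>g. g <#\<^bsub>G\<^esub> K 0) ` carrier G" "countable A" "\<Union>A = carrier G" by blast
  show "M = N"
  proof (rule measure_eqI_generator_eq_countable[of ?E' "carrier G" _ _ A])
    show "Int_stable ?E'"
      unfolding Int_stable_def
    proof (intro ballI)
      fix X Y assume XY: "X \<in> ?E'" "Y \<in> ?E'"
      show "X \<inter> Y \<in> ?E'"
      proof (cases "X \<inter> Y = {}")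
        case False
        then obtain x where x: "x \<in> X" "x \<in> Y" by blast
        have "X \<in> ?E" "Y \<in> ?E" using XY x by auto
        then obtain g m h n where g: "g \<in> carrier G" "X = g <#\<^bsub>G\<^esub> K m"
          and h: "h \<in> carrier G" "Y = h <#\<^bsub>G\<^esub> K n" by auto
        have xc: "x \<in> carrier G" using x(1) g K by (simp add: mem_l_coset_iff)
        have "X = x <#\<^bsub>G\<^esub> K m" "Y = x <#\<^bsub>G\<^esub> K n"
          using x g(1) h(1) l_repr_independence[OF _ _ K] unfolding g(2) h(2) by blast+
        moreover have "y \<in> K (max m n) \<longleftrightarrow> y \<in> K m \<and> y \<in> K n" for y
          using dec[of m n] dec[of n m] by (cases "m \<le> n") (auto simp: max_def)
        ultimately have "X \<inter> Y = x <#\<^bsub>G\<^esub> K (max m n)"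
          by (auto simp: mem_l_coset_iff[OF K xc])
        then show ?thesis using xc by blast
      qed simp
    qed
    show "?E' \<subseteq> Pow (carrier G)" using K by (auto simp: mem_l_coset_iff)
    show "emeasure M X = emeasure N X" if "X \<in> ?E'" for X
      using that M' N(2) eq by (auto simp: invariant_on_cosets_def)
    show "emeasure M a \<noteq> \<infinity>" if "a \<in> A" for a
      using that A(1) M' by (auto simp: invariant_on_cosets_def)
  qed (use A M_sets N(1) sets in auto)
qed

section \<open>Scaling of Haar measure on a p-adic field\<close>

lemma group_additive_group: "group (additive_group :: 'a::ab_group_add monoid)"
proof (rule groupI)
  show "\<exists>y\<in>carrier additive_group. y \<otimes>\<^bsub>additive_group\<^esub> x = \<one>\<^bsub>additive_group\<^esub>" for x :: 'a
    by (rule bexI[of _ "- x"]) (simp_all add: additive_group_def)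
qed (simp_all add: additive_group_def add.assoc)

lemma l_coset_additive_group: "g <#\<^bsub>additive_group\<^esub> X = (+) g ` X"
  by (auto simp: l_coset_def additive_group_def)

lemma subgroup_max_ideal_power: "subgroup (max_ideal_power n :: 'a::padic_field set) additive_group"
proof -
  interpret group "additive_group :: 'a monoid" by (rule group_additive_group)
  have "inv\<^bsub>additive_group\<^esub> x = - x" for x :: 'a
    by (rule inv_equality) (simp_all add: additive_group_def)
  then show ?thesis
    by (intro subgroupI) (auto simp: additive_group_def max_ideal_power_minus max_ideal_power_add
        intro: max_ideal_power_zero)
qed

lemma open_plus_image: "open S \<Longrightarrow> open ((+) (g::'a::padic_field) ` S)"
proof -
  assume S: "open S"
  have "(+) g ` S = (\<lambda>t. t - g) -` S" by (auto simp: image_iff intro!: bexI[of _ "_ - g"])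
  then show ?thesis using S by (auto intro!: open_vimage continuous_intros)
qed

lemma ring_of_integers_borel: "ring_of_integers \<in> sets (borel :: 'a::padic_field measure)"
  unfolding max_ideal_power_0[symmetric] using open_max_ideal_power by (rule borel_open)

locale normalized_haar =
  fixes dc :: "'a::padic_field measure"
  assumes haar: "haar_measure additive_group dc"
    and normalized: "emeasure dc ring_of_integers = 1"
begin

lemma sets_dc [simp, measurable_cong]: "sets dc = sets borel"
  using haar by (simp add: haar_measure_def additive_group_def sets_restrict_space)

lemma space_dc [simp]: "space dc = UNIV"
  using haar by (simp add: haar_measure_def additive_group_def)

lemma emeasure_translate: "X \<in> sets borel \<Longrightarrow> emeasure dc ((+) a ` X) = emeasure dc X"
  using haar by (simp add: haar_measure_def additive_group_def)

lemma emeasure_open_pos: "open V \<Longrightarrow> V \<noteq> {} \<Longrightarrow> emeasure dc V > 0"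
  using haar by (simp add: haar_measure_def additive_group_def)

lemma haar_eqI:
  assumes "sets N = sets borel" "\<And>a n. emeasure N ((+) a ` max_ideal_power n) = emeasure N (max_ideal_power n)"
    "\<And>n. emeasure N (max_ideal_power n) > 0" "emeasure N ring_of_integers = 1"
  shows "dc = N"
proof (rule haar_measure_eqI[OF group_additive_group subgroup_max_ideal_power])
  show "max_ideal_power n \<subseteq> (max_ideal_power m :: 'a set)" if "m \<le> n" for m n
    using that max_ideal_power_le by blast
  have op: "open ((+) g ` max_ideal_power n)" for g :: 'a and n
    using open_max_ideal_power by (rule open_plus_image)
  show "\<exists>V. open V \<and> g <#\<^bsub>additive_group\<^esub> max_ideal_power n = V \<inter> carrier additive_group" for g :: 'a and n
    by (intro exI[of _ "(+) g ` max_ideal_power n"]) (simp add: op l_coset_additive_group, simp add: additive_group_def)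
  show "\<exists>n. g <#\<^bsub>additive_group\<^esub> max_ideal_power n \<subseteq> U" if "open U" "g \<in> U" for U and g :: 'a
  proof -
    obtain e where e: "e > 0" "\<And>y. dist y g < e \<Longrightarrow> y \<in> U" using \<open>open U\<close> \<open>g \<in> U\<close> unfolding open_dist by blast
    obtain n where n: "absv (uniformizer :: 'a) ^ n < e" using uniformizer_power_arch[OF e(1)] .
    have "(+) g ` max_ideal_power n \<subseteq> U" using n e(2) by (auto simp: dist_absv max_ideal_power_def)
    then show ?thesis unfolding l_coset_additive_group by blast
  qed
  show "haar_measure additive_group dc" by (rule haar)
  show "emeasure dc (max_ideal_power 0) = 1" using normalized by (simp add: max_ideal_power_0)
  show "sets N = sets (restrict_space borel (carrier additive_group))"
    using assms(1) by (simp add: additive_group_def sets_restrict_space)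
  show "invariant_on_cosets additive_group max_ideal_power N"
    using assms op by (simp add: invariant_on_cosets_def l_coset_additive_group max_ideal_power_0)
qed

lemma measurable_affine [measurable]: "(\<lambda>t. a * t + b) \<in> borel_measurable (borel :: 'a measure)"
  by (intro borel_measurable_continuous_onI continuous_intros continuous_on_mult')

lemma measurable_divide_const [measurable]: "(\<lambda>t. t / a) \<in> borel_measurable (borel :: 'a measure)"
  using measurable_affine[of "1 / a" 0] by simp

lemma image_mult_eq_vimage: "a \<noteq> 0 \<Longrightarrow> (*) a ` X = (\<lambda>t. t / a) -` X" for a :: 'a
  by (auto simp: image_iff intro!: bexI[of _ "_ / a"])

lemma sets_image_mult: "a \<noteq> 0 \<Longrightarrow> X \<in> sets borel \<Longrightarrow> (*) a ` X \<in> sets borel" for a :: 'a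
  unfolding image_mult_eq_vimage using measurable_sets[OF measurable_divide_const, of X a] by simp

text \<open>
  The measure \<open>X \<mapsto> dc (a X)\<close> is a Haar measure again, so that by uniqueness the scaling factor can be read
  off from the ring of integers.
\<close>

lemma emeasure_scale_by_integers:
  assumes a: "a \<noteq> 0" and c: "emeasure dc ((*) a ` ring_of_integers) = ennreal c" "c > 0"
    and X: "X \<in> sets borel"
  shows "emeasure dc ((*) a ` X) = ennreal c * emeasure dc X"
proof -
  define N where "N = scale_measure (ennreal (1 / c)) (distr dc borel (\<lambda>t. t / a))"
  have N: "emeasure N Y = ennreal (1 / c) * emeasure dc ((*) a ` Y)" if "Y \<in> sets borel" for Y
    unfolding N_def emeasure_scale_measure image_mult_eq_vimage[OF a]
    by (subst emeasure_distr) (use that in \<open>simp_all add: measurable_cong_sets[OF sets_dc refl]\<close>)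
  have op: "open ((*) a ` max_ideal_power n)" for n
  proof -
    have "continuous_on UNIV (\<lambda>t. t * (1 / a))"
      by (intro continuous_intros continuous_on_mult')
    then show ?thesis unfolding image_mult_eq_vimage[OF a]
      by (intro open_vimage open_max_ideal_power) simp
  qed
  have "dc = N"
  proof (rule haar_eqI)
    show "sets N = sets borel" by (simp add: N_def)
    fix n
    have mem: "max_ideal_power n \<in> sets (borel :: 'a measure)" using open_max_ideal_power by (rule borel_open)
    have "(*) a ` max_ideal_power n \<noteq> {}" using max_ideal_power_zero by blast
    then have "emeasure dc ((*) a ` max_ideal_power n) > 0" using op by (intro emeasure_open_pos)
    then show "emeasure N (max_ideal_power n) > 0"
      using c(2) mem by (simp add: N ennreal_zero_less_mult_iff)
    fix b :: 'a
    have "(+) b ` max_ideal_power n \<in> sets borel"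
      using open_plus_image[OF open_max_ideal_power] by (rule borel_open)
    moreover have "(*) a ` (+) b ` max_ideal_power n = (+) (a * b) ` (*) a ` max_ideal_power n"
      by (simp add: image_image distrib_left)
    ultimately show "emeasure N ((+) b ` max_ideal_power n) = emeasure N (max_ideal_power n)"
      using mem by (simp add: N emeasure_translate borel_open op)
  next
    show "emeasure N ring_of_integers = 1"
      using c by (simp add: N ring_of_integers_borel flip: ennreal_mult)
  qed
  then have "emeasure dc X = ennreal (1 / c) * emeasure dc ((*) a ` X)" using N[OF X] by simp
  moreover have "ennreal c * ennreal (1 / c) = 1" using c(2) by (simp flip: ennreal_mult)
  ultimately show ?thesis by (simp add: mult.assoc[symmetric])
qed

text \<open>
  The maximal ideal has index \<open>q\<close> in the ring of integers, and \<open>1 / q\<close> is the normalized absolute value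
  of the uniformizer.
\<close>

lemma emeasure_uniformizer_image:
  "emeasure dc ((*) uniformizer ` ring_of_integers) = ennreal (absv (uniformizer :: 'a))"
proof -
  let ?m = "{y::'a. absv y < 1}"
  let ?q = "card (residue_classes :: 'a set set)"
  have m: "?m = max_ideal_power 1" by (rule max_ideal_power_1[symmetric])
  have m_sets: "?m \<in> sets borel" unfolding m using open_max_ideal_power by (rule borel_open)
  have cls: "{y. absv (x - y) < 1} = (+) x ` ?m" for x :: 'a
  proof (intro equalityI subsetI)
    fix y assume "y \<in> {y. absv (x - y) < 1}"
    then show "y \<in> (+) x ` ?m" by (intro image_eqI[of _ _ "y - x"]) (simp_all add: absv_minus_commute)
  qed auto
  have val: "X \<in> sets dc" "emeasure dc X = emeasure dc ?m" if X: "X \<in> residue_classes" for X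
  proof -
    obtain x where "X = {y. absv (x - y) < 1}" using X by (auto simp: residue_classes_altdef)
    then have "X = (+) x ` ?m" by (simp only: cls)
    moreover have "open ((+) x ` ?m)" for x unfolding m using open_max_ideal_power by (rule open_plus_image)
    ultimately show "X \<in> sets dc" "emeasure dc X = emeasure dc ?m" using m_sets by (simp_all add: emeasure_translate)
  qed
  have disj: "disjoint (residue_classes :: 'a set set)"
  proof (rule disjointI)
    fix X Y :: "'a set" assume XY: "X \<in> residue_classes" "Y \<in> residue_classes" "X \<noteq> Y"
    then obtain x y where x: "X = {z. absv (x - z) < 1}" and y: "Y = {z. absv (y - z) < 1}"
      by (auto simp: residue_classes_altdef)
    show "X \<inter> Y = {}"
    proof (rule ccontr)
      assume "X \<inter> Y \<noteq> {}"
      then obtain z where z: "absv (x - z) < 1" "absv (y - z) < 1" by (auto simp: x y)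
      have "absv (x - y) < 1" using z absv_ultrametric_diff[of "x - z" "y - z"] by simp
      then have "absv (x - w) < 1 \<longleftrightarrow> absv (y - w) < 1" for w
        using absv_ultrametric[of "x - y" "y - w"] absv_ultrametric_diff[of "x - w" "x - y"] by auto
      then have "X = Y" by (simp add: x y)
      with XY(3) show False ..
    qed
  qed
  have union: "\<Union>(residue_classes :: 'a set set) = ring_of_integers"
  proof (intro equalityI subsetI)
    fix z :: 'a assume "z \<in> \<Union>residue_classes"
    then obtain x :: 'a where "absv x \<le> 1" "absv (x - z) < 1" by (auto simp: residue_classes_altdef)
    then show "z \<in> ring_of_integers"
      using absv_ultrametric_diff[of x "x - z"] by (simp add: ring_of_integers_def)
  next
    fix z :: 'a assume "z \<in> ring_of_integers"
    then show "z \<in> \<Union>residue_classes" by (auto simp: residue_classes_altdef ring_of_integers_def)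
  qed
  have "(1::ennreal) = emeasure dc (\<Union>X\<in>residue_classes. X)" using normalized by (simp add: union)
  also have "\<dots> = (\<Sum>X\<in>residue_classes. emeasure dc X)"
  proof (rule sum_emeasure[symmetric])
    show "(\<lambda>X. X) ` residue_classes \<subseteq> sets dc" using val(1) by auto
    show "disjoint_family_on (\<lambda>X. X) (residue_classes :: 'a set set)"
      using disj by (auto simp: disjoint_family_on_def disjoint_def)
  qed (rule finite_residue_classes)
  also have "\<dots> = of_nat ?q * emeasure dc ?m" by (simp add: val(2))
  finally have 1: "of_nat ?q * emeasure dc ?m = 1" ..
  have q: "?q > 0" using card_residue_classes[where 'a = 'a] by simp
  have "emeasure dc ?m = ennreal (1 / ?q) * (of_nat ?q * emeasure dc ?m)"
    using q by (simp add: ennreal_of_nat_eq_real_of_nat flip: mult.assoc ennreal_mult del: divide_ennreal_def)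
  also have "\<dots> = ennreal (1 / ?q)" unfolding 1 by simp
  finally show ?thesis
    using max_ideal_power_eq_image[of 1, where 'a = 'a] by (simp add: absv_uniformizer m)
qed

text \<open>
  Multiplication by units preserves the ring of integers; the general case follows by writing an integral
  \<open>a\<close> as a unit times a power of the uniformizer, and a non-integral one as the inverse of an integral one.
\<close>

lemma emeasure_scale:
  assumes "a \<noteq> 0" "X \<in> sets borel"
  shows "emeasure dc ((*) a ` X) = ennreal (absv a) * emeasure dc X"
proof -
  have le1: "emeasure dc ((*) a ` X) = ennreal (absv a) * emeasure dc X"
    if a: "a \<noteq> 0" "absv a \<le> 1" and X: "X \<in> sets borel" for a :: 'a and X
  proof -
    obtain u n where u: "absv u = 1" "a = u * uniformizer ^ n" using absv_eq_power_uniformizer[OF a] .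
    then have u0: "u \<noteq> 0" by auto
    have "(*) u ` ring_of_integers = ring_of_integers"
    proof (intro equalityI subsetI)
      fix x :: 'a assume "x \<in> ring_of_integers"
      then show "x \<in> (*) u ` ring_of_integers"
        using u0 u(1) by (intro image_eqI[of _ _ "x / u"]) (simp_all add: ring_of_integers_def absv_divide)
    qed (use u(1) in \<open>auto simp: ring_of_integers_def absv_mult\<close>)
    then have unit: "emeasure dc ((*) u ` Y) = emeasure dc Y" if "Y \<in> sets borel" for Y
      using emeasure_scale_by_integers[OF u0 _ _ that, of 1] normalized by simp
    have pow: "emeasure dc ((*) (uniformizer ^ k) ` X) = ennreal (absv (uniformizer :: 'a) ^ k) * emeasure dc X" for k
    proof (induction k)
      case (Suc k)
      have "(*) (uniformizer ^ Suc k) ` X = (*) uniformizer ` (*) (uniformizer ^ k) ` X"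
        by (simp add: image_image mult.assoc)
      then show ?case
        using emeasure_scale_by_integers[OF _ emeasure_uniformizer_image, of "(*) (uniformizer ^ k) ` X"]
          sets_image_mult[OF _ X, of "uniformizer ^ k"] Suc
        by (simp add: ennreal_mult mult.assoc)
    qed simp
    have "(*) a ` X = (*) u ` (*) (uniformizer ^ n) ` X"
      unfolding u(2) by (simp add: image_image mult.assoc)
    then show ?thesis
      using unit[OF sets_image_mult[OF _ X, of "uniformizer ^ n"]] pow[of n] u
      by (simp add: absv_mult absv_power)
  qed
  show ?thesis
  proof (cases "absv a \<le> 1")
    case False
    have "emeasure dc ((*) (1 / a) ` (*) a ` X) = ennreal (absv (1 / a)) * emeasure dc ((*) a ` X)"
      using False assms by (intro le1 sets_image_mult) (auto simp: absv_divide)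
    moreover have "(*) (1 / a) ` (*) a ` X = X" using assms(1) by (simp add: image_image)
    ultimately have "ennreal (absv a) * emeasure dc X
        = ennreal (absv a * absv (1 / a)) * emeasure dc ((*) a ` X)"
      by (simp add: ennreal_mult mult.assoc)
    then show ?thesis using assms(1) by (simp add: absv_divide)
  qed (use assms le1 in blast)
qed

lemma nn_integral_affine:
  assumes a: "a \<noteq> 0" and h [measurable]: "h \<in> borel_measurable borel"
  shows "(\<integral>\<^sup>+ t. h (a * t + b) * ennreal (absv a) \<partial>dc) = (\<integral>\<^sup>+ t. h t \<partial>dc)"
proof -
  have "distr dc dc (\<lambda>t. a * t + b) = scale_measure (ennreal (1 / absv a)) dc"
  proof (rule measure_eqI)
    fix X assume "X \<in> sets (distr dc dc (\<lambda>t. a * t + b))"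
    then have X: "X \<in> sets borel" by simp
    have "(+) (- b) ` X = (\<lambda>t. 1 * t + b) -` X" by (auto simp: image_iff intro!: bexI[of _ "_ + b"])
    then have sets: "(+) (- b) ` X \<in> sets borel"
      using measurable_sets[OF measurable_affine[of 1 b] X] by simp
    have a': "1 / a \<noteq> 0" using a by simp
    have eq: "(\<lambda>t. a * t + b) -` X = (*) (1 / a) ` (+) (- b) ` X"
    proof (intro equalityI subsetI)
      fix t assume "t \<in> (\<lambda>t. a * t + b) -` X"
      then show "t \<in> (*) (1 / a) ` (+) (- b) ` X"
        using a by (intro image_eqI[of _ _ "a * t"] image_eqI[of _ _ "a * t + b"]) simp_all
    qed (use a in auto)
    have "emeasure (distr dc dc (\<lambda>t. a * t + b)) X = emeasure dc ((*) (1 / a) ` (+) (- b) ` X)"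
      unfolding eq[symmetric] using X
      by (subst emeasure_distr) (simp_all add: measurable_cong_sets[OF sets_dc sets_dc])
    also have "\<dots> = ennreal (absv (1 / a)) * emeasure dc X"
      unfolding emeasure_scale[OF a' sets] emeasure_translate[OF X] ..
    finally show "emeasure (distr dc dc (\<lambda>t. a * t + b)) X = emeasure (scale_measure (ennreal (1 / absv a)) dc) X"
      by (simp add: absv_divide)
  qed simp
  then have "(\<integral>\<^sup>+ t. h (a * t + b) \<partial>dc) = ennreal (1 / absv a) * (\<integral>\<^sup>+ t. h t \<partial>dc)"
    using nn_integral_distr[of "\<lambda>t. a * t + b" dc dc h] by (simp add: nn_integral_scale_measure)
  moreover have "(\<lambda>t. h (a * t + b)) \<in> borel_measurable dc"
    unfolding measurable_cong_sets[OF sets_dc refl] by measurable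
  ultimately have "(\<integral>\<^sup>+ t. h (a * t + b) * ennreal (absv a) \<partial>dc)
      = ennreal (absv a * (1 / absv a)) * (\<integral>\<^sup>+ t. h t \<partial>dc)"
    by (subst nn_integral_multc) (simp_all only: ennreal_mult[OF absv_nonneg] absv_nonneg zero_le_divide_1_iff mult_ac)
  also have "absv a * (1 / absv a) = 1" using a by simp
  finally show ?thesis by simp
qed

text \<open>
  The origin is fixed by multiplication with the uniformizer, which shrinks volumes.
\<close>

lemma emeasure_singleton_0: "emeasure dc {0} = 0"
proof (rule ccontr)
  assume nz: "emeasure dc {0} \<noteq> 0"
  have eq: "emeasure dc ({0::'a}) = ennreal (absv (uniformizer :: 'a)) * emeasure dc {0}"
    using emeasure_scale[of uniformizer "{0}"] by simp
  have "emeasure dc {0} \<le> emeasure dc ring_of_integers"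
    by (rule emeasure_mono) (simp_all add: ring_of_integers_borel, simp add: ring_of_integers_def)
  then obtain r where r: "emeasure dc {0} = ennreal r" "r \<ge> 0"
    unfolding normalized by (cases "emeasure dc {0}") (auto simp: top_unique)
  with nz have r0: "r > 0" by (simp add: less_le)
  have "ennreal r = ennreal (absv (uniformizer :: 'a) * r)"
    using eq unfolding r(1) by (simp add: ennreal_mult r(2))
  then have "r = absv (uniformizer :: 'a) * r" using r(2) by (simp add: ennreal_inj)
  then show False using absv_uniformizer_less_1[where 'a = 'a] r0 by simp
qed

lemma sigma_finite_dc: "sigma_finite_measure dc"
proof
  have "countable (range (\<lambda>k. (*) (1 / uniformizer ^ k) ` (ring_of_integers :: 'a set)))" by simp
  moreover have "\<Union>(range (\<lambda>k. (*) (1 / uniformizer ^ k) ` (ring_of_integers :: 'a set))) = UNIV"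
  proof (intro equalityI subsetI)
    fix x :: 'a
    obtain k where k: "uniformizer ^ k * x \<in> ring_of_integers" using exists_scaled_integral by blast
    have "x \<in> (*) (1 / uniformizer ^ k) ` ring_of_integers"
      by (rule image_eqI[OF _ k]) simp
    then show "x \<in> \<Union>(range (\<lambda>k. (*) (1 / uniformizer ^ k) ` (ring_of_integers :: 'a set)))" by blast
  qed simp
  moreover have "(*) (1 / uniformizer ^ k) ` ring_of_integers \<in> sets dc"
      "emeasure dc ((*) (1 / uniformizer ^ k) ` ring_of_integers) \<noteq> \<infinity>" for k
  proof -
    have "1 / uniformizer ^ k \<noteq> (0::'a)" by simp
    from sets_image_mult[OF this ring_of_integers_borel] emeasure_scale[OF this ring_of_integers_borel]
    show "(*) (1 / uniformizer ^ k) ` ring_of_integers \<in> sets dc"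
      "emeasure dc ((*) (1 / uniformizer ^ k) ` ring_of_integers) \<noteq> \<infinity>" by (simp_all add: normalized)
  qed
  ultimately show "\<exists>A. countable A \<and> A \<subseteq> sets dc \<and> \<Union> A = space dc \<and> (\<forall>a\<in>A. emeasure dc a \<noteq> \<infinity>)"
    by (intro exI[of _ "range (\<lambda>k. (*) (1 / uniformizer ^ k) ` (ring_of_integers :: 'a set))"])
       auto
qed

sublocale sigma_finite_measure dc by (rule sigma_finite_dc)

sublocale product_sigma_finite "\<lambda>_::'i. dc" by standard

end

section \<open>Changes of variables\<close>

lemma continuous_on_inverse_padic: "continuous_on (- {0}) (inverse :: 'a::padic_field \<Rightarrow> 'a)"
  unfolding continuous_on_iff
proof (intro ballI allI impI)
  fix a :: 'a and e :: real
  assume a: "a \<in> - {0}" and e: "e > 0"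
  define d where "d = min (absv a) (e * absv a * absv a)"
  have d: "d > 0" using a e by (simp add: d_def)
  moreover have "dist (inverse x) (inverse a) < e" if x: "dist x a < d" "x \<in> - {0}" for x
  proof -
    have xa: "absv (x - a) < d" using x by (simp add: dist_absv)
    then have "absv (x - a) < absv a" by (simp add: d_def)
    then have "absv a \<le> absv x"
      using absv_ultrametric_diff[of x "x - a"] by (simp add: max_def split: if_splits)
    then have "absv a * absv a \<le> absv x * absv a" by (rule mult_right_mono) simp
    have "inverse x - inverse a = (a - x) / (x * a)"
      using a x(2) by (simp add: field_simps)
    then have "dist (inverse x) (inverse a) = absv (x - a) / (absv x * absv a)"
      by (simp add: dist_absv absv_divide absv_mult absv_minus_commute)
    also have "\<dots> < d / (absv x * absv a)"
      using a x(2) xa by (intro divide_strict_right_mono) simp_all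
    also have "\<dots> \<le> d / (absv a * absv a)"
      using a d \<open>absv a * absv a \<le> absv x * absv a\<close> by (intro divide_left_mono) (simp_all add: x(2)[simplified])
    also have "\<dots> \<le> e" using a by (simp add: d_def divide_le_eq mult.assoc)
    finally show ?thesis .
  qed
  ultimately show "\<exists>d>0. \<forall>x\<in>- {0}. dist x a < d \<longrightarrow> dist (inverse x) (inverse a) < e" by blast
qed

lemma borel_measurable_absv [measurable]: "absv \<in> borel_measurable (borel :: 'a::padic_field measure)"
proof -
  have "(\<lambda>x::'a. dist x 0) \<in> borel_measurable borel"
    by (intro borel_measurable_continuous_onI continuous_intros)
  then show ?thesis by (simp add: dist_absv)
qed

lemma borel_measurable_padic_times [measurable (raw)]:
  assumes "f \<in> borel_measurable M" "g \<in> borel_measurable M"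
  shows "(\<lambda>x. f x * g x :: 'a::padic_field) \<in> borel_measurable M"
  using assms by (rule borel_measurable_continuous_Pair) (intro continuous_intros continuous_on_mult')

lemma borel_measurable_padic_divide [measurable (raw)]:
  assumes f: "f \<in> borel_measurable M" and [measurable]: "g \<in> borel_measurable M"
  shows "(\<lambda>x. f x / g x :: 'a::padic_field) \<in> borel_measurable M"
proof -
  have [measurable]: "inverse \<in> borel_measurable (borel :: 'a measure)"
    by (rule borel_measurable_continuous_countable_exceptions[of "{0}"])
       (simp_all add: continuous_on_inverse_padic)
  have "(\<lambda>x. inverse (g x)) \<in> borel_measurable M" by measurable
  then show ?thesis unfolding divide_inverse using f by measurable
qed

lemma borel_measurable_padic_add [measurable (raw)]:
  assumes "f \<in> borel_measurable M" "g \<in> borel_measurable M"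
  shows "(\<lambda>x. f x + g x :: 'a::padic_field) \<in> borel_measurable M"
  using assms by (rule borel_measurable_continuous_Pair) (intro continuous_intros)

lemma borel_measurable_padic_diff [measurable (raw)]:
  assumes "f \<in> borel_measurable M" "g \<in> borel_measurable M"
  shows "(\<lambda>x. f x - g x :: 'a::padic_field) \<in> borel_measurable M"
  using assms by (rule borel_measurable_continuous_Pair) (intro continuous_intros)

text \<open>
  The map \<open>T\<close> satisfies the substitution rule with Jacobian \<open>J\<close> and has a measurable inverse on a set \<open>G\<close> of
  full measure in the target. More cannot be asked: \<open>Phi\<close> is invertible only where \<open>c\<^sub>3, c\<^sub>4, c\<^sub>5\<close> do not
  vanish, and its fibres over the remaining points may be empty or infinite.
\<close>

definition change_of_variables ::
  "'x measure \<Rightarrow> 'y measure \<Rightarrow> ('x \<Rightarrow> 'y) \<Rightarrow> ('x \<Rightarrow> ennreal) \<Rightarrow> bool" where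
  "change_of_variables M N T J \<longleftrightarrow> T \<in> measurable M N \<and> J \<in> borel_measurable M \<and>
     (\<forall>h\<in>borel_measurable N. (\<integral>\<^sup>+ x. h (T x) * J x \<partial>M) = (\<integral>\<^sup>+ y. h y \<partial>N)) \<and>
     (\<exists>S\<in>measurable N M. \<exists>G\<in>sets N. (AE y in N. y \<in> G) \<and>
        (\<forall>x\<in>space M. T x \<in> G \<longrightarrow> S (T x) = x) \<and> (\<forall>y\<in>G. T (S y) = y))"

text \<open>
  What the map sends outside of a set of full measure is invisible to the measure with density \<open>J\<close>, although
  it need not be a null set in the source.
\<close>

lemma change_of_variables_AE:
  assumes "T \<in> measurable M N" "J \<in> borel_measurable M"
    and int: "\<And>h. h \<in> borel_measurable N \<Longrightarrow> (\<integral>\<^sup>+ x. h (T x) * J x \<partial>M) = (\<integral>\<^sup>+ y. h y \<partial>N)"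
    and G: "G \<in> sets N" "AE y in N. y \<in> G"
  shows "AE x in M. T x \<in> G \<or> J x = 0"
proof -
  note [measurable] = assms(1,2) G(1)
  have "(\<integral>\<^sup>+ x. indicator (space N - G) (T x) * J x \<partial>M) = (\<integral>\<^sup>+ y. indicator (space N - G) y \<partial>N)"
    by (rule int) measurable
  also have "\<dots> = 0" using G(2) by (subst nn_integral_0_iff_AE) (auto simp: indicator_def elim!: eventually_mono)
  finally have "AE x in M. indicator (space N - G) (T x) * J x = (0::ennreal)"
    by (subst (asm) nn_integral_0_iff_AE) measurable
  then show ?thesis
  proof (rule AE_mp[OF _ AE_I2], intro impI)
    fix x assume "x \<in> space M" "indicator (space N - G) (T x) * J x = (0::ennreal)"
    moreover have "T x \<in> space N" using assms(1) \<open>x \<in> space M\<close> by (rule measurable_space)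
    ultimately show "T x \<in> G \<or> J x = 0" by (auto simp: indicator_def split: if_splits)
  qed
qed

text \<open>
  Almost every point of the target has exactly one preimage, so that the counting integral in the
  definition of the pullback is the measure of a preimage under the inverse map, which the
  substitution rule moves to the source.
\<close>

theorem pullback_measure_eq_density:
  assumes "change_of_variables D \<mu> f J"
  shows "pullback_measure D f \<mu> = density D J"
proof -
  from assms have f [measurable]: "f \<in> measurable D \<mu>" and J [measurable]: "J \<in> borel_measurable D"
    and int: "\<And>h. h \<in> borel_measurable \<mu> \<Longrightarrow> (\<integral>\<^sup>+ x. h (f x) * J x \<partial>D) = (\<integral>\<^sup>+ y. h y \<partial>\<mu>)"
    by (auto simp: change_of_variables_def)
  from assms obtain S G where S [measurable]: "S \<in> measurable \<mu> D" and G [measurable]: "G \<in> sets \<mu>"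
    and AE_G: "AE y in \<mu>. y \<in> G"
    and S_f: "\<And>x. x \<in> space D \<Longrightarrow> f x \<in> G \<Longrightarrow> S (f x) = x" and f_S: "\<And>y. y \<in> G \<Longrightarrow> f (S y) = y"
    unfolding change_of_variables_def by blast
  have AE_f: "AE x in D. f x \<in> G \<or> J x = 0" by (rule change_of_variables_AE[OF f J int G AE_G])
  have eq: "(\<integral>\<^sup>+ y. emeasure (count_space UNIV) {x \<in> X. f x = y} \<partial>\<mu>) = emeasure (density D J) X"
    if X [measurable]: "X \<in> sets D" for X
  proof -
    have "(\<integral>\<^sup>+ y. emeasure (count_space UNIV) {x \<in> X. f x = y} \<partial>\<mu>) = (\<integral>\<^sup>+ y. indicator X (S y) \<partial>\<mu>)"
    proof (rule nn_integral_cong_AE, rule AE_mp[OF AE_G AE_I2], intro impI)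
      fix y assume y: "y \<in> space \<mu>" "y \<in> G"
      have "{x \<in> X. f x = y} = (if S y \<in> X then {S y} else {})"
        using S_f f_S[OF y(2)] y(2) sets.sets_into_space[OF X] by auto
      then show "emeasure (count_space UNIV) {x \<in> X. f x = y} = indicator X (S y)"
        by (simp add: indicator_def)
    qed
    also have "\<dots> = (\<integral>\<^sup>+ x. indicator X (S (f x)) * J x \<partial>D)" by (rule int[symmetric]) measurable
    also have "\<dots> = (\<integral>\<^sup>+ x. J x * indicator X x \<partial>D)"
    proof (rule nn_integral_cong_AE, rule AE_mp[OF AE_f AE_I2], intro impI)
      fix x assume "x \<in> space D" "f x \<in> G \<or> J x = 0"
      then show "indicator X (S (f x)) * J x = J x * indicator X x" using S_f by (auto simp: mult.commute)
    qed
    also have "\<dots> = emeasure (density D J) X" by (subst emeasure_density) measurable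
    finally show ?thesis .
  qed
  have "pullback_measure D f \<mu> = measure_of (space D) (sets D) (emeasure (density D J))"
    unfolding pullback_measure_def using eq
    by (intro measure_of_eq) (simp_all add: sets.space_closed sets.sigma_sets_eq)
  also have "\<dots> = density D J" using measure_of_of_measure[of "density D J"] by simp
  finally show ?thesis .
qed

text \<open>
  The composite is inverted on those points of \<open>G'\<close> whose preimage lies in \<open>G\<close>; the points of \<open>G'\<close> lost in
  this way are a null set by the substitution rule for the second map.
\<close>

lemma change_of_variables_comp:
  assumes 1: "change_of_variables M N T J" and 2: "change_of_variables N P T' J'"
  shows "change_of_variables M P (\<lambda>x. T' (T x)) (\<lambda>x. J x * J' (T x))"
proof -
  from 1 have T [measurable]: "T \<in> measurable M N" and J [measurable]: "J \<in> borel_measurable M"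
    and int: "\<And>h. h \<in> borel_measurable N \<Longrightarrow> (\<integral>\<^sup>+ x. h (T x) * J x \<partial>M) = (\<integral>\<^sup>+ y. h y \<partial>N)"
    by (auto simp: change_of_variables_def)
  from 1 obtain S G where S [measurable]: "S \<in> measurable N M" and G [measurable]: "G \<in> sets N"
    and AE_G: "AE y in N. y \<in> G"
    and S_T: "\<And>x. x \<in> space M \<Longrightarrow> T x \<in> G \<Longrightarrow> S (T x) = x" and T_S: "\<And>y. y \<in> G \<Longrightarrow> T (S y) = y"
    unfolding change_of_variables_def by blast
  from 2 have T' [measurable]: "T' \<in> measurable N P" and J' [measurable]: "J' \<in> borel_measurable N"
    and int': "\<And>h. h \<in> borel_measurable P \<Longrightarrow> (\<integral>\<^sup>+ x. h (T' x) * J' x \<partial>N) = (\<integral>\<^sup>+ y. h y \<partial>P)"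
    by (auto simp: change_of_variables_def)
  from 2 obtain S' G' where S' [measurable]: "S' \<in> measurable P N" and G' [measurable]: "G' \<in> sets P"
    and AE_G': "AE y in P. y \<in> G'"
    and S'_T': "\<And>x. x \<in> space N \<Longrightarrow> T' x \<in> G' \<Longrightarrow> S' (T' x) = x" and T'_S': "\<And>y. y \<in> G' \<Longrightarrow> T' (S' y) = y"
    unfolding change_of_variables_def by blast
  define G'' where "G'' = {y \<in> G'. S' y \<in> G}"
  have G''_eq: "G'' = {y \<in> space P. y \<in> G' \<and> S' y \<in> G}"
    using sets.sets_into_space[OF G'] by (auto simp: G''_def)
  have G'' [measurable]: "G'' \<in> sets P" unfolding G''_eq by measurable
  have "(\<integral>\<^sup>+ y. indicator (G' - G'') y \<partial>P) = (\<integral>\<^sup>+ x. indicator (G' - G'') (T' x) * J' x \<partial>N)"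
    by (rule int'[symmetric]) measurable
  also have "\<dots> = 0"
  proof (subst nn_integral_0_iff_AE)
    show "AE x in N. indicator (G' - G'') (T' x) * J' x = (0::ennreal)"
    proof (rule AE_mp[OF AE_G AE_I2], intro impI)
      fix x assume "x \<in> space N" "x \<in> G"
      then show "indicator (G' - G'') (T' x) * J' x = (0::ennreal)"
        using S'_T'[of x] by (auto simp: G''_def indicator_def)
    qed
  qed measurable
  finally have "AE y in P. indicator (G' - G'') y = (0::ennreal)"
    by (subst (asm) nn_integral_0_iff_AE) measurable
  then have AE_G'': "AE y in P. y \<in> G''"
    using AE_G' by eventually_elim (auto simp: indicator_def split: if_splits)
  show ?thesis
    unfolding change_of_variables_def
  proof (intro conjI ballI bexI[of _ "\<lambda>y. S (S' y)"] bexI[of _ G''])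
    fix h :: "'c \<Rightarrow> ennreal" assume [measurable]: "h \<in> borel_measurable P"
    have "(\<integral>\<^sup>+ x. h (T' (T x)) * (J x * J' (T x)) \<partial>M) = (\<integral>\<^sup>+ x. (h (T' (T x)) * J' (T x)) * J x \<partial>M)"
      by (simp add: mult_ac)
    also have "\<dots> = (\<integral>\<^sup>+ x. h (T' x) * J' x \<partial>N)"
      using int[of "\<lambda>x. h (T' x) * J' x"] by simp
    also have "\<dots> = (\<integral>\<^sup>+ y. h y \<partial>P)" by (rule int') measurable
    finally show "(\<integral>\<^sup>+ x. h (T' (T x)) * (J x * J' (T x)) \<partial>M) = (\<integral>\<^sup>+ y. h y \<partial>P)" .
  next
    show "T' (T x) \<in> G'' \<longrightarrow> S (S' (T' (T x))) = x" if "x \<in> space M" for x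
      using that S'_T'[of "T x"] S_T[of x] measurable_space[OF T that] by (auto simp: G''_def)
    show "T' (T (S (S' y))) = y" if "y \<in> G''" for y
      using that T_S T'_S' by (simp add: G''_def)
  qed (use AE_G'' in measurable)
qed

lemma change_of_variables_iso:
  assumes T: "T \<in> measurable M N" and S: "S \<in> measurable N M" and distr: "distr M N T = N"
    and S_T: "\<And>x. x \<in> space M \<Longrightarrow> S (T x) = x" and T_S: "\<And>y. y \<in> space N \<Longrightarrow> T (S y) = y"
  shows "change_of_variables M N T (\<lambda>_. 1)" and "change_of_variables N M S (\<lambda>_. 1)"
proof -
  have "(\<integral>\<^sup>+ x. h (T x) \<partial>M) = (\<integral>\<^sup>+ y. h y \<partial>N)" if "h \<in> borel_measurable N" for h
    using nn_integral_distr[OF T, of h] that by (simp add: distr)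
  then show "change_of_variables M N T (\<lambda>_. 1)"
    unfolding change_of_variables_def using T S S_T T_S
    by (auto intro!: bexI[of _ S] bexI[of _ "space N"])
  have "distr N M S = distr M M (\<lambda>x. S (T x))"
    using distr_distr[OF S T] by (simp add: distr comp_def)
  also have "\<dots> = distr M M (\<lambda>x. x)" by (rule distr_cong) (simp_all add: S_T)
  finally have distr': "distr N M S = M" by simp
  have "(\<integral>\<^sup>+ x. h (S x) \<partial>N) = (\<integral>\<^sup>+ y. h y \<partial>M)" if "h \<in> borel_measurable M" for h
    using nn_integral_distr[OF S, of h] that by (simp add: distr')
  then show "change_of_variables N M S (\<lambda>_. 1)"
    unfolding change_of_variables_def using T S S_T T_S
    by (auto intro!: bexI[of _ T] bexI[of _ "space M"])
qed

lemma change_of_variables_cong: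
  assumes "change_of_variables M N T J" "\<And>x. x \<in> space M \<Longrightarrow> T x = T' x" "\<And>x. x \<in> space M \<Longrightarrow> J x = J' x"
  shows "change_of_variables M N T' J'"
proof -
  from assms(1) have T: "T \<in> measurable M N" "J \<in> borel_measurable M"
    and int: "\<And>h. h \<in> borel_measurable N \<Longrightarrow> (\<integral>\<^sup>+ x. h (T x) * J x \<partial>M) = (\<integral>\<^sup>+ y. h y \<partial>N)"
    by (auto simp: change_of_variables_def)
  from assms(1) obtain S G where S: "S \<in> measurable N M" and G: "G \<in> sets N" "AE y in N. y \<in> G"
    and S_T: "\<And>x. x \<in> space M \<Longrightarrow> T x \<in> G \<Longrightarrow> S (T x) = x" and T_S: "\<And>y. y \<in> G \<Longrightarrow> T (S y) = y"
    unfolding change_of_variables_def by blast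
  have "T' (S y) = y" if "y \<in> G" for y
  proof -
    have "S y \<in> space M" using measurable_space[OF S] sets.sets_into_space[OF G(1)] that by blast
    then show ?thesis using T_S[OF that] assms(2) by metis
  qed
  moreover have "T' \<in> measurable M N" "J' \<in> borel_measurable M"
    using T assms(2,3) by (simp_all cong: measurable_cong)
  moreover have "(\<integral>\<^sup>+ x. h (T' x) * J' x \<partial>M) = (\<integral>\<^sup>+ y. h y \<partial>N)" if "h \<in> borel_measurable N" for h
    unfolding int[OF that, symmetric] using assms(2,3) by (intro nn_integral_cong) simp
  moreover have "S (T' x) = x" if "x \<in> space M" "T' x \<in> G" for x
    using that S_T assms(2) by metis
  ultimately show ?thesis unfolding change_of_variables_def using S G by blast
qed

context normalized_haar
begin

lemma measurable_coordinate: "i \<in> I \<Longrightarrow> (\<lambda>t. t i) \<in> borel_measurable (\<Pi>\<^sub>M i\<in>I. dc)"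
  using measurable_component_singleton[of i I "\<lambda>_. dc"] by (simp add: measurable_cong_sets[OF refl sets_dc])

lemma AE_coordinate_nonzero:
  assumes "finite I" "i \<in> I"
  shows "AE t in (\<Pi>\<^sub>M i\<in>I. dc). t i \<noteq> 0"
proof -
  have I: "insert i (I - {i}) = I" using assms(2) by blast
  let ?P = "\<Pi>\<^sub>M i\<in>I. dc"
  note [measurable] = measurable_coordinate[OF assms(2)]
  have m: "(\<lambda>t. indicator {0} (t i) :: ennreal) \<in> borel_measurable ?P" by measurable
  have "(\<integral>\<^sup>+ t. indicator {0} (t i) \<partial>?P) = (\<integral>\<^sup>+ x. \<integral>\<^sup>+ y. indicator {0} y \<partial>dc \<partial>(\<Pi>\<^sub>M i\<in>I - {i}. dc))"
    using product_nn_integral_insert[of "I - {i}" i "\<lambda>t. indicator {0} (t i)", unfolded I] assms m by simp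
  also have "\<dots> = 0" by (simp add: emeasure_singleton_0)
  finally have "AE t in ?P. indicator {0} (t i) = (0::ennreal)"
    using m by (simp add: nn_integral_0_iff_AE)
  then show ?thesis by eventually_elim (simp add: indicator_def split: if_splits)
qed

text \<open>
  Fubini reduces this to the affine substitution in the coordinate \<open>k\<close> alone. The points where \<open>m\<close> vanishes
  contribute nothing on the left, and form a null set on the right.
\<close>

lemma change_of_variables_update:
  assumes I: "finite I" "k \<in> I"
    and m [measurable]: "m \<in> borel_measurable (\<Pi>\<^sub>M i\<in>I. dc)" and f [measurable]: "f \<in> borel_measurable (\<Pi>\<^sub>M i\<in>I. dc)"
    and ind: "\<And>t s. m (t(k := s)) = m t" "\<And>t s. f (t(k := s)) = f t"
    and nz: "AE t in (\<Pi>\<^sub>M i\<in>I. dc). m t \<noteq> 0"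
  shows "change_of_variables (\<Pi>\<^sub>M i\<in>I. dc) (\<Pi>\<^sub>M i\<in>I. dc) (\<lambda>t. t(k := m t * t k + f t)) (\<lambda>t. ennreal (absv (m t)))"
proof -
  let ?P = "\<Pi>\<^sub>M i\<in>I. dc"
  have I': "insert k (I - {k}) = I" using I(2) by blast
  note [measurable] = measurable_coordinate[OF I(2)]
  have upd: "(\<lambda>t. t(k := g t)) \<in> measurable ?P ?P" if "g \<in> borel_measurable ?P" for g
    using that I(2) by (intro measurable_fun_upd[of I I k]) (auto simp: measurable_cong_sets[OF refl sets_dc])
  have T [measurable]: "(\<lambda>t. t(k := m t * t k + f t)) \<in> measurable ?P ?P" by (rule upd) measurable
  have S [measurable]: "(\<lambda>t. t(k := (t k - f t) / m t)) \<in> measurable ?P ?P" by (rule upd) measurable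
  have int: "(\<integral>\<^sup>+ t. h (t(k := m t * t k + f t)) * ennreal (absv (m t)) \<partial>?P) = (\<integral>\<^sup>+ t. h t \<partial>?P)"
    if h [measurable]: "h \<in> borel_measurable ?P" for h
  proof -
    have "(\<integral>\<^sup>+ t. h (t(k := m t * t k + f t)) * ennreal (absv (m t)) \<partial>?P)
        = (\<integral>\<^sup>+ x. \<integral>\<^sup>+ s. h (x(k := m x * s + f x)) * ennreal (absv (m x)) \<partial>dc \<partial>(\<Pi>\<^sub>M i\<in>I - {k}. dc))"
      using product_nn_integral_insert[of "I - {k}" k "\<lambda>t. h (t(k := m t * t k + f t)) * ennreal (absv (m t))", unfolded I'] I
      by (simp add: ind)
    also have "\<dots> = (\<integral>\<^sup>+ x. \<integral>\<^sup>+ s. h (x(k := s)) * indicator (- {0}) (m x) \<partial>dc \<partial>(\<Pi>\<^sub>M i\<in>I - {k}. dc))"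
    proof (rule nn_integral_cong)
      fix x assume x: "x \<in> space (\<Pi>\<^sub>M i\<in>I - {k}. dc)"
      have hx: "(\<lambda>s. h (x(k := s))) \<in> borel_measurable borel"
      proof -
        have "(\<lambda>s. x(k := s)) \<in> measurable dc ?P"
          using measurable_component_update[of x "I - {k}" "\<lambda>_. dc" k] x unfolding I' by simp
        from measurable_compose[OF this h] show ?thesis by (simp add: measurable_cong_sets[OF sets_dc refl])
      qed
      show "(\<integral>\<^sup>+ s. h (x(k := m x * s + f x)) * ennreal (absv (m x)) \<partial>dc)
          = (\<integral>\<^sup>+ s. h (x(k := s)) * indicator (- {0}) (m x) \<partial>dc)"
      proof (cases "m x = 0")
        case False
        then show ?thesis using nn_integral_affine[OF False hx, of "f x"] by simp
      qed simp
    qed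
    also have "\<dots> = (\<integral>\<^sup>+ t. h t * indicator (- {0}) (m t) \<partial>?P)"
      using product_nn_integral_insert[of "I - {k}" k "\<lambda>t. h t * indicator (- {0}) (m t)", unfolded I'] I
      by (simp add: ind)
    also have "\<dots> = (\<integral>\<^sup>+ t. h t \<partial>?P)"
      by (rule nn_integral_cong_AE) (use nz in eventually_elim, simp)
    finally show ?thesis .
  qed
  show ?thesis
    unfolding change_of_variables_def
  proof (intro conjI ballI bexI[of _ "\<lambda>t. t(k := (t k - f t) / m t)"] bexI[of _ "{t \<in> space ?P. m t \<noteq> 0}"] impI)
    show "AE y in ?P. y \<in> {t \<in> space ?P. m t \<noteq> 0}" using nz AE_space by eventually_elim simp
  qed (use int in \<open>auto simp: ind\<close>)
qed

text \<open>
  The function belonging to the first index does not depend on the coordinates with an index in the list,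
  the next one may depend on the first coordinate as well, and so on.
\<close>

fun triangular :: "('i \<Rightarrow> ('i \<Rightarrow> 'a) \<Rightarrow> 'a) \<Rightarrow> 'i list \<Rightarrow> bool" where
  "triangular f [] \<longleftrightarrow> True"
| "triangular f (k # ks) \<longleftrightarrow>
     (\<forall>t t'. (\<forall>i. i \<notin> set (k # ks) \<longrightarrow> t i = t' i) \<longrightarrow> f k t = f k t') \<and> triangular f ks"

text \<open>
  A triangular map is a composition of updates of a single coordinate. The update for the head of the list
  comes last, when the other coordinates have their new values already; this does not matter, since its
  coefficients do not depend on those.
\<close>

theorem change_of_variables_triangular:
  assumes I: "finite I" "set ks \<subseteq> I" and ks: "distinct ks"
    and tri: "triangular m ks" "triangular f ks"
    and meas: "\<And>k. k \<in> set ks \<Longrightarrow> m k \<in> borel_measurable (\<Pi>\<^sub>M i\<in>I. dc)"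
      "\<And>k. k \<in> set ks \<Longrightarrow> f k \<in> borel_measurable (\<Pi>\<^sub>M i\<in>I. dc)"
    and nz: "\<And>k. k \<in> set ks \<Longrightarrow> AE t in (\<Pi>\<^sub>M i\<in>I. dc). m k t \<noteq> 0"
  shows "change_of_variables (\<Pi>\<^sub>M i\<in>I. dc) (\<Pi>\<^sub>M i\<in>I. dc)
    (\<lambda>t k. if k \<in> set ks then m k t * t k + f k t else t k) (\<lambda>t. ennreal (\<Prod>k\<in>set ks. absv (m k t)))"
  using I(2) ks tri meas nz
proof (induction ks)
  case Nil
  have "change_of_variables (\<Pi>\<^sub>M i\<in>I. dc) (\<Pi>\<^sub>M i\<in>I. dc) (\<lambda>t. t) (\<lambda>_. 1)"
    by (rule change_of_variables_iso(1)[of "\<lambda>t. t" _ _ "\<lambda>t. t"]) simp_all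
  then show ?case by simp
next
  case (Cons k ks)
  let ?T = "\<lambda>t j. if j \<in> set ks then m j t * t j + f j t else t j"
  have k: "k \<notin> set ks" using Cons.prems(2) by simp
  have dep: "m k t = m k t'" "f k t = f k t'" if "\<And>i. i \<notin> insert k (set ks) \<Longrightarrow> t i = t' i" for t t'
    using Cons.prems(3,4) that by auto
  have 1: "change_of_variables (\<Pi>\<^sub>M i\<in>I. dc) (\<Pi>\<^sub>M i\<in>I. dc) ?T (\<lambda>t. ennreal (\<Prod>k\<in>set ks. absv (m k t)))"
    using Cons.prems by (intro Cons.IH) auto
  have 2: "change_of_variables (\<Pi>\<^sub>M i\<in>I. dc) (\<Pi>\<^sub>M i\<in>I. dc) (\<lambda>t. t(k := m k t * t k + f k t)) (\<lambda>t. ennreal (absv (m k t)))"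
    using Cons.prems I(1) by (intro change_of_variables_update) (auto intro!: dep)
  have dep': "m k (?T t) = m k t" "f k (?T t) = f k t" for t by (rule dep; simp)+
  show ?case
  proof (rule change_of_variables_cong[OF change_of_variables_comp[OF 1 2]])
    show "(?T t)(k := m k (?T t) * ?T t k + f k (?T t))
      = (\<lambda>j. if j \<in> set (k # ks) then m j t * t j + f j t else t j)" for t
      unfolding dep' using k by (intro ext) auto
    show "ennreal (\<Prod>k\<in>set ks. absv (m k t)) * ennreal (absv (m k (?T t)))
        = ennreal (\<Prod>k\<in>set (k # ks). absv (m k t))" for t
      unfolding dep' using k by (simp add: mult.commute ennreal_mult prod_nonneg)
  qed
qed

end

section \<open>Roots and weights\<close>

lemma sum_UNIV_6: "(\<Sum>i\<in>(UNIV :: 6 set). f i) = f 1 + f 2 + f 3 + f 4 + f 5 + f 6"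
  unfolding UNIV_6 by (simp add: add.assoc)

definition root_weight :: "int^6 \<Rightarrow> int^6" where
  "root_weight \<beta> = cartan *v \<beta>"

definition pairing :: "int^6 \<Rightarrow> int^6 \<Rightarrow> int" where
  "pairing \<nu> \<beta> = (\<Sum>i\<in>UNIV. \<nu> $ i * \<beta> $ i)"

abbreviation inner_root :: "int^6 \<Rightarrow> int^6 \<Rightarrow> int" where
  "inner_root \<beta> \<gamma> \<equiv> pairing (root_weight \<beta>) \<gamma>"

definition height :: "int^6 \<Rightarrow> int" where
  "height \<beta> = (\<Sum>i\<in>UNIV. \<beta> $ i)"

lemma root_weight_nth:
  "root_weight \<beta> $ 1 = 2 * \<beta> $ 1 - \<beta> $ 3"
  "root_weight \<beta> $ 2 = 2 * \<beta> $ 2 - \<beta> $ 4"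
  "root_weight \<beta> $ 3 = 2 * \<beta> $ 3 - \<beta> $ 1 - \<beta> $ 4"
  "root_weight \<beta> $ 4 = 2 * \<beta> $ 4 - \<beta> $ 2 - \<beta> $ 3 - \<beta> $ 5"
  "root_weight \<beta> $ 5 = 2 * \<beta> $ 5 - \<beta> $ 4 - \<beta> $ 6"
  "root_weight \<beta> $ 6 = 2 * \<beta> $ 6 - \<beta> $ 5"
  by (simp_all add: root_weight_def matrix_vector_mult_def sum_UNIV_6 cartan_def doubleton_eq_iff)

lemma pairing_expand:
  "pairing \<nu> \<beta> = \<nu> $ 1 * \<beta> $ 1 + \<nu> $ 2 * \<beta> $ 2 + \<nu> $ 3 * \<beta> $ 3 + \<nu> $ 4 * \<beta> $ 4 + \<nu> $ 5 * \<beta> $ 5 + \<nu> $ 6 * \<beta> $ 6"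
  by (simp add: pairing_def sum_UNIV_6)

lemma root_weight_add: "root_weight (\<beta> + \<gamma>) = root_weight \<beta> + root_weight \<gamma>"
  by (simp add: root_weight_def matrix_vector_right_distrib)

lemma pairing_add_left: "pairing (\<nu> + \<mu>) \<beta> = pairing \<nu> \<beta> + pairing \<mu> \<beta>"
  by (simp add: pairing_def algebra_simps sum.distrib)

lemma pairing_add_right: "pairing \<nu> (\<beta> + \<gamma>) = pairing \<nu> \<beta> + pairing \<nu> \<gamma>"
  by (simp add: pairing_def algebra_simps sum.distrib)

lemma inner_root_commute: "inner_root \<beta> \<gamma> = inner_root \<gamma> \<beta>"
  by (simp add: pairing_expand root_weight_nth algebra_simps)

lemma height_add: "height (\<beta> + \<gamma>) = height \<beta> + height \<gamma>"
  by (simp add: height_def sum.distrib)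

lemma root_weight_simple_root: "root_weight (simple_root i) = cartan $ i"
proof -
  have "\<forall>i. root_weight (simple_root i) = cartan $ i"
    unfolding forall_6 by (simp add: vec_eq_iff forall_6 root_weight_nth simple_root_def axis_def cartan_def doubleton_eq_iff)
  then show ?thesis by blast
qed

lemma pairing_simple_root: "pairing \<nu> (simple_root i) = \<nu> $ i"
  by (simp add: pairing_def simple_root_def axis_def if_distrib cong: if_cong)

text \<open>
  Statements about finitely many roots and weights are decided by evaluation on lists of coordinates. The
  roots of the Levi subgroup are listed with those that contain \<open>\<alpha>\<^sub>4\<close> in front. The latter span an abelian
  ideal, so that an element of \<open>U\<^sub>M\<close> is the product of an element of an abelian normal subgroup of dimension
  9 and an element of the unipotent radical of a Borel subgroup of type \<open>A\<^sub>2 \<times> A\<^sub>2\<close>. Within each list the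
  height does not decrease.
\<close>

definition levi_list_4 :: "int list list" where
  "levi_list_4 = [[0,0,0,1,0,0], [0,0,0,1,1,0], [0,0,1,1,0,0], [0,0,0,1,1,1], [0,0,1,1,1,0],
     [1,0,1,1,0,0], [0,0,1,1,1,1], [1,0,1,1,1,0], [1,0,1,1,1,1]]"

definition levi_list_0 :: "int list list" where
  "levi_list_0 = [[1,0,0,0,0,0], [0,0,1,0,0,0], [0,0,0,0,0,1], [0,0,0,0,1,0], [1,0,1,0,0,0], [0,0,0,0,1,1]]"

definition radical_list :: "int list list" where
  "radical_list = [[0,1,0,0,0,0], [0,1,0,1,0,0], [0,1,0,1,1,0], [0,1,1,1,0,0], [0,1,0,1,1,1],
     [0,1,1,1,1,0], [1,1,1,1,0,0], [0,1,1,1,1,1], [0,1,1,2,1,0], [1,1,1,1,1,0], [0,1,1,2,1,1],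
     [1,1,1,1,1,1], [1,1,1,2,1,0], [0,1,1,2,2,1], [1,1,1,2,1,1], [1,1,2,2,1,0], [1,1,1,2,2,1],
     [1,1,2,2,1,1], [1,1,2,2,2,1], [1,1,2,3,2,1], [1,2,2,3,2,1]]"

definition positive_root_list :: "int list list" where
  "positive_root_list = levi_list_4 @ levi_list_0 @ radical_list"

fun list_root_weight :: "int list \<Rightarrow> int list" where
  "list_root_weight [a, b, c, d, e, f] =
     [2 * a - c, 2 * b - d, 2 * c - a - d, 2 * d - b - c - e, 2 * e - d - f, 2 * f - e]"
| "list_root_weight _ = []"

definition list_pairing :: "int list \<Rightarrow> int list \<Rightarrow> int" where
  "list_pairing l m = sum_list (map2 (*) l m)"

definition list_add :: "int list \<Rightarrow> int list \<Rightarrow> int list" where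
  "list_add l m = map2 (+) l m"

fun root_reflections :: "int list \<Rightarrow> int list list" where
  "root_reflections [a, b, c, d, e, f] =
     [[c - a, b, c, d, e, f], [a, d - b, c, d, e, f], [a, b, a + d - c, d, e, f],
      [a, b, c, b + c + e - d, e, f], [a, b, c, d, d + f - e, f], [a, b, c, d, e, e - f]]"
| "root_reflections _ = []"

lemma length_6E:
  assumes "length l = 6"
  obtains a b c d e f where "l = [a, b, c, d, e, f]"
  using assms by (auto simp: length_Suc_conv eval_nat_numeral)

lemma vector_6_eq_iff:
  "(vector [a, b, c, d, e, f] :: int^6) = vector [a', b', c', d', e', f'] \<longleftrightarrow>
     a = a' \<and> b = b' \<and> c = c' \<and> d = d' \<and> e = e' \<and> f = f'"
  by (auto simp: vec_eq_iff forall_6)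

lemma vector_6_add:
  "(vector [a, b, c, d, e, f] :: int^6) + vector [a', b', c', d', e', f'] =
     vector [a + a', b + b', c + c', d + d', e + e', f + f']"
  by (simp add: vec_eq_iff forall_6)

lemma vector_6_diff:
  "(vector [a, b, c, d, e, f] :: int^6) - vector [a', b', c', d', e', f'] =
     vector [a - a', b - b', c - c', d - d', e - e', f - f']"
  by (simp add: vec_eq_iff forall_6)

lemma vector_6_uminus:
  "- (vector [a, b, c, d, e, f] :: int^6) = vector [- a, - b, - c, - d, - e, - f]"
  by (simp add: vec_eq_iff forall_6)

lemma vector_list_ops:
  assumes "length l = 6" "length m = 6"
  shows "vector l + vector m = (vector (list_add l m) :: int^6)"
    and "root_weight (vector l) = vector (list_root_weight l)"
    and "pairing (vector l) (vector m) = list_pairing l m"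
    and "vector l = (vector m :: int^6) \<longleftrightarrow> l = m"
  using assms by (auto elim!: length_6E simp: vector_6_add list_add_def list_pairing_def pairing_expand
      vector_6_eq_iff root_weight_nth vec_eq_iff[of "root_weight _"] forall_6)

lemma length_list_root_weight: "length l = 6 \<Longrightarrow> length (list_root_weight l) = 6"
  by (elim length_6E) simp

lemma positive_root_list_length: "\<forall>l\<in>set positive_root_list. length l = 6"
  by code_simp

lemma positive_root_list_descent:
  "\<forall>l\<in>set positive_root_list. sum_list l = 1 \<or>
     (\<exists>m\<in>set (root_reflections l). m \<in> set positive_root_list \<and> sum_list m < sum_list l)"
  by code_simp

lemma positive_root_list_closed:
  "\<forall>l\<in>set positive_root_list. \<forall>m\<in>set (root_reflections l).
     m \<in> set positive_root_list \<or> map uminus m \<in> set positive_root_list"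
  by code_simp

lemma positive_root_list_nonneg: "\<forall>l\<in>set positive_root_list. \<forall>x\<in>set l. 0 \<le> x"
  by code_simp

lemma positive_root_list_form:
  "\<forall>l\<in>set positive_root_list. \<forall>m\<in>set positive_root_list.
     let k = list_pairing (list_root_weight l) m in
       - 1 \<le> k \<and> (if k \<ge> 2 then l = m \<and> k = 2 else l \<noteq> m) \<and>
       (k = - 1 \<longrightarrow> list_add l m \<in> set positive_root_list)"
  by code_simp

lemma weight_pairing_list:
  "\<forall>n\<in>set weight_list. \<forall>l\<in>set positive_root_list.
     let k = list_pairing n l in \<bar>k\<bar> \<le> 1 \<and>
       (k = - 1 \<longrightarrow> list_add n (list_root_weight l) \<in> set weight_list)"
  by code_simp

text \<open>
  The pairing with \<open>[8,11,15,21,15,8]\<close>, which is half the sum of all positive coroots, increases along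
  some simple reflection unless the weight is the highest one; this shows that every entry of the list lies in the
  orbit of the highest weight.
\<close>

lemma weight_list_ascent:
  "\<forall>n\<in>set weight_list. n = [1,0,0,0,0,0] \<or>
     (\<exists>m\<in>set (reflections n). m \<in> set weight_list \<and>
        list_pairing [8,11,15,21,15,8] n < list_pairing [8,11,15,21,15,8] m)"
  by code_simp

lemma reflection_in_list:
  assumes "length l = 6"
  shows "(vector l :: int^6) - (cartan *v vector l) $ i *s simple_root i \<in> vector ` set (root_reflections l)"
    (is "?r i \<in> _")
proof -
  have "\<forall>i. ?r i \<in> vector ` set (root_reflections l)"
    using assms unfolding forall_6 root_weight_def[symmetric]
    by (elim length_6E)
       (simp add: image_iff vec_eq_iff forall_6 root_weight_nth simple_root_def axis_def)
  then show ?thesis by blast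
qed

lemma list_in_reflections:
  assumes "length l = 6" "m \<in> set (root_reflections l)"
  shows "\<exists>i. vector l = (vector m :: int^6) - (cartan *v vector m) $ i *s simple_root i"
proof -
  obtain a b c d e f where l: "l = [a, b, c, d, e, f]" using assms(1) by (rule length_6E)
  let ?R = "\<lambda>m i. vector l = (vector m :: int^6) - (cartan *v vector m) $ i *s simple_root i"
  have "?R [c - a, b, c, d, e, f] 1"
    "?R [a, d - b, c, d, e, f] 2"
    "?R [a, b, a + d - c, d, e, f] 3"
    "?R [a, b, c, b + c + e - d, e, f] 4"
    "?R [a, b, c, d, d + f - e, f] 5"
    "?R [a, b, c, d, e, e - f] 6"
    unfolding l root_weight_def[symmetric]
    by (simp_all add: vec_eq_iff forall_6 root_weight_nth simple_root_def axis_def)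
  note eqs = this
  have "m \<in> {[c - a, b, c, d, e, f], [a, d - b, c, d, e, f], [a, b, a + d - c, d, e, f],
      [a, b, c, b + c + e - d, e, f], [a, b, c, d, d + f - e, f], [a, b, c, d, e, e - f]}"
    using assms(2) unfolding l by simp
  then show ?thesis by (elim insertE emptyE; hypsubst) (rule exI, rule eqs)+
qed

lemma roots_subset: "roots \<subseteq> vector ` set positive_root_list \<union> uminus ` vector ` set positive_root_list"
  (is "_ \<subseteq> ?P \<union> ?N")
proof
  fix \<beta> assume "\<beta> \<in> roots"
  then show "\<beta> \<in> ?P \<union> ?N"
  proof induction
    case (simple i)
    have "\<forall>i. simple_root i \<in> vector ` set positive_root_list"
      unfolding forall_6
      by (simp add: positive_root_list_def levi_list_4_def levi_list_0_def radical_list_def image_iff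
          vec_eq_iff forall_6 simple_root_def axis_def)
    then show ?case by blast
  next
    case (reflect \<beta> i)
    have step: "vector l - (cartan *v vector l) $ i *s simple_root i \<in> ?P \<union> ?N" if l: "l \<in> set positive_root_list" for l
    proof -
      have len: "length l = 6" using positive_root_list_length l by blast
      obtain m where m: "m \<in> set (root_reflections l)"
        "vector l - (cartan *v vector l) $ i *s simple_root i = (vector m :: int^6)"
        using reflection_in_list[OF len, of i] by auto
      have "length m = 6" using m(1) len by (elim length_6E) auto
      then have "vector m = (- vector (map uminus m) :: int^6)"
        by (elim length_6E) (simp add: vector_6_uminus)
      then show ?thesis using positive_root_list_closed l m by force
    qed
    show ?case
    proof (cases "\<beta> \<in> ?P")
      case True
      then show ?thesis using step by auto
    next
      case False
      then obtain l where l: "l \<in> set positive_root_list" "\<beta> = - vector l" using reflect.IH by auto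
      have "\<beta> - (cartan *v \<beta>) $ i *s simple_root i = - (vector l - (cartan *v vector l) $ i *s simple_root i)"
        unfolding l(2) by (simp add: vec_eq_iff matrix_vector_mult_def sum_negf)
      moreover have neg: "- x \<in> ?P \<union> ?N" if "x \<in> ?P \<union> ?N" for x :: "int^6" using that by auto
      ultimately show ?thesis using neg[OF step[OF l(1)]] by (simp only:)
    qed
  qed
qed

lemma positive_root_list_simple:
  "\<forall>l\<in>set positive_root_list. sum_list l = 1 \<longrightarrow> l \<in> set [[1,0,0,0,0,0], [0,1,0,0,0,0],
     [0,0,1,0,0,0], [0,0,0,1,0,0], [0,0,0,0,1,0], [0,0,0,0,0,1]]"
  by code_simp

lemma positive_root_list_simple_root:
  assumes "l \<in> set positive_root_list" "sum_list l = 1"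
  shows "\<exists>i. vector l = simple_root i"
proof -
  have "vector [1,0,0,0,0,0] = simple_root 1" "vector [0,1,0,0,0,0] = simple_root 2"
    "vector [0,0,1,0,0,0] = simple_root 3" "vector [0,0,0,1,0,0] = simple_root 4"
    "vector [0,0,0,0,1,0] = simple_root 5" "vector [0,0,0,0,0,1] = simple_root 6"
    by (simp_all add: vec_eq_iff forall_6 simple_root_def axis_def)
  note eqs = this
  have "l \<in> {[1,0,0,0,0,0], [0,1,0,0,0,0], [0,0,1,0,0,0], [0,0,0,1,0,0], [0,0,0,0,1,0], [0,0,0,0,0,1]}"
    using positive_root_list_simple assms by simp
  then show ?thesis by (elim insertE emptyE; hypsubst) (rule exI, rule eqs)+
qed

lemma positive_root_list_roots: "l \<in> set positive_root_list \<Longrightarrow> vector l \<in> roots"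
proof (induction "nat (sum_list l)" arbitrary: l rule: less_induct)
  case less
  show ?case
  proof (cases "sum_list l = 1")
    case True
    then show ?thesis using positive_root_list_simple_root less.prems by (metis roots.simple)
  next
    case False
    then obtain m where m: "m \<in> set (root_reflections l)" "m \<in> set positive_root_list" "sum_list m < sum_list l"
      using positive_root_list_descent less.prems by blast
    have "0 \<le> sum_list m" using positive_root_list_nonneg m(2) by (simp add: sum_list_nonneg)
    then have "vector m \<in> roots" using m by (intro less.hyps) simp_all
    moreover have "length l = 6" using positive_root_list_length less.prems by blast
    ultimately show ?thesis using list_in_reflections m(1) by (metis roots.reflect)
  qed
qed

lemma inner_root_list:
  assumes "l \<in> set positive_root_list" "m \<in> set positive_root_list"
  shows "inner_root (vector l) (vector m) = list_pairing (list_root_weight l) m"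
proof -
  have "length l = 6" "length m = 6" using positive_root_list_length assms by blast+
  then show ?thesis by (simp add: vector_list_ops length_list_root_weight)
qed

lemma positive_roots_eq: "positive_roots = vector ` set positive_root_list"
proof (intro equalityI subsetI)
  fix \<beta> :: "int^6" assume "\<beta> \<in> vector ` set positive_root_list"
  then obtain l where l: "l \<in> set positive_root_list" "\<beta> = vector l" by blast
  have "length l = 6" using positive_root_list_length l(1) by blast
  then obtain a b c d e f where abc: "l = [a, b, c, d, e, f]" by (rule length_6E)
  have "\<forall>i. 0 \<le> \<beta> $ i"
    using positive_root_list_nonneg l(1) unfolding forall_6 l(2) abc by auto
  then show "\<beta> \<in> positive_roots"
    using positive_root_list_roots l by (simp add: positive_roots_def)
next
  fix \<beta> assume \<beta>: "\<beta> \<in> positive_roots"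
  show "\<beta> \<in> vector ` set positive_root_list"
  proof (rule ccontr)
    assume "\<beta> \<notin> vector ` set positive_root_list"
    moreover have "\<beta> \<in> roots" using \<beta> by (simp add: positive_roots_def)
    ultimately obtain l where l: "l \<in> set positive_root_list" "\<beta> = - vector l"
      using roots_subset by blast
    have "length l = 6" using positive_root_list_length l(1) by blast
    then obtain a b c d e f where abc: "l = [a, b, c, d, e, f]" by (rule length_6E)
    have "\<forall>i. 0 \<le> \<beta> $ i" using \<beta> by (simp add: positive_roots_def)
    moreover have "\<forall>x\<in>set l. 0 \<le> x" using positive_root_list_nonneg l(1) by blast
    ultimately have "l = [0, 0, 0, 0, 0, 0]"
      unfolding forall_6 l(2) abc by (auto simp: vector_6_uminus)
    moreover have "[0, 0, 0, 0, 0, 0] \<notin> set positive_root_list" by code_simp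
    ultimately show False using l(1) by simp
  qed
qed

lemma positive_roots_roots: "\<beta> \<in> positive_roots \<Longrightarrow> \<beta> \<in> roots"
  by (simp add: positive_roots_def)

text \<open>
  The system is simply laced: sums of positive roots are recognized by their inner product.
\<close>

lemma inner_root_cases:
  assumes "\<beta> \<in> positive_roots" "\<gamma> \<in> positive_roots"
  shows "inner_root \<beta> \<gamma> \<in> {- 1, 0, 1, 2}"
    and "inner_root \<beta> \<gamma> = 2 \<longleftrightarrow> \<beta> = \<gamma>"
    and "inner_root \<beta> \<gamma> = - 1 \<Longrightarrow> \<beta> + \<gamma> \<in> positive_roots"
proof -
  obtain l m where l: "l \<in> set positive_root_list" "\<beta> = vector l"
    and m: "m \<in> set positive_root_list" "\<gamma> = vector m"
    using assms by (auto simp: positive_roots_eq)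
  have len: "length l = 6" "length m = 6" using positive_root_list_length l m by blast+
  define k where "k = list_pairing (list_root_weight l) m"
  have k: "inner_root \<beta> \<gamma> = k" unfolding l(2) m(2) k_def by (rule inner_root_list[OF l(1) m(1)])
  have *: "- 1 \<le> k \<and> (if k \<ge> 2 then l = m \<and> k = 2 else l \<noteq> m) \<and>
       (k = - 1 \<longrightarrow> list_add l m \<in> set positive_root_list)"
    using positive_root_list_form l(1) m(1) unfolding k_def Let_def by blast
  have eq: "\<beta> = \<gamma> \<longleftrightarrow> l = m" unfolding l(2) m(2) using len by (rule vector_list_ops(4))
  show "inner_root \<beta> \<gamma> \<in> {- 1, 0, 1, 2}" using * unfolding k by (auto split: if_splits)
  show "inner_root \<beta> \<gamma> = 2 \<longleftrightarrow> \<beta> = \<gamma>" using * unfolding k eq by (auto split: if_splits)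
  show "\<beta> + \<gamma> \<in> positive_roots" if "inner_root \<beta> \<gamma> = - 1"
  proof -
    have "list_add l m \<in> set positive_root_list" using * that unfolding k by simp
    then show ?thesis unfolding positive_roots_eq l(2) m(2) vector_list_ops(1)[OF len] by (rule imageI)
  qed
qed

lemma inner_root_self: "\<beta> \<in> positive_roots \<Longrightarrow> inner_root \<beta> \<beta> = 2"
  using inner_root_cases(2) by blast

lemma add_positive_root_iff:
  assumes "\<beta> \<in> positive_roots" "\<gamma> \<in> positive_roots"
  shows "\<beta> + \<gamma> \<in> positive_roots \<longleftrightarrow> inner_root \<beta> \<gamma> = - 1"
proof
  assume "\<beta> + \<gamma> \<in> positive_roots"
  then have "inner_root (\<beta> + \<gamma>) (\<beta> + \<gamma>) = 2" by (rule inner_root_self)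
  then show "inner_root \<beta> \<gamma> = - 1"
    using inner_root_self[OF assms(1)] inner_root_self[OF assms(2)] inner_root_commute[of \<beta> \<gamma>]
    by (simp add: root_weight_add pairing_add_left pairing_add_right)
qed (rule inner_root_cases(3)[OF assms])

lemma root_weight_inj:
  assumes "\<beta> \<in> positive_roots" "\<gamma> \<in> positive_roots" "root_weight \<beta> = root_weight \<gamma>"
  shows "\<beta> = \<gamma>"
  using assms inner_root_cases(2)[OF assms(1,2)] inner_root_self by metis

lemma height_pos: "\<beta> \<in> positive_roots \<Longrightarrow> 0 < height \<beta>"
proof -
  assume \<beta>: "\<beta> \<in> positive_roots"
  then have nonneg: "\<forall>i. 0 \<le> \<beta> $ i" by (simp add: positive_roots_def)
  have "\<beta> \<noteq> 0"
    using inner_root_self[OF \<beta>] by (auto simp: pairing_def)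
  then obtain i where "\<beta> $ i \<noteq> 0" by (auto simp: vec_eq_iff)
  with nonneg show ?thesis unfolding height_def by (intro sum_pos2[of _ i]) (auto simp: order_less_le)
qed

lemma simple_root_positive: "simple_root i \<in> positive_roots"
proof -
  have "\<forall>j. 0 \<le> simple_root i $ j" by (simp add: simple_root_def axis_def)
  then show ?thesis unfolding positive_roots_def using roots.simple by blast
qed

lemma positive_root_list_step:
  "\<forall>l\<in>set positive_root_list. sum_list l = 1 \<or>
     (\<exists>m\<in>set positive_root_list. \<exists>s\<in>set positive_root_list. sum_list s = 1 \<and> l = list_add m s)"
  by code_simp

text \<open>
  This is the induction by which the root vectors of a Chevalley system are determined up to sign from
  the simple ones.
\<close>

lemma positive_root_induct [consumes 1, case_names simple add]:
  assumes "\<beta> \<in> positive_roots"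
    and simple: "\<And>i. P (simple_root i)"
    and add: "\<And>\<gamma> i. \<gamma> \<in> positive_roots \<Longrightarrow> \<gamma> + simple_root i \<in> positive_roots \<Longrightarrow> P \<gamma> \<Longrightarrow> P (\<gamma> + simple_root i)"
  shows "P \<beta>"
  using assms(1)
proof (induction "nat (height \<beta>)" arbitrary: \<beta> rule: less_induct)
  case less
  then obtain l where l: "l \<in> set positive_root_list" "\<beta> = vector l" by (auto simp: positive_roots_eq)
  show ?case
  proof (cases "sum_list l = 1")
    case True
    then show ?thesis using positive_root_list_simple_root l simple by metis
  next
    case False
    then obtain m s where m: "m \<in> set positive_root_list" "s \<in> set positive_root_list" "sum_list s = 1" "l = list_add m s"
      using positive_root_list_step l(1) by blast
    obtain i where i: "vector s = simple_root i" using positive_root_list_simple_root m(2,3) by blast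
    have "length m = 6" "length s = 6" using positive_root_list_length m by blast+
    then have \<beta>: "\<beta> = vector m + simple_root i"
      unfolding l(2) m(4) i[symmetric] by (rule vector_list_ops(1)[symmetric])
    have \<gamma>: "vector m \<in> positive_roots" using m(1) by (simp add: positive_roots_eq)
    have "height \<beta> = height (vector m) + height (simple_root i)" unfolding \<beta> by (rule height_add)
    then have "P (vector m)"
      using height_pos[OF \<gamma>] height_pos[OF simple_root_positive, of i] by (intro less.hyps \<gamma>) simp
    then show ?thesis using add[OF \<gamma>] less.prems unfolding \<beta> by blast
  qed
qed

subsection \<open>Weights\<close>

lemma list_in_weight_reflections:
  assumes "length n = 6" "m \<in> set (reflections n)"
  shows "\<exists>i. vector n = (vector m :: int^6) - (vector m $ i) *s cartan $ i"
proof -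
  obtain a b c d e f where n: "n = [a, b, c, d, e, f]" using assms(1) by (rule length_6E)
  let ?R = "\<lambda>m i. vector n = (vector m :: int^6) - (vector m $ i) *s cartan $ i"
  have "?R [- a, b, c + a, d, e, f] 1" "?R [a, - b, c, d + b, e, f] 2"
    "?R [a + c, b, - c, d + c, e, f] 3" "?R [a, b + d, c + d, - d, e + d, f] 4"
    "?R [a, b, c, d + e, - e, f + e] 5" "?R [a, b, c, d, e + f, - f] 6"
    unfolding n by (simp_all add: vec_eq_iff forall_6 cartan_def doubleton_eq_iff)
  note eqs = this
  have "m \<in> {[- a, b, c + a, d, e, f], [a, - b, c, d + b, e, f], [a + c, b, - c, d + c, e, f],
     [a, b + d, c + d, - d, e + d, f], [a, b, c, d + e, - e, f + e], [a, b, c, d, e + f, - f]}"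
    using assms(2) unfolding n by simp
  then show ?thesis by (elim insertE emptyE; hypsubst) (rule exI, rule eqs)+
qed

lemma weight_list_minuscule: "n \<in> set weight_list \<Longrightarrow> vector n \<in> minuscule_weights"
proof (induction "nat (100 - list_pairing [8,11,15,21,15,8] n)" arbitrary: n rule: less_induct)
  case less
  show ?case
  proof (cases "n = [1,0,0,0,0,0]")
    case True
    have "(axis 1 1 :: int^6) = vector [1, 0, 0, 0, 0, 0]"
      by (simp add: vec_eq_iff forall_6 axis_def)
    then show ?thesis using minuscule_weights.highest True by simp
  next
    case False
    then obtain m where m: "m \<in> set (reflections n)" "m \<in> set weight_list"
      "list_pairing [8,11,15,21,15,8] n < list_pairing [8,11,15,21,15,8] m"
      using weight_list_ascent less.prems by blast
    have "\<forall>n\<in>set weight_list. list_pairing [8,11,15,21,15,8] n < 100" by code_simp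
    then have "vector m \<in> minuscule_weights"
      using m less.prems by (intro less.hyps) auto
    moreover have "\<exists>i. vector n = (vector m :: int^6) - (vector m $ i) *s cartan $ i"
    proof -
      have "length n = 6" using weight_list_closed less.prems by blast
      then show ?thesis using list_in_weight_reflections m(1) by blast
    qed
    ultimately show ?thesis by (metis minuscule_weights.reflect)
  qed
qed

text \<open>
  The representation is minuscule: root strings of weights have length at most two, and this is why root
  vectors have square zero and entries \<open>0\<close>, \<open>1\<close>, \<open>-1\<close>.
\<close>

lemma weight_pairing:
  assumes "\<nu> \<in> minuscule_weights" "\<beta> \<in> positive_roots"
  shows "\<bar>pairing \<nu> \<beta>\<bar> \<le> 1"
    and "\<nu> + root_weight \<beta> \<in> minuscule_weights \<longleftrightarrow> pairing \<nu> \<beta> = - 1"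
proof -
  obtain l where l: "l \<in> set positive_root_list" "\<beta> = vector l" using assms(2) by (auto simp: positive_roots_eq)
  have len: "length l = 6" using positive_root_list_length l by blast
  have *: "\<bar>pairing \<mu> \<beta>\<bar> \<le> 1 \<and> (pairing \<mu> \<beta> = - 1 \<longrightarrow> \<mu> + root_weight \<beta> \<in> minuscule_weights)"
    if \<mu>: "\<mu> \<in> minuscule_weights" for \<mu>
  proof -
    obtain n where n: "n \<in> set weight_list" "\<mu> = vector n" using \<mu> minuscule_weights_subset by blast
    have "length n = 6" using weight_list_closed n(1) by blast
    then have eqs: "pairing \<mu> \<beta> = list_pairing n l"
      "\<mu> + root_weight \<beta> = vector (list_add n (list_root_weight l))"
      unfolding n(2) l(2) using len by (simp_all add: vector_list_ops length_list_root_weight)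
    show ?thesis
      unfolding eqs using weight_pairing_list n(1) l(1) weight_list_minuscule unfolding Let_def by blast
  qed
  show "\<bar>pairing \<nu> \<beta>\<bar> \<le> 1" using *[OF assms(1)] by simp
  show "\<nu> + root_weight \<beta> \<in> minuscule_weights \<longleftrightarrow> pairing \<nu> \<beta> = - 1"
    using *[OF assms(1)] *[of "\<nu> + root_weight \<beta>"] inner_root_self[OF assms(2)]
    by (auto simp: pairing_add_left)
qed

section \<open>Root vectors\<close>

text \<open>
  Explicit root vectors. The Dynkin diagram is bipartite with colour classes \<open>{1, 4, 6}\<close> and \<open>{2, 3, 5}\<close>.
  Summing over one colour class gives a bilinear form whose symmetrization is the inner product of roots
  modulo two, so the sign is a bimultiplicative cocycle with the commutation property of the root vectors.
\<close>

definition std_sign :: "int^6 \<Rightarrow> int^6 \<Rightarrow> 'a::field" where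
  "std_sign \<beta> \<nu> = (if even (\<beta> $ 1 * \<nu> $ 1 + \<beta> $ 4 * \<nu> $ 4 + \<beta> $ 6 * \<nu> $ 6) then 1 else - 1)"

definition std_root_vector :: "int^6 \<Rightarrow> 'a::field ^ weight ^ weight" where
  "std_root_vector \<beta> = (\<chi> \<mu> \<nu>. if Rep_weight \<mu> = Rep_weight \<nu> + root_weight \<beta> then std_sign \<beta> (Rep_weight \<nu>) else 0)"

lemma sign_even_add:
  "(if even (x + y :: int) then 1 else - 1 :: 'a::ring_1)
     = (if even x then 1 else - 1) * (if even y then 1 else - 1)"
  by simp

lemma std_sign_add_left: "std_sign (\<beta> + \<gamma>) \<nu> = (std_sign \<beta> \<nu> * std_sign \<gamma> \<nu> :: 'a::field)"
proof -
  have "(\<beta> + \<gamma>) $ 1 * \<nu> $ 1 + (\<beta> + \<gamma>) $ 4 * \<nu> $ 4 + (\<beta> + \<gamma>) $ 6 * \<nu> $ 6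
      = (\<beta> $ 1 * \<nu> $ 1 + \<beta> $ 4 * \<nu> $ 4 + \<beta> $ 6 * \<nu> $ 6) + (\<gamma> $ 1 * \<nu> $ 1 + \<gamma> $ 4 * \<nu> $ 4 + \<gamma> $ 6 * \<nu> $ 6)"
    by (simp add: algebra_simps)
  then show ?thesis unfolding std_sign_def by (simp only: sign_even_add)
qed

lemma std_sign_add_right: "std_sign \<beta> (\<nu> + \<mu>) = (std_sign \<beta> \<nu> * std_sign \<beta> \<mu> :: 'a::field)"
proof -
  have "\<beta> $ 1 * (\<nu> + \<mu>) $ 1 + \<beta> $ 4 * (\<nu> + \<mu>) $ 4 + \<beta> $ 6 * (\<nu> + \<mu>) $ 6
      = (\<beta> $ 1 * \<nu> $ 1 + \<beta> $ 4 * \<nu> $ 4 + \<beta> $ 6 * \<nu> $ 6) + (\<beta> $ 1 * \<mu> $ 1 + \<beta> $ 4 * \<mu> $ 4 + \<beta> $ 6 * \<mu> $ 6)"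
    by (simp add: algebra_simps)
  then show ?thesis unfolding std_sign_def by (simp only: sign_even_add)
qed

lemma std_sign_square: "std_sign \<beta> \<nu> \<in> {1, - 1 :: 'a::field}"
  by (simp add: std_sign_def)

text \<open>
  In the sum of both exponents an edge of the diagram is counted once, since exactly one of its ends
  has the chosen colour; the diagonal terms are even.
\<close>

lemma std_sign_commutation:
  "std_sign \<beta> (root_weight \<gamma>) * std_sign \<gamma> (root_weight \<beta>)
     = (if even (inner_root \<beta> \<gamma>) then 1 else - 1 :: 'a::field)"
proof -
  have "even ((\<beta> $ 1 * root_weight \<gamma> $ 1 + \<beta> $ 4 * root_weight \<gamma> $ 4 + \<beta> $ 6 * root_weight \<gamma> $ 6)
      + (\<gamma> $ 1 * root_weight \<beta> $ 1 + \<gamma> $ 4 * root_weight \<beta> $ 4 + \<gamma> $ 6 * root_weight \<beta> $ 6)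
      + inner_root \<beta> \<gamma>)"
  proof (rule dvdI)
    show "(\<beta> $ 1 * root_weight \<gamma> $ 1 + \<beta> $ 4 * root_weight \<gamma> $ 4 + \<beta> $ 6 * root_weight \<gamma> $ 6)
      + (\<gamma> $ 1 * root_weight \<beta> $ 1 + \<gamma> $ 4 * root_weight \<beta> $ 4 + \<gamma> $ 6 * root_weight \<beta> $ 6)
      + inner_root \<beta> \<gamma> = 2 * (inner_root \<beta> \<gamma> + \<beta> $ 1 * \<gamma> $ 1 + \<beta> $ 4 * \<gamma> $ 4 + \<beta> $ 6 * \<gamma> $ 6
        - \<beta> $ 2 * \<gamma> $ 2 - \<beta> $ 3 * \<gamma> $ 3 - \<beta> $ 5 * \<gamma> $ 5)"
      by (simp add: pairing_expand root_weight_nth algebra_simps)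
  qed
  then show ?thesis unfolding std_sign_def even_add by auto
qed

lemma std_root_vector_mult:
  assumes "\<beta> \<in> positive_roots" "\<gamma> \<in> positive_roots"
  shows "(std_root_vector \<beta> ** std_root_vector \<gamma> :: 'a::field ^ weight ^ weight) $ \<mu> $ \<nu> =
    (if Rep_weight \<mu> = Rep_weight \<nu> + root_weight \<gamma> + root_weight \<beta> \<and> pairing (Rep_weight \<nu>) \<gamma> = - 1
     then std_sign \<beta> (Rep_weight \<nu> + root_weight \<gamma>) * std_sign \<gamma> (Rep_weight \<nu>) else 0)"
proof -
  let ?e = "\<lambda>\<kappa>. (std_root_vector \<beta> :: 'a ^ weight ^ weight) $ \<mu> $ \<kappa> * std_root_vector \<gamma> $ \<kappa> $ \<nu>"
  have prod: "(std_root_vector \<beta> ** std_root_vector \<gamma> :: 'a ^ weight ^ weight) $ \<mu> $ \<nu> = (\<Sum>\<kappa>\<in>UNIV. ?e \<kappa>)"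
    by (simp add: matrix_matrix_mult_def)
  show ?thesis
  proof (cases "pairing (Rep_weight \<nu>) \<gamma> = - 1")
    case True
    then have "Rep_weight \<nu> + root_weight \<gamma> \<in> minuscule_weights"
      using weight_pairing(2)[OF Rep_weight assms(2)] by simp
    then obtain \<kappa>0 where \<kappa>0: "Rep_weight \<kappa>0 = Rep_weight \<nu> + root_weight \<gamma>"
      using Abs_weight_inverse by metis
    have "(\<Sum>\<kappa>\<in>UNIV. ?e \<kappa>) = (\<Sum>\<kappa>\<in>{\<kappa>0}. ?e \<kappa>)"
      by (rule sum.mono_neutral_right) (auto simp: std_root_vector_def \<kappa>0[symmetric] Rep_weight_inject)
    then show ?thesis unfolding prod using True by (simp add: std_root_vector_def \<kappa>0)
  next
    case False
    then have "Rep_weight \<nu> + root_weight \<gamma> \<notin> minuscule_weights"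
      using weight_pairing(2)[OF Rep_weight assms(2)] by simp
    then have "?e \<kappa> = 0" for \<kappa>
      using Rep_weight[of \<kappa>] by (auto simp: std_root_vector_def)
    then have "(\<Sum>\<kappa>\<in>UNIV. ?e \<kappa>) = 0" by (intro sum.neutral) blast
    then show ?thesis unfolding prod using False by simp
  qed
qed

text \<open>
  After a step by \<open>\<gamma>\<close> the pairing of the weight with \<open>\<beta>\<close> is nonnegative, so that \<open>\<beta>\<close> cannot be added.
\<close>

lemma std_root_vector_mult_eq_0:
  assumes "\<beta> \<in> positive_roots" "\<gamma> \<in> positive_roots" "inner_root \<beta> \<gamma> > 0"
  shows "std_root_vector \<beta> ** std_root_vector \<gamma> = (0 :: 'a::field ^ weight ^ weight)"
proof -
  have "False" if "Rep_weight \<mu> = Rep_weight \<nu> + root_weight \<gamma> + root_weight \<beta>" "pairing (Rep_weight \<nu>) \<gamma> = - 1" for \<mu> \<nu>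
  proof -
    have "Rep_weight \<nu> + root_weight \<gamma> \<in> minuscule_weights"
      using weight_pairing(2)[OF Rep_weight assms(2)] that(2) by simp
    then have "pairing (Rep_weight \<nu> + root_weight \<gamma>) \<beta> = - 1"
      using weight_pairing(2)[OF _ assms(1)] that(1) Rep_weight by metis
    then show False
      using weight_pairing(1)[OF Rep_weight assms(1), of \<nu>] assms(3) inner_root_commute[of \<beta> \<gamma>]
      by (simp add: pairing_add_left)
  qed
  then show ?thesis by (auto simp: vec_eq_iff std_root_vector_mult[OF assms(1,2)])
qed

lemma std_root_vector_commute:
  assumes "\<beta> \<in> positive_roots" "\<gamma> \<in> positive_roots" "inner_root \<beta> \<gamma> = 0"
  shows "std_root_vector \<beta> ** std_root_vector \<gamma> = (std_root_vector \<gamma> ** std_root_vector \<beta> :: 'a::field ^ weight ^ weight)"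
proof -
  have sgn: "std_sign \<beta> (root_weight \<gamma>) = (std_sign \<gamma> (root_weight \<beta>) :: 'a)"
    using std_sign_commutation[of \<beta> \<gamma>, where 'a = 'a] std_sign_square[of \<beta> "root_weight \<gamma>", where 'a = 'a]
      std_sign_square[of \<gamma> "root_weight \<beta>", where 'a = 'a] assms(3) by auto
  have "pairing (Rep_weight \<nu>) \<gamma> = - 1 \<longleftrightarrow> pairing (Rep_weight \<nu>) \<beta> = - 1"
    if "Rep_weight \<mu> = Rep_weight \<nu> + root_weight \<gamma> + root_weight \<beta>" for \<mu> \<nu>
  proof -
    have "pairing (Rep_weight \<nu>) \<beta> = - 1" if \<mu>: "Rep_weight \<mu> = Rep_weight \<nu> + root_weight \<gamma> + root_weight \<beta>"
      "pairing (Rep_weight \<nu>) \<gamma> = - 1" "\<beta> \<in> positive_roots" "\<gamma> \<in> positive_roots" "inner_root \<gamma> \<beta> = 0" for \<beta> \<gamma>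
    proof -
      have "Rep_weight \<nu> + root_weight \<gamma> \<in> minuscule_weights"
        using weight_pairing(2)[OF Rep_weight \<mu>(4)] \<mu>(2) by simp
      then have "pairing (Rep_weight \<nu> + root_weight \<gamma>) \<beta> = - 1"
        using weight_pairing(2)[OF _ \<mu>(3)] \<mu>(1) Rep_weight by metis
      then show ?thesis using \<mu>(5) by (simp add: pairing_add_left)
    qed
    from this[of \<gamma> \<beta>] this[of \<beta> \<gamma>] show ?thesis
      using assms that inner_root_commute[of \<beta> \<gamma>] by (auto simp: add_ac)
  qed
  then show ?thesis
    by (auto simp: vec_eq_iff std_root_vector_mult assms add_ac std_sign_add_right sgn)
qed

text \<open>
  On a weight to which \<open>\<beta> + \<gamma>\<close> can be added, exactly one order of the two steps is possible, and the two orders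
  carry opposite signs.
\<close>

lemma std_root_vector_commutator:
  assumes "\<beta> \<in> positive_roots" "\<gamma> \<in> positive_roots" "inner_root \<beta> \<gamma> = - 1"
  shows "std_root_vector \<beta> ** std_root_vector \<gamma> - std_root_vector \<gamma> ** std_root_vector \<beta> \<in>
    {std_root_vector (\<beta> + \<gamma>), - std_root_vector (\<beta> + \<gamma>) :: 'a::field ^ weight ^ weight}"
proof -
  define s where "s = (std_sign \<beta> (root_weight \<gamma>) :: 'a)"
  have s': "std_sign \<gamma> (root_weight \<beta>) = - s"
    using std_sign_commutation[of \<beta> \<gamma>, where 'a = 'a] std_sign_square[of \<beta> "root_weight \<gamma>", where 'a = 'a] assms(3)
    by (auto simp: s_def)
  have sum: "\<beta> + \<gamma> \<in> positive_roots" using inner_root_cases(3)[OF assms] .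
  have "(std_root_vector \<beta> ** std_root_vector \<gamma> - std_root_vector \<gamma> ** std_root_vector \<beta>) $ \<mu> $ \<nu>
      = s * std_root_vector (\<beta> + \<gamma>) $ \<mu> $ \<nu>" for \<mu> \<nu>
  proof (cases "Rep_weight \<mu> = Rep_weight \<nu> + root_weight \<gamma> + root_weight \<beta>")
    case True
    then have eqs: "Rep_weight \<mu> = Rep_weight \<nu> + root_weight \<beta> + root_weight \<gamma>"
      "Rep_weight \<mu> = Rep_weight \<nu> + root_weight (\<beta> + \<gamma>)"
      by (simp_all add: root_weight_add add_ac)
    then have "pairing (Rep_weight \<nu>) (\<beta> + \<gamma>) = - 1"
      using weight_pairing(2)[OF Rep_weight sum] Rep_weight by metis
    then have "pairing (Rep_weight \<nu>) \<beta> = - 1 \<and> pairing (Rep_weight \<nu>) \<gamma> = 0 \<or>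
        pairing (Rep_weight \<nu>) \<beta> = 0 \<and> pairing (Rep_weight \<nu>) \<gamma> = - 1"
      using weight_pairing(1)[OF Rep_weight assms(1), of \<nu>] weight_pairing(1)[OF Rep_weight assms(2), of \<nu>]
      by (auto simp: pairing_add_right)
    then show ?thesis
      using eqs True by (auto simp: std_root_vector_mult assms(1,2) std_root_vector_def[of "\<beta> + \<gamma>"]
          std_sign_add_left std_sign_add_right s_def[symmetric] s')
  next
    case False
    then show ?thesis
      by (simp add: std_root_vector_mult assms(1,2) std_root_vector_def[of "\<beta> + \<gamma>"] root_weight_add add_ac)
  qed
  moreover have "s = 1 \<or> s = - 1" using std_sign_square[of \<beta> "root_weight \<gamma>", where 'a = 'a] by (simp add: s_def)
  ultimately show ?thesis by (auto simp: vec_eq_iff)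
qed

lemma matrix_minus_left: "(- A) ** B = - (A ** B)" for A B :: "'a::ring_1 ^ 'n ^ 'n"
  by (simp add: vec_eq_iff matrix_matrix_mult_def sum_negf)

lemma matrix_minus_right: "A ** (- B) = - (A ** B)" for A B :: "'a::ring_1 ^ 'n ^ 'n"
  by (simp add: vec_eq_iff matrix_matrix_mult_def sum_negf)

lemma chevalley_system_simple:
  assumes "chevalley_system E"
  shows "E (simple_root i) \<in> {std_root_vector (simple_root i), - std_root_vector (simple_root i) :: 'a::field ^ weight ^ weight}"
proof -
  have raise: "E (simple_root i) = raising i" using assms by (simp add: chevalley_system_def)
  have "\<exists>s\<in>{1, - 1}. \<forall>\<mu> \<nu>. raising i $ \<mu> $ \<nu> = s * (std_root_vector (simple_root i) :: 'a ^ weight ^ weight) $ \<mu> $ \<nu>"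
  proof (intro bexI allI)
    define s where "s = (if i \<in> {1, 4, 6} then - 1 else 1 :: 'a)"
    show "s \<in> {1, - 1}" by (simp add: s_def)
    fix \<mu> \<nu>
    show "raising i $ \<mu> $ \<nu> = s * (std_root_vector (simple_root i) :: 'a ^ weight ^ weight) $ \<mu> $ \<nu>"
    proof (cases "Rep_weight \<mu> = Rep_weight \<nu> + root_weight (simple_root i)")
      case True
      then have "pairing (Rep_weight \<nu>) (simple_root i) = - 1"
        using weight_pairing(2)[OF Rep_weight simple_root_positive] Rep_weight by metis
      then have "Rep_weight \<nu> $ i = - 1" by (simp only: pairing_simple_root)
      then have "std_sign (simple_root i) (Rep_weight \<nu>) = s"
        by (auto simp: std_sign_def simple_root_def axis_def s_def)
      then show ?thesis using True
        by (simp add: raising_def std_root_vector_def root_weight_simple_root s_def)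
    next
      case False
      then show ?thesis by (simp add: raising_def std_root_vector_def root_weight_simple_root)
    qed
  qed
  then show ?thesis unfolding raise by (auto simp: vec_eq_iff)
qed

text \<open>
  Hence the entries of each positive root vector are known up to one common sign, which does not affect
  absolute values.
\<close>

lemma chevalley_system_positive:
  assumes "chevalley_system E" "\<beta> \<in> positive_roots"
  shows "E \<beta> \<in> {std_root_vector \<beta>, - std_root_vector \<beta> :: 'a::field ^ weight ^ weight}"
  using assms(2)
proof (induction rule: positive_root_induct)
  case (simple i)
  show ?case by (rule chevalley_system_simple[OF assms(1)])
next
  case (add \<gamma> i)
  have *: "inner_root \<gamma> (simple_root i) = - 1"
    using add.hyps add_positive_root_iff simple_root_positive by blast
  let ?C = "E \<gamma> ** E (simple_root i) - E (simple_root i) ** E \<gamma>"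
  let ?D = "std_root_vector \<gamma> ** std_root_vector (simple_root i)
      - std_root_vector (simple_root i) ** std_root_vector \<gamma>"
  have "?C \<in> {E (\<gamma> + simple_root i), - E (\<gamma> + simple_root i)}"
    using assms(1) add.hyps simple_root_positive positive_roots_roots unfolding chevalley_system_def by blast
  moreover have "Y = X \<or> Y = - X" if "X \<in> {Y, - Y}" for X Y :: "'a ^ weight ^ weight"
    using that by auto
  ultimately have "E (\<gamma> + simple_root i) = ?C \<or> E (\<gamma> + simple_root i) = - ?C" by blast
  moreover have "?C = ?D \<or> ?C = - ?D"
    using add.IH chevalley_system_simple[OF assms(1), of i]
    by (auto simp: matrix_minus_left matrix_minus_right)
  moreover have "?D \<in> {std_root_vector (\<gamma> + simple_root i), - std_root_vector (\<gamma> + simple_root i) :: 'a ^ weight ^ weight}"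
    by (rule std_root_vector_commutator[OF add.hyps(1) simple_root_positive *])
  ultimately show ?case by (elim disjE insertE emptyE) simp_all
qed

section \<open>Relations between root elements\<close>

lemma mat_scale_nth: "(mat t ** A) $ i $ j = t * A $ i $ j" for A :: "'a::semiring_1 ^ 'n ^ 'n"
  by (simp add: matrix_matrix_mult_def mat_def if_distrib[of "\<lambda>x. x * _"] cong: if_cong)

lemma mat_scale_mult: "(mat s ** A) ** (mat t ** B) = mat (s * t) ** (A ** B)"
  for A B :: "'a::comm_semiring_1 ^ 'n ^ 'n"
proof -
  have "((mat s ** A) ** (mat t ** B)) $ i $ j = (mat (s * t) ** (A ** B)) $ i $ j" for i j
  proof -
    have "((mat s ** A) ** (mat t ** B)) $ i $ j = (\<Sum>k\<in>UNIV. (s * A $ i $ k) * (t * B $ k $ j))"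
      unfolding matrix_matrix_mult_def[of "mat s ** A"] by (simp add: mat_scale_nth)
    also have "\<dots> = (s * t) * (\<Sum>k\<in>UNIV. A $ i $ k * B $ k $ j)"
      unfolding sum_distrib_left by (intro sum.cong refl) (simp only: mult_ac)
    also have "\<dots> = (mat (s * t) ** (A ** B)) $ i $ j"
      unfolding mat_scale_nth by (simp add: matrix_matrix_mult_def)
    finally show ?thesis .
  qed
  then show ?thesis by (simp add: vec_eq_iff)
qed

lemma matrix_add_rdistrib': "(A + B) ** C = A ** C + B ** C" for A B C :: "'a::semiring_1 ^ 'n ^ 'n"
  by (simp add: vec_eq_iff matrix_matrix_mult_def sum.distrib distrib_right)

lemma matrix_zero_right: "A ** 0 = 0" for A :: "'a::semiring_1 ^ 'n ^ 'n"
  by (simp add: vec_eq_iff matrix_matrix_mult_def)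

text \<open>
  The condition on an ordering of roots under which the products of root elements in this order form a
  group with unique coordinates. That \<open>\<beta> + \<gamma>\<close> comes after \<open>\<beta>\<close> lets a root element be moved to its place from
  the left. That the height does not decrease, except when passing from roots that contain \<open>\<alpha>\<^sub>4\<close> to roots that do not,
  ensures that the first root is not a sum of two or more later ones, so that its coordinate can be read off from
  a matrix entry.
\<close>

fun adapted :: "(int^6) list \<Rightarrow> bool" where
  "adapted [] \<longleftrightarrow> True"
| "adapted (\<beta> # bs) \<longleftrightarrow> \<beta> \<in> positive_roots \<and> \<beta> \<notin> set bs \<and>
     (\<forall>\<gamma>\<in>set bs. (height \<beta> \<le> height \<gamma> \<or> \<beta> $ 4 \<noteq> 0 \<and> \<gamma> $ 4 = 0) \<and>
       (\<beta> + \<gamma> \<in> positive_roots \<longrightarrow> \<beta> + \<gamma> \<in> set bs)) \<and> adapted bs"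

lemma adapted_positive_roots: "adapted bs \<Longrightarrow> set bs \<subseteq> positive_roots"
  by (induction bs) auto

text \<open>
  The linear forms on the weight space that extend the height and the coefficient of \<open>\<alpha>\<^sub>4\<close>.
\<close>

definition weight_height :: "int^6 \<Rightarrow> int" where
  "weight_height \<delta> = 8 * \<delta> $ 1 + 11 * \<delta> $ 2 + 15 * \<delta> $ 3 + 21 * \<delta> $ 4 + 15 * \<delta> $ 5 + 8 * \<delta> $ 6"

definition weight_level_4 :: "int^6 \<Rightarrow> int" where
  "weight_level_4 \<delta> = 2 * \<delta> $ 1 + 3 * \<delta> $ 2 + 4 * \<delta> $ 3 + 6 * \<delta> $ 4 + 4 * \<delta> $ 5 + 2 * \<delta> $ 6"

lemma weight_height_simps:
  "weight_height 0 = 0" "weight_height (\<delta> + \<delta>') = weight_height \<delta> + weight_height \<delta>'"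
  "weight_height (\<delta> - \<delta>') = weight_height \<delta> - weight_height \<delta>'"
  "weight_height (root_weight \<beta>) = height \<beta>" "weight_height (- \<delta>) = - weight_height \<delta>"
  by (simp_all add: weight_height_def root_weight_nth height_def sum_UNIV_6)

lemma weight_level_4_simps:
  "weight_level_4 0 = 0" "weight_level_4 (\<delta> + \<delta>') = weight_level_4 \<delta> + weight_level_4 \<delta>'"
  "weight_level_4 (root_weight \<beta>) = \<beta> $ 4"
  by (simp_all add: weight_level_4_def root_weight_nth)

lemma exists_weight_pairing:
  "\<forall>l\<in>set positive_root_list. \<exists>n\<in>set weight_list. list_pairing n l = - 1"
  by code_simp

lemma exists_weights:
  assumes "\<beta> \<in> positive_roots"
  shows "\<exists>p. Rep_weight (fst p) = Rep_weight (snd p) + root_weight \<beta>"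
proof -
  obtain l where l: "l \<in> set positive_root_list" "\<beta> = vector l" using assms by (auto simp: positive_roots_eq)
  obtain n where n: "n \<in> set weight_list" "list_pairing n l = - 1" using exists_weight_pairing l(1) by blast
  have "length l = 6" "length n = 6" using positive_root_list_length weight_list_closed l(1) n(1) by blast+
  then have "pairing (vector n) \<beta> = - 1" unfolding l(2) using n(2) by (simp add: vector_list_ops)
  moreover have \<nu>: "vector n \<in> minuscule_weights" using n(1) by (rule weight_list_minuscule)
  ultimately have "vector n + root_weight \<beta> \<in> minuscule_weights" using weight_pairing(2)[OF \<nu> assms] by simp
  with \<nu> have "Rep_weight (fst (Abs_weight (vector n + root_weight \<beta>), Abs_weight (vector n)))
      = Rep_weight (snd (Abs_weight (vector n + root_weight \<beta>), Abs_weight (vector n))) + root_weight \<beta>"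
    by (simp add: Abs_weight_inverse)
  then show ?thesis by blast
qed

text \<open>
  A position in the matrices at which the root vector of \<open>\<beta>\<close> has the entry \<open>1\<close> or \<open>-1\<close>.
\<close>

definition entry_of :: "int^6 \<Rightarrow> weight \<times> weight" where
  "entry_of \<beta> = (SOME p. Rep_weight (fst p) = Rep_weight (snd p) + root_weight \<beta>)"

lemma entry_of: "\<beta> \<in> positive_roots \<Longrightarrow>
    Rep_weight (fst (entry_of \<beta>)) = Rep_weight (snd (entry_of \<beta>)) + root_weight \<beta>"
  unfolding entry_of_def by (rule someI_ex) (rule exists_weights)

locale chevalley =
  fixes E :: "int^6 \<Rightarrow> 'a::field ^ weight ^ weight"
  assumes chevalley_system: "chevalley_system E"
begin

abbreviation x :: "int^6 \<Rightarrow> 'a \<Rightarrow> 'a ^ weight ^ weight" where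
  "x \<equiv> root_elem E"

lemma E_cases: "\<beta> \<in> positive_roots \<Longrightarrow> E \<beta> = std_root_vector \<beta> \<or> E \<beta> = - std_root_vector \<beta>"
  using chevalley_system_positive[OF chevalley_system] by blast

lemma std_root_vector_nth:
  "std_root_vector \<beta> $ \<mu> $ \<nu> =
     (if Rep_weight \<mu> = Rep_weight \<nu> + root_weight \<beta> then std_sign \<beta> (Rep_weight \<nu>) else (0::'a))"
  by (simp add: std_root_vector_def)

lemma E_nth_cases: "\<beta> \<in> positive_roots \<Longrightarrow> E \<beta> $ \<mu> $ \<nu> \<in> {0, 1, - 1}"
  using E_cases[of \<beta>] std_sign_square[of \<beta> "Rep_weight \<nu>", where 'a = 'a]
  by (auto simp: std_root_vector_nth split: if_splits)

lemma E_nth_eq_0_iff: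
  "\<beta> \<in> positive_roots \<Longrightarrow> E \<beta> $ \<mu> $ \<nu> = 0 \<longleftrightarrow> Rep_weight \<mu> \<noteq> Rep_weight \<nu> + root_weight \<beta>"
  using E_cases[of \<beta>] std_sign_square[of \<beta> "Rep_weight \<nu>", where 'a = 'a]
  by (auto simp: std_root_vector_nth split: if_splits)

lemma E_mult_eq_0:
  assumes "\<beta> \<in> positive_roots" "\<gamma> \<in> positive_roots" "inner_root \<beta> \<gamma> > 0"
  shows "E \<beta> ** E \<gamma> = 0"
  using E_cases[OF assms(1)] E_cases[OF assms(2)] std_root_vector_mult_eq_0[OF assms, where 'a = 'a]
  by (auto simp: matrix_minus_left matrix_minus_right)

lemma E_commute:
  assumes "\<beta> \<in> positive_roots" "\<gamma> \<in> positive_roots" "inner_root \<beta> \<gamma> \<noteq> - 1"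
  shows "E \<beta> ** E \<gamma> = E \<gamma> ** E \<beta>"
proof (cases "inner_root \<beta> \<gamma> = 0")
  case True
  then show ?thesis
    using E_cases[OF assms(1)] E_cases[OF assms(2)] std_root_vector_commute[OF assms(1,2), where 'a = 'a]
    by (auto simp: matrix_minus_left matrix_minus_right)
next
  case False
  then have "inner_root \<beta> \<gamma> > 0" using inner_root_cases(1)[OF assms(1,2)] assms(3) by auto
  then show ?thesis
    using E_mult_eq_0[OF assms(1,2)] E_mult_eq_0[OF assms(2,1)] inner_root_commute[of \<beta> \<gamma>] by simp
qed

lemma E_commutator:
  assumes "\<beta> \<in> positive_roots" "\<gamma> \<in> positive_roots" "\<beta> + \<gamma> \<in> positive_roots"
  shows "\<exists>\<sigma>\<in>{1, - 1}. E \<beta> ** E \<gamma> = E \<gamma> ** E \<beta> + mat \<sigma> ** E (\<beta> + \<gamma>)"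
proof -
  have "E \<beta> ** E \<gamma> - E \<gamma> ** E \<beta> \<in> {E (\<beta> + \<gamma>), - E (\<beta> + \<gamma>)}"
    using chevalley_system assms by (simp add: chevalley_system_def positive_roots_roots)
  moreover have "mat (- 1) ** E (\<beta> + \<gamma>) = - E (\<beta> + \<gamma>)" by (simp add: vec_eq_iff mat_scale_nth)
  ultimately show ?thesis by (auto simp: diff_eq_eq add.commute)
qed

lemma root_elem_nth: "x \<beta> t $ \<mu> $ \<nu> = (if \<mu> = \<nu> then 1 else 0) + t * E \<beta> $ \<mu> $ \<nu>"
  by (simp add: root_elem_def mat_scale_nth) (simp add: mat_def)

lemma root_elem_mult:
  "x \<beta> s ** x \<gamma> t = mat 1 + mat s ** E \<beta> + mat t ** E \<gamma> + mat (s * t) ** (E \<beta> ** E \<gamma>)"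
  by (simp add: root_elem_def matrix_add_ldistrib matrix_add_rdistrib' mat_scale_mult add_ac)

lemma mat_add_scale: "mat (s + t) ** A = mat s ** A + mat t ** A" for A :: "'a ^ 'n ^ 'n"
  by (simp add: vec_eq_iff mat_scale_nth distrib_right)

lemma root_elem_add: "\<beta> \<in> positive_roots \<Longrightarrow> x \<beta> s ** x \<beta> t = x \<beta> (s + t)"
  using E_mult_eq_0[of \<beta> \<beta>] inner_root_self[of \<beta>]
  by (simp add: root_elem_mult matrix_zero_right) (simp add: root_elem_def mat_add_scale add_ac)

lemma root_elem_0 [simp]: "x \<beta> 0 = mat 1"
  by (simp add: vec_eq_iff root_elem_nth mat_def)

lemma root_elem_commute:
  assumes "\<beta> \<in> positive_roots" "\<gamma> \<in> positive_roots" "\<beta> + \<gamma> \<notin> positive_roots"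
  shows "x \<beta> s ** x \<gamma> t = x \<gamma> t ** x \<beta> s"
  using E_commute[OF assms(1,2)] assms(3) add_positive_root_iff[OF assms(1,2)]
  by (simp add: root_elem_mult mult.commute add_ac)

text \<open>
  With only one sum \<open>\<beta> + \<gamma>\<close> available, this is the Chevalley commutator formula; the root element of the sum
  commutes with both factors.
\<close>

lemma root_elem_commutator:
  assumes "\<beta> \<in> positive_roots" "\<gamma> \<in> positive_roots" "\<beta> + \<gamma> \<in> positive_roots"
  shows "\<exists>\<sigma>\<in>{1, - 1}. \<forall>s t. x \<beta> s ** x \<gamma> t = x \<gamma> t ** (x \<beta> s ** x (\<beta> + \<gamma>) (\<sigma> * s * t))"
proof -
  obtain \<sigma> where \<sigma>: "\<sigma> \<in> {1, - 1}" "E \<beta> ** E \<gamma> = E \<gamma> ** E \<beta> + mat \<sigma> ** E (\<beta> + \<gamma>)"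
    using E_commutator[OF assms] by blast
  have inner: "inner_root \<beta> \<gamma> = - 1" using assms add_positive_root_iff by blast
  have zero: "E \<beta> ** E (\<beta> + \<gamma>) = 0" "E \<gamma> ** E (\<beta> + \<gamma>) = 0"
    using assms inner inner_root_commute[of \<beta> \<gamma>] inner_root_self[OF assms(1)] inner_root_self[OF assms(2)]
    by (auto intro!: E_mult_eq_0 simp: pairing_add_right)
  have "x \<beta> s ** x \<gamma> t = x \<gamma> t ** (x \<beta> s ** x (\<beta> + \<gamma>) (\<sigma> * s * t))" for s t
  proof -
    have "x \<gamma> t ** (x \<beta> s ** x (\<beta> + \<gamma>) (\<sigma> * s * t))
        = x \<gamma> t ** (x \<beta> s + mat (\<sigma> * s * t) ** E (\<beta> + \<gamma>))"
      by (simp add: root_elem_mult zero matrix_zero_right) (simp add: root_elem_def add_ac)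
    also have "\<dots> = x \<gamma> t ** x \<beta> s + mat (\<sigma> * s * t) ** E (\<beta> + \<gamma>)"
      by (simp add: matrix_add_ldistrib root_elem_def[of E \<gamma> t] matrix_add_rdistrib' mat_scale_mult zero matrix_zero_right)
    also have "\<dots> = x \<beta> s ** x \<gamma> t"
      by (simp add: vec_eq_iff root_elem_mult \<sigma>(2) mat_scale_nth algebra_simps)
    finally show ?thesis ..
  qed
  with \<sigma>(1) show ?thesis by blast
qed

lemma group_GL: "group (GL :: ('a ^ 'n ^ 'n) monoid)"
proof (rule groupI)
  fix g h :: "'a ^ 'n ^ 'n" assume "g \<in> carrier GL" "h \<in> carrier GL"
  then obtain g' h' where *: "g ** g' = mat 1" "g' ** g = mat 1" "h ** h' = mat 1" "h' ** h = mat 1"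
    by (auto simp: GL_def invertible_def)
  have "(g ** h) ** (h' ** g') = g ** (h ** h') ** g'" "(h' ** g') ** (g ** h) = h' ** (g' ** g) ** h"
    by (simp_all only: matrix_mul_assoc)
  then have "(g ** h) ** (h' ** g') = mat 1" "(h' ** g') ** (g ** h) = mat 1"
    using * by simp_all
  then show "g \<otimes>\<^bsub>GL\<^esub> h \<in> carrier GL" unfolding GL_def invertible_def by auto
next
  fix g :: "'a ^ 'n ^ 'n" assume "g \<in> carrier GL"
  then obtain g' where "g ** g' = mat 1" "g' ** g = mat 1" by (auto simp: GL_def invertible_def)
  then show "\<exists>y\<in>carrier GL. y \<otimes>\<^bsub>GL\<^esub> g = \<one>\<^bsub>GL\<^esub>" by (auto simp: GL_def invertible_def)
qed (auto simp: GL_def matrix_mul_assoc invertible_def intro: exI[of _ "mat 1"])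

lemma E6_simps [simp]: "\<one>\<^bsub>E6_group E\<^esub> = mat 1" "g \<otimes>\<^bsub>E6_group E\<^esub> h = g ** h"
  by (simp_all add: E6_group_def) (simp_all add: GL_def)

sublocale E6: group "E6_group E"
  unfolding E6_group_def by (rule group.group_subgroup_generated[OF group_GL])

lemma root_elem_inverse:
  "\<beta> \<in> positive_roots \<Longrightarrow> x \<beta> t ** x \<beta> (- t) = mat 1"
  "\<beta> \<in> positive_roots \<Longrightarrow> x \<beta> (- t) ** x \<beta> t = mat 1"
  by (simp_all add: root_elem_add)

lemma root_elem_E6:
  assumes "\<beta> \<in> positive_roots"
  shows "x \<beta> t \<in> carrier (E6_group E)"
proof -
  have "x \<beta> t \<in> carrier GL"
    using root_elem_inverse[OF assms, of t] by (auto simp: GL_def invertible_def)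
  then show ?thesis
    using positive_roots_roots[OF assms] unfolding E6_group_def carrier_subgroup_generated
    by (intro generate.incl) auto
qed

lemma inv_root_elem: "\<beta> \<in> positive_roots \<Longrightarrow> inv\<^bsub>E6_group E\<^esub> (x \<beta> t) = x \<beta> (- t)"
  by (rule E6.inv_equality) (simp_all add: root_elem_E6 root_elem_inverse)

definition root_subgroup_span :: "(int^6) list \<Rightarrow> ('a ^ weight ^ weight) set" where
  "root_subgroup_span bs = generate (E6_group E) (\<Union>\<beta>\<in>set bs. range (x \<beta>))"

lemma carrier_subgroup_generated_root_elems:
  assumes "set bs \<subseteq> positive_roots"
  shows "carrier (subgroup_generated (E6_group E) (\<Union>\<beta>\<in>set bs. range (x \<beta>))) = root_subgroup_span bs"
proof -
  have "carrier (E6_group E) \<inter> (\<Union>\<beta>\<in>set bs. range (x \<beta>)) = (\<Union>\<beta>\<in>set bs. range (x \<beta>))"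
    using assms root_elem_E6 by blast
  then show ?thesis by (simp add: carrier_subgroup_generated root_subgroup_span_def)
qed

lemma root_subgroup_span_induct [consumes 2, case_names one root_elem mult]:
  assumes "g \<in> root_subgroup_span bs" "set bs \<subseteq> positive_roots"
    and "P (mat 1)" "\<And>\<beta> t. \<beta> \<in> set bs \<Longrightarrow> P (x \<beta> t)"
    and "\<And>g h. g \<in> root_subgroup_span bs \<Longrightarrow> h \<in> root_subgroup_span bs \<Longrightarrow> P g \<Longrightarrow> P h \<Longrightarrow> P (g ** h)"
  shows "P g"
  using assms(1) unfolding root_subgroup_span_def
proof induction
  case (inv h)
  then obtain \<beta> t where "\<beta> \<in> set bs" "h = x \<beta> t" by blast
  then show ?case using assms(2,4) by (simp add: inv_root_elem subset_iff)
next
  case (eng g h)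
  then show ?case using assms(5)[of g h] by (simp add: root_subgroup_span_def)
qed (use assms(3,4) in auto)

section \<open>Products of root elements\<close>

definition xprod :: "(int^6) list \<Rightarrow> (int^6 \<Rightarrow> 'a) \<Rightarrow> 'a ^ weight ^ weight" where
  "xprod bs t = foldr (\<lambda>\<beta> g. x \<beta> (t \<beta>) ** g) bs (mat 1)"

lemma xprod_simps [simp]:
  "xprod [] t = mat 1"
  "xprod (\<beta> # bs) t = x \<beta> (t \<beta>) ** xprod bs t"
  by (simp_all add: xprod_def)

fun xprod_inv :: "(int^6) list \<Rightarrow> (int^6 \<Rightarrow> 'a) \<Rightarrow> 'a ^ weight ^ weight" where
  "xprod_inv [] t = mat 1"
| "xprod_inv (\<beta> # bs) t = xprod_inv bs t ** x \<beta> (- t \<beta>)"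

lemma xprod_cong: "(\<And>\<beta>. \<beta> \<in> set bs \<Longrightarrow> t \<beta> = t' \<beta>) \<Longrightarrow> xprod bs t = xprod bs t'"
  by (induction bs) auto

lemma xprod_append: "xprod (bs @ bs') t = xprod bs t ** xprod bs' t"
  by (induction bs) (simp_all add: matrix_mul_assoc)

lemma xprod_inverse:
  assumes "set bs \<subseteq> positive_roots"
  shows "xprod_inv bs t ** xprod bs t = mat 1"
  using assms
proof (induction bs)
  case (Cons \<beta> bs)
  have "xprod_inv (\<beta> # bs) t ** xprod (\<beta> # bs) t = xprod_inv bs t ** (x \<beta> (- t \<beta>) ** x \<beta> (t \<beta>)) ** xprod bs t"
    by (simp only: xprod_simps xprod_inv.simps matrix_mul_assoc)
  also have "\<dots> = mat 1" using Cons by (simp add: root_elem_inverse)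
  finally show ?case .
qed simp

lemma xprod_E6: "set bs \<subseteq> positive_roots \<Longrightarrow> xprod bs t \<in> carrier (E6_group E)"
  by (induction bs) (use E6.one_closed E6.m_closed root_elem_E6 in auto)

lemma xprod_inv_E6: "set bs \<subseteq> positive_roots \<Longrightarrow> xprod_inv bs t \<in> carrier (E6_group E)"
  by (induction bs) (use E6.one_closed E6.m_closed root_elem_E6 in auto)

lemma inv_xprod: "set bs \<subseteq> positive_roots \<Longrightarrow> inv\<^bsub>E6_group E\<^esub> (xprod bs t) = xprod_inv bs t"
  by (rule E6.inv_equality) (simp_all add: xprod_E6 xprod_inv_E6 xprod_inverse)

lemma xprod_in_span: "set bs \<subseteq> set bs' \<Longrightarrow> xprod bs t \<in> root_subgroup_span bs'"
proof (induction bs)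
  case Nil
  then show ?case using generate.one[of "E6_group E"] by (simp add: root_subgroup_span_def)
next
  case (Cons \<beta> bs)
  then have "x \<beta> (t \<beta>) \<otimes>\<^bsub>E6_group E\<^esub> xprod bs t \<in> root_subgroup_span bs'"
    unfolding root_subgroup_span_def by (intro generate.eng[OF generate.incl]) auto
  then show ?case by simp
qed

lemma matrix_mult_root_elem_nth:
  fixes g :: "'a ^ weight ^ weight"
  shows "(x \<beta> s ** g) $ \<mu> $ \<nu> = g $ \<mu> $ \<nu> + s * (\<Sum>\<kappa>\<in>UNIV. E \<beta> $ \<mu> $ \<kappa> * g $ \<kappa> $ \<nu>)"
proof -
  have "x \<beta> s ** g = g + mat s ** (E \<beta> ** g)"
    by (simp add: root_elem_def matrix_add_rdistrib' matrix_mul_assoc)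
  then show ?thesis by (simp add: mat_scale_nth) (simp add: matrix_matrix_mult_def)
qed

text \<open>
  A nonzero entry comes from a chain of weights in which each step adds a root of the list. The invariant
  \<open>Q\<close> describes the differences of weights that such chains can have.
\<close>

lemma xprod_nth_nonzero:
  assumes Q: "Q 0" "\<And>\<delta> \<gamma>. Q \<delta> \<Longrightarrow> \<gamma> \<in> set bs \<Longrightarrow> Q (\<delta> + root_weight \<gamma>)"
    and bs: "set bs \<subseteq> positive_roots"
    and nz: "xprod bs t $ \<mu> $ \<nu> \<noteq> 0"
  shows "Q (Rep_weight \<mu> - Rep_weight \<nu>)"
  using Q(2) bs nz
proof (induction bs arbitrary: \<mu>)
  case Nil
  then have "\<mu> = \<nu>" by (simp add: mat_def split: if_splits)
  then show ?case using Q(1) by simp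
next
  case (Cons \<beta> bs)
  have IH: "Q (Rep_weight \<kappa> - Rep_weight \<nu>)" if "xprod bs t $ \<kappa> $ \<nu> \<noteq> 0" for \<kappa>
    using Cons.prems that by (intro Cons.IH) auto
  show ?case
  proof (cases "xprod bs t $ \<mu> $ \<nu> = 0")
    case True
    then have "(\<Sum>\<kappa>\<in>UNIV. E \<beta> $ \<mu> $ \<kappa> * xprod bs t $ \<kappa> $ \<nu>) \<noteq> 0"
      using Cons.prems(3) by (auto simp: matrix_mult_root_elem_nth)
    then obtain \<kappa> where "E \<beta> $ \<mu> $ \<kappa> \<noteq> 0" "xprod bs t $ \<kappa> $ \<nu> \<noteq> 0"
      by (metis (no_types, lifting) mult_zero_left mult_zero_right sum.neutral)
    then have "Rep_weight \<mu> = Rep_weight \<kappa> + root_weight \<beta>" "Q (Rep_weight \<kappa> - Rep_weight \<nu>)"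
      using Cons.prems(2) IH E_nth_eq_0_iff[of \<beta>] by auto
    then show ?thesis using Cons.prems(1)[of "Rep_weight \<kappa> - Rep_weight \<nu>" \<beta>] by (simp add: algebra_simps)
  qed (rule IH)
qed

lemma xprod_diagonal:
  assumes "set bs \<subseteq> positive_roots"
  shows "xprod bs t $ \<nu> $ \<nu> = 1"
  using assms
proof (induction bs)
  case (Cons \<beta> bs)
  have "E \<beta> $ \<nu> $ \<kappa> * xprod bs t $ \<kappa> $ \<nu> = 0" for \<kappa>
  proof (rule ccontr)
    assume "E \<beta> $ \<nu> $ \<kappa> * xprod bs t $ \<kappa> $ \<nu> \<noteq> 0"
    then have "Rep_weight \<nu> = Rep_weight \<kappa> + root_weight \<beta>" "xprod bs t $ \<kappa> $ \<nu> \<noteq> 0"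
      using E_nth_eq_0_iff[of \<beta> \<nu> \<kappa>] Cons.prems by auto
    moreover have "weight_height (Rep_weight \<kappa> - Rep_weight \<nu>) \<ge> 0"
      by (rule xprod_nth_nonzero[OF _ _ _ calculation(2)])
         (use Cons.prems height_pos in \<open>force simp: weight_height_simps\<close>)+
    ultimately show False using height_pos[of \<beta>] Cons.prems by (simp add: weight_height_simps)
  qed
  then have "(\<Sum>\<kappa>\<in>UNIV. E \<beta> $ \<nu> $ \<kappa> * xprod bs t $ \<kappa> $ \<nu>) = 0"
    by (intro sum.neutral) blast
  then show ?case using Cons by (simp add: matrix_mult_root_elem_nth)
qed (simp add: mat_def)

text \<open>
  No chain of at least one step with roots of \<open>bs\<close> leads to the difference \<open>\<beta>\<close>: two or more steps have too
  large a height, unless they avoid \<open>\<alpha>\<^sub>4\<close> while \<open>\<beta>\<close> contains it, and a single step is a root different from \<open>\<beta>\<close>.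
\<close>

lemma adapted_nth_eq_0:
  assumes "adapted (\<beta> # bs)" "Rep_weight \<mu> = Rep_weight \<nu> + root_weight \<beta>"
  shows "xprod bs t $ \<mu> $ \<nu> = 0"
proof (rule ccontr)
  assume nz: "xprod bs t $ \<mu> $ \<nu> \<noteq> 0"
  have \<beta>: "\<beta> \<in> positive_roots" "\<beta> \<notin> set bs" and bs: "set bs \<subseteq> positive_roots"
    and sep: "\<And>\<gamma>. \<gamma> \<in> set bs \<Longrightarrow> height \<beta> \<le> height \<gamma> \<or> \<beta> $ 4 \<noteq> 0 \<and> \<gamma> $ 4 = 0"
    using assms(1) adapted_positive_roots[of bs] by auto
  define Q where "Q \<delta> \<longleftrightarrow> \<delta> = 0 \<or> weight_height \<delta> > height \<beta> \<or> (\<exists>\<gamma>\<in>set bs. \<delta> = root_weight \<gamma>) \<or>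
     \<beta> $ 4 \<noteq> 0 \<and> weight_level_4 \<delta> = 0 \<and> weight_height \<delta> > 0" for \<delta>
  have "Q (Rep_weight \<mu> - Rep_weight \<nu>)"
  proof (rule xprod_nth_nonzero[OF _ _ bs nz])
    show "Q 0" by (simp add: Q_def)
    fix \<delta> \<gamma> assume "Q \<delta>" and \<gamma>: "\<gamma> \<in> set bs"
    have h: "height \<gamma>' > 0" if "\<gamma>' \<in> set bs" for \<gamma>' using bs height_pos that by blast
    from \<open>Q \<delta>\<close> consider "\<delta> = 0" | "weight_height \<delta> > height \<beta>" | \<gamma>' where "\<gamma>' \<in> set bs" "\<delta> = root_weight \<gamma>'"
      | "\<beta> $ 4 \<noteq> 0" "weight_level_4 \<delta> = 0" "weight_height \<delta> > 0"
      unfolding Q_def by blast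
    then show "Q (\<delta> + root_weight \<gamma>)"
    proof cases
      case 3
      then show ?thesis using sep[OF \<gamma>] sep[OF 3(1)] h[OF \<gamma>] h[OF 3(1)]
        by (auto simp: Q_def weight_height_simps weight_level_4_simps)
    next
      case 4
      then show ?thesis using sep[OF \<gamma>] h[OF \<gamma>]
        by (auto simp: Q_def weight_height_simps weight_level_4_simps)
    qed (use \<gamma> h[OF \<gamma>] in \<open>auto simp: Q_def weight_height_simps\<close>)
  qed
  then have "Q (root_weight \<beta>)" using assms(2) by simp
  moreover have "root_weight \<beta> \<noteq> 0" using height_pos[OF \<beta>(1)] weight_height_simps(4)[of \<beta>]
    by (auto simp: weight_height_simps(1))
  ultimately show False
    using \<beta> bs root_weight_inj[OF \<beta>(1)] by (auto simp: Q_def weight_height_simps weight_level_4_simps)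
qed

definition coefficient :: "int^6 \<Rightarrow> 'a ^ weight ^ weight \<Rightarrow> 'a" where
  "coefficient \<beta> g = E \<beta> $ fst (entry_of \<beta>) $ snd (entry_of \<beta>) * g $ fst (entry_of \<beta>) $ snd (entry_of \<beta>)"

lemma E_entry_square:
  assumes "\<beta> \<in> positive_roots"
  shows "E \<beta> $ fst (entry_of \<beta>) $ snd (entry_of \<beta>) * E \<beta> $ fst (entry_of \<beta>) $ snd (entry_of \<beta>) = 1"
  using E_nth_cases[OF assms] E_nth_eq_0_iff[OF assms] entry_of[OF assms] by fastforce

lemma coefficient_mult:
  assumes \<beta>: "\<beta> \<in> positive_roots"
    and g: "g $ fst (entry_of \<beta>) $ snd (entry_of \<beta>) = 0" "g $ snd (entry_of \<beta>) $ snd (entry_of \<beta>) = 1"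
  shows "coefficient \<beta> (x \<beta> s ** g) = s"
proof -
  obtain \<mu> \<nu> where p: "entry_of \<beta> = (\<mu>, \<nu>)" by fastforce
  have \<mu>: "Rep_weight \<mu> = Rep_weight \<nu> + root_weight \<beta>" using entry_of[OF \<beta>] p by simp
  have "(\<Sum>\<kappa>\<in>UNIV. E \<beta> $ \<mu> $ \<kappa> * g $ \<kappa> $ \<nu>) = (\<Sum>\<kappa>\<in>{\<nu>}. E \<beta> $ \<mu> $ \<kappa> * g $ \<kappa> $ \<nu>)"
    using E_nth_eq_0_iff[OF \<beta>] \<mu> by (intro sum.mono_neutral_right) (auto simp: Rep_weight_inject)
  then have "(x \<beta> s ** g) $ \<mu> $ \<nu> = s * E \<beta> $ \<mu> $ \<nu>"
    using g p by (simp add: matrix_mult_root_elem_nth)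
  then show ?thesis using E_entry_square[OF \<beta>] p by (simp add: coefficient_def mult.left_commute)
qed

text \<open>
  The coordinates of a product of root elements, computed from the left: read off the first one and divide
  by its root element. Outside of the listed roots the value is \<open>undefined\<close>, as for the elements of a
  product measure space.
\<close>

fun xcoord :: "(int^6) list \<Rightarrow> 'a ^ weight ^ weight \<Rightarrow> int^6 \<Rightarrow> 'a" where
  "xcoord [] g = (\<lambda>_. undefined)"
| "xcoord (\<beta> # bs) g = (xcoord bs (x \<beta> (- coefficient \<beta> g) ** g))(\<beta> := coefficient \<beta> g)"

lemma xcoord_xprod:
  assumes "adapted bs"
  shows "xcoord bs (xprod bs t) = restrict t (set bs)"
  using assms
proof (induction bs)
  case (Cons \<beta> bs)
  have \<beta>: "\<beta> \<in> positive_roots" using Cons.prems by simp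
  have bs: "adapted bs" "set bs \<subseteq> positive_roots" using Cons.prems adapted_positive_roots[of bs] by auto
  have coeff: "coefficient \<beta> (x \<beta> (t \<beta>) ** xprod bs t) = t \<beta>"
    using adapted_nth_eq_0[OF Cons.prems entry_of[OF \<beta>]] bs(2)
    by (intro coefficient_mult \<beta> xprod_diagonal) simp_all
  have "x \<beta> (- t \<beta>) ** (x \<beta> (t \<beta>) ** xprod bs t) = xprod bs t"
    by (simp add: matrix_mul_assoc root_elem_inverse(2)[OF \<beta>])
  then show ?case using Cons.IH[OF bs(1)] coeff by (auto simp: fun_eq_iff restrict_def)
qed (auto simp: restrict_def)

end

section \<open>Haar measure on unipotent groups\<close>

lemma continuous_on_matrix_mult:
  fixes f g :: "'z::topological_space \<Rightarrow> 'a::padic_field ^ 'n ^ 'n"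
  assumes "continuous_on S f" "continuous_on S g"
  shows "continuous_on S (\<lambda>z. f z ** g z)"
  unfolding matrix_matrix_mult_def
  by (intro continuous_on_vec_lambda continuous_on_sum continuous_on_mult' continuous_on_component assms)

lemma borel_measurable_matrix_mult [measurable (raw)]:
  fixes f g :: "'z \<Rightarrow> 'a::padic_field ^ 'n ^ 'n"
  assumes "f \<in> borel_measurable M" "g \<in> borel_measurable M"
  shows "(\<lambda>z. f z ** g z) \<in> borel_measurable M"
  using assms by (rule borel_measurable_continuous_Pair) (intro continuous_on_matrix_mult continuous_intros)

text \<open>
  The condition that defines the principal congruence subgroups of \<open>GL\<close>.
\<close>

definition congruent_1 :: "nat \<Rightarrow> 'a::padic_field ^ 'n ^ 'n \<Rightarrow> bool" where
  "congruent_1 n g \<longleftrightarrow> (\<forall>i j. (g - mat 1) $ i $ j \<in> max_ideal_power n)"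

lemma congruent_1_one [simp]: "congruent_1 n (mat 1)"
  by (simp add: congruent_1_def)

lemma congruent_1_0: "congruent_1 0 g \<longleftrightarrow> (\<forall>i j. g $ i $ j \<in> ring_of_integers)"
proof -
  have one: "(mat 1 :: 'a ^ 'n ^ 'n) $ i $ j \<in> max_ideal_power 0" for i j
    by (simp add: mat_def max_ideal_power_0 ring_of_integers_def)
  have "(g - mat 1) $ i $ j \<in> max_ideal_power 0 \<longleftrightarrow> g $ i $ j \<in> max_ideal_power 0" for i j
    using max_ideal_power_add[OF _ one, of "g $ i $ j - mat 1 $ i $ j" i j]
      max_ideal_power_diff[OF _ one, of "g $ i $ j" i j] by auto
  then show ?thesis by (simp add: congruent_1_def max_ideal_power_0)
qed

lemma congruent_1_mult:
  assumes "congruent_1 n g" "congruent_1 n h"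
  shows "congruent_1 n (g ** h)"
proof -
  have "g ** h - mat 1 = (g - mat 1) ** h + (h - mat 1)"
    by (simp add: vec_eq_iff matrix_matrix_mult_def left_diff_distrib sum_subtractf)
       (simp add: mat_def if_distrib[of "\<lambda>x. x * _"] cong: if_cong)
  moreover have "((g - mat 1) ** h) $ i $ j \<in> max_ideal_power n" for i j
  proof -
    have "congruent_1 0 h" using assms(2) max_ideal_power_le[of _ n 0] by (auto simp: congruent_1_def)
    then have "absv (h $ k $ j) \<le> 1" for k by (simp add: congruent_1_0 ring_of_integers_def)
    then have "h $ k $ j * (g - mat 1) $ i $ k \<in> max_ideal_power n" for k
      using assms(1) unfolding congruent_1_def by (intro max_ideal_power_mult) auto
    then show ?thesis unfolding matrix_matrix_mult_def
      by (simp add: mult.commute[of _ "h $ _ $ _"] del: vector_minus_component) (intro max_ideal_power_sum)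
  qed
  moreover have "(h - mat 1) $ i $ j \<in> max_ideal_power n" for i j
    using assms(2) by (simp only: congruent_1_def)
  ultimately show ?thesis
    unfolding congruent_1_def by (auto simp only: vector_add_component intro!: max_ideal_power_add)
qed

lemma open_congruent_1: "open {g :: 'a::padic_field ^ 'n ^ 'n. congruent_1 n g}"
proof -
  have "{g :: 'a ^ 'n ^ 'n. congruent_1 n g} = (\<Inter>i. \<Inter>j. (\<lambda>g. (g - mat 1) $ i $ j) -` max_ideal_power n)"
    by (auto simp: congruent_1_def)
  moreover have "open ((\<lambda>g :: 'a ^ 'n ^ 'n. (g - mat 1) $ i $ j) -` max_ideal_power n)" for i j
  proof (rule open_vimage[OF open_max_ideal_power])
    have "continuous_on UNIV (\<lambda>g :: 'a ^ 'n ^ 'n. g $ i $ j - mat 1 $ i $ j)"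
      by (intro continuous_intros)
    then show "continuous_on UNIV (\<lambda>g :: 'a ^ 'n ^ 'n. (g - mat 1) $ i $ j)" by simp
  qed
  ultimately show ?thesis by (simp add: open_INT)
qed

lemma congruent_1_neighbourhood:
  fixes W :: "('a::padic_field ^ 'n ^ 'n) set"
  assumes "open W" "mat 1 \<in> W"
  obtains n where "\<And>g. congruent_1 n g \<Longrightarrow> g \<in> W"
proof -
  obtain e where e: "e > 0" "\<And>g. dist g (mat 1) < e \<Longrightarrow> g \<in> W"
    using assms unfolding open_dist by blast
  let ?N = "real CARD('n) * real CARD('n)"
  have "e / ?N > 0" using e(1) by simp
  then obtain n where n: "absv (uniformizer :: 'a) ^ n < e / ?N" using uniformizer_power_arch by blast
  have "g \<in> W" if g: "congruent_1 n g" for g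
  proof -
    have le_sum: "dist v w \<le> (\<Sum>i\<in>UNIV. dist (v $ i) (w $ i))" for v w :: "'b::metric_space ^ 'n"
      unfolding dist_vec_def by (rule L2_set_le_sum) simp
    have "dist g (mat 1) \<le> (\<Sum>i\<in>UNIV. dist (g $ i) (mat 1 $ i))" by (rule le_sum)
    also have "\<dots> \<le> (\<Sum>i\<in>UNIV. \<Sum>j\<in>UNIV. dist (g $ i $ j) (mat 1 $ i $ j))"
      by (intro sum_mono le_sum)
    also have "\<dots> \<le> (\<Sum>i\<in>(UNIV :: 'n set). \<Sum>j\<in>(UNIV :: 'n set). absv (uniformizer :: 'a) ^ n)"
      using g by (intro sum_mono) (simp add: congruent_1_def max_ideal_power_def dist_absv)
    also have "\<dots> = ?N * absv (uniformizer :: 'a) ^ n" by simp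
    also have "\<dots> < e" using n by (simp add: field_simps)
    finally show ?thesis by (rule e(2))
  qed
  then show thesis by (rule that)
qed

locale chevalley_haar = normalized_haar dc + chevalley E
  for dc :: "'a::padic_field measure" and E :: "int^6 \<Rightarrow> 'a ^ weight ^ weight"
begin

abbreviation coord_space :: "(int^6) set \<Rightarrow> (int^6 \<Rightarrow> 'a) measure" where
  "coord_space B \<equiv> (\<Pi>\<^sub>M \<beta>\<in>B. dc)"

lemma continuous_on_root_elem:
  assumes "continuous_on S f"
  shows "continuous_on S (\<lambda>z. x \<beta> (f z))"
proof -
  have "x \<beta> t = (\<chi> i j. mat 1 $ i $ j + t * E \<beta> $ i $ j)" for t
    by (simp add: vec_eq_iff root_elem_def mat_scale_nth)
  then show ?thesis using assms
    by (simp add: continuous_on_vec_lambda continuous_on_add continuous_on_mult')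
qed

lemma borel_measurable_root_elem [measurable (raw)]:
  assumes "f \<in> borel_measurable M"
  shows "(\<lambda>z. x \<beta> (f z)) \<in> borel_measurable M"
proof -
  have "x \<beta> \<in> borel_measurable borel"
    by (intro borel_measurable_continuous_onI continuous_on_root_elem continuous_intros)
  from measurable_compose[OF assms this] show ?thesis .
qed

lemma continuous_on_coefficient:
  "continuous_on S h \<Longrightarrow> continuous_on S (\<lambda>z. coefficient \<beta> (h z))"
  unfolding coefficient_def by (intro continuous_on_mult' continuous_intros)

lemma continuous_on_xcoord:
  "continuous_on S h \<Longrightarrow> \<beta> \<in> set bs \<Longrightarrow> continuous_on S (\<lambda>z. xcoord bs (h z) \<beta>)"
proof (induction bs arbitrary: h)
  case (Cons \<gamma> bs)
  show ?case
  proof (cases "\<beta> = \<gamma>")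
    case True
    then show ?thesis using Cons.prems by (simp add: continuous_on_coefficient)
  next
    case False
    have "continuous_on S (\<lambda>z. x \<gamma> (- coefficient \<gamma> (h z)) ** h z)"
      using Cons.prems by (intro continuous_on_matrix_mult continuous_on_root_elem continuous_on_minus continuous_on_coefficient)
    then show ?thesis using False Cons by simp
  qed
qed simp

lemma continuous_on_xprod_inv:
  "(\<And>\<beta>. \<beta> \<in> set bs \<Longrightarrow> continuous_on S (\<lambda>z. t z \<beta>)) \<Longrightarrow> continuous_on S (\<lambda>z. xprod_inv bs (t z))"
  by (induction bs) (auto intro!: continuous_on_matrix_mult continuous_on_root_elem continuous_on_minus)

lemma borel_measurable_xprod:
  "(\<And>\<beta>. \<beta> \<in> set bs \<Longrightarrow> (\<lambda>z. t z \<beta>) \<in> borel_measurable M) \<Longrightarrow> (\<lambda>z. xprod bs (t z)) \<in> borel_measurable M"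
  by (induction bs) (auto intro!: borel_measurable_matrix_mult borel_measurable_root_elem)

lemma xcoord_extensional: "xcoord bs g \<in> extensional (set bs)"
  by (induction bs arbitrary: g) (auto simp: extensional_def)

lemma space_coord_space: "space (coord_space B) = extensional B"
  by (simp add: space_PiM PiE_def)

lemma measurable_xcoord: "xcoord bs \<in> measurable borel (coord_space (set bs))"
proof -
  have "(\<lambda>g \<beta>. xcoord bs g \<beta>) \<in> measurable borel (coord_space (set bs))"
  proof (rule measurable_PiM_single')
    show "(\<lambda>g. xcoord bs g \<beta>) \<in> measurable borel dc" if "\<beta> \<in> set bs" for \<beta>
      using continuous_on_xcoord[OF continuous_on_id that]
      by (simp add: measurable_cong_sets[OF refl sets_dc] borel_measurable_continuous_onI)
  qed (use xcoord_extensional in \<open>auto simp: PiE_def\<close>)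
  then show ?thesis by simp
qed

subsection \<open>Translations in coordinates\<close>

definition preserving :: "'z measure \<Rightarrow> ('z \<Rightarrow> 'z) \<Rightarrow> bool" where
  "preserving P T \<longleftrightarrow> T \<in> measurable P P \<and> (\<forall>h\<in>borel_measurable P. (\<integral>\<^sup>+ t. h (T t) \<partial>P) = (\<integral>\<^sup>+ t. h t \<partial>P))"

lemma preserving_nn_integral:
  "preserving P T \<Longrightarrow> h \<in> borel_measurable P \<Longrightarrow> (\<integral>\<^sup>+ t. h (T t) \<partial>P) = (\<integral>\<^sup>+ t. h t \<partial>P)"
  by (simp add: preserving_def)

lemma preserving_comp: "preserving P T \<Longrightarrow> preserving P T' \<Longrightarrow> preserving P (\<lambda>t. T (T' t))"
proof -
  assume T: "preserving P T" and T': "preserving P T'"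
  have "(\<integral>\<^sup>+ t. h (T (T' t)) \<partial>P) = (\<integral>\<^sup>+ t. h t \<partial>P)" if h: "h \<in> borel_measurable P" for h
  proof -
    have "(\<lambda>t. h (T t)) \<in> borel_measurable P"
    proof -
      have "T \<in> measurable P P" using T by (simp add: preserving_def)
      from measurable_compose[OF this h] show ?thesis .
    qed
    from preserving_nn_integral[OF T' this]
    have "(\<integral>\<^sup>+ t. h (T (T' t)) \<partial>P) = (\<integral>\<^sup>+ t. h (T t) \<partial>P)" .
    then show ?thesis using T h by (simp add: preserving_def)
  qed
  then show ?thesis using T T' measurable_compose[of T' P P T P] by (simp add: preserving_def)
qed

text \<open>
  Left translation by a root element, in coordinates. The factor is moved to the right past the first
  factor of the product, which creates at most one more root element, and by induction both are absorbed in
  the remaining factors. Thus the coordinate of the first root is left alone, or translated when the roots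
  agree, while the other coordinates undergo for each of its values a measure preserving map. Joint measurability in
  the parameter \<open>s\<close> is carried along because this parameter depends on a coordinate in the induction step.
\<close>

lemma root_elem_xprod:
  assumes "adapted bs" "\<gamma> \<in> set bs"
  shows "\<exists>T. (\<lambda>(s, t). T s t) \<in> measurable (borel \<Otimes>\<^sub>M coord_space (set bs)) (coord_space (set bs)) \<and>
    (\<forall>s. preserving (coord_space (set bs)) (T s)) \<and>
    (\<forall>s. \<forall>t\<in>space (coord_space (set bs)). x \<gamma> s ** xprod bs t = xprod bs (T s t))"
  using assms
proof (induction bs arbitrary: \<gamma>)
  case (Cons \<beta> bs)
  let ?S = "set bs"
  let ?P = "coord_space ?S"
  let ?P' = "coord_space (insert \<beta> ?S)"
  have \<beta>: "\<beta> \<in> positive_roots" "\<beta> \<notin> ?S" and bs: "adapted bs" "?S \<subseteq> positive_roots"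
    and sum: "\<And>\<gamma>. \<gamma> \<in> ?S \<Longrightarrow> \<beta> + \<gamma> \<in> positive_roots \<Longrightarrow> \<beta> + \<gamma> \<in> ?S"
    using Cons.prems(1) adapted_positive_roots[of bs] by auto
  have meas_\<beta>: "(\<lambda>t. t \<beta>) \<in> borel_measurable ?P'" by (rule measurable_coordinate) simp
  show ?case
  proof (cases "\<gamma> = \<beta>")
    case True
    define T where "T s t = t(\<beta> := s + t \<beta>)" for s and t :: "int^6 \<Rightarrow> 'a"
    have meas: "(\<lambda>(s, t). T s t) \<in> measurable (borel \<Otimes>\<^sub>M ?P') ?P'"
      unfolding T_def case_prod_unfold
      by (rule measurable_fun_upd[of _ "insert \<beta> ?S"])
         (use meas_\<beta> in \<open>auto simp: measurable_cong_sets[OF refl sets_dc]\<close>)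
    have "preserving ?P' (T s)" for s
      unfolding preserving_def
    proof (intro conjI ballI)
      show T: "T s \<in> measurable ?P' ?P'" using measurable_Pair2[OF meas, of s] by simp
      fix h :: "(int^6 \<Rightarrow> 'a) \<Rightarrow> ennreal" assume h: "h \<in> borel_measurable ?P'"
      have "(\<integral>\<^sup>+ t. h (T s t) \<partial>?P') = (\<integral>\<^sup>+ t. \<integral>\<^sup>+ u. h (t(\<beta> := 1 * u + s)) * ennreal (absv (1::'a)) \<partial>dc \<partial>?P)"
        using product_nn_integral_insert[OF _ \<beta>(2), of "\<lambda>t. h (T s t)"] measurable_compose[OF T h]
        by (simp add: T_def add.commute)
      also have "\<dots> = (\<integral>\<^sup>+ t. \<integral>\<^sup>+ u. h (t(\<beta> := u)) \<partial>dc \<partial>?P)"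
      proof (rule nn_integral_cong)
        fix t assume t: "t \<in> space ?P"
        have "(\<lambda>u. h (t(\<beta> := u))) \<in> borel_measurable borel"
          using measurable_compose[OF measurable_component_update[OF t \<beta>(2)] h]
          by (simp add: measurable_cong_sets[OF sets_dc refl])
        from nn_integral_affine[OF one_neq_zero this]
        show "(\<integral>\<^sup>+ u. h (t(\<beta> := 1 * u + s)) * ennreal (absv (1::'a)) \<partial>dc) = (\<integral>\<^sup>+ u. h (t(\<beta> := u)) \<partial>dc)" .
      qed
      also have "\<dots> = (\<integral>\<^sup>+ t. h t \<partial>?P')"
        using product_nn_integral_insert[OF _ \<beta>(2) h] by simp
      finally show "(\<integral>\<^sup>+ t. h (T s t) \<partial>?P') = (\<integral>\<^sup>+ t. h t \<partial>?P')" .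
    qed
    moreover have "x \<gamma> s ** xprod (\<beta> # bs) t = xprod (\<beta> # bs) (T s t)" for s t
    proof -
      have "xprod bs (T s t) = xprod bs t" using \<beta>(2) by (intro xprod_cong) (auto simp: T_def)
      then show ?thesis using True \<beta>(1) by (simp add: matrix_mul_assoc root_elem_add) (simp add: T_def)
    qed
    ultimately show ?thesis using meas by auto
  next
    case False
    then have \<gamma>: "\<gamma> \<in> ?S" using Cons.prems(2) by simp
    have "\<exists>R. (\<lambda>(s, u, t). R s u t) \<in> measurable (borel \<Otimes>\<^sub>M borel \<Otimes>\<^sub>M ?P) ?P \<and>
       (\<forall>s u. preserving ?P (R s u)) \<and>
       (\<forall>s u. \<forall>t\<in>space ?P. x \<gamma> s ** (x \<beta> u ** xprod bs t) = x \<beta> u ** xprod bs (R s u t))"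
    proof -
      obtain T where T: "(\<lambda>(s, t). T s t) \<in> measurable (borel \<Otimes>\<^sub>M ?P) ?P" "\<And>s. preserving ?P (T s)"
        "\<And>s t. t \<in> space ?P \<Longrightarrow> x \<gamma> s ** xprod bs t = xprod bs (T s t)"
        using Cons.IH[OF bs(1) \<gamma>] by blast
      have \<gamma>': "\<gamma> \<in> positive_roots" using \<gamma> bs(2) by blast
      show ?thesis
      proof (cases "\<gamma> + \<beta> \<in> positive_roots")
        case True
        then have "\<gamma> + \<beta> \<in> ?S" using sum[OF \<gamma>] by (simp add: add.commute)
        then obtain T' where T': "(\<lambda>(s, t). T' s t) \<in> measurable (borel \<Otimes>\<^sub>M ?P) ?P" "\<And>s. preserving ?P (T' s)"
          "\<And>s t. t \<in> space ?P \<Longrightarrow> x (\<gamma> + \<beta>) s ** xprod bs t = xprod bs (T' s t)"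
          using Cons.IH[OF bs(1)] by blast
        obtain \<sigma> where \<sigma>: "\<And>s u. x \<gamma> s ** x \<beta> u = x \<beta> u ** (x \<gamma> s ** x (\<gamma> + \<beta>) (\<sigma> * s * u))"
          using root_elem_commutator[OF \<gamma>' \<beta>(1) True] by blast
        define R where "R s u t = T s (T' (\<sigma> * s * u) t)" for s u t
        have "(\<lambda>(s, u, t). R s u t) \<in> measurable (borel \<Otimes>\<^sub>M borel \<Otimes>\<^sub>M ?P) ?P"
        proof -
          have 1: "(\<lambda>p. (\<sigma> * fst p * fst (snd p), snd (snd p))) \<in> measurable (borel \<Otimes>\<^sub>M borel \<Otimes>\<^sub>M ?P) (borel \<Otimes>\<^sub>M ?P)"
            by measurable
          have "(\<lambda>p. T' (\<sigma> * fst p * fst (snd p)) (snd (snd p))) \<in> measurable (borel \<Otimes>\<^sub>M borel \<Otimes>\<^sub>M ?P) ?P"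
            using measurable_compose[OF 1 T'(1)] by simp
          then have 2: "(\<lambda>p. (fst p, T' (\<sigma> * fst p * fst (snd p)) (snd (snd p)))) \<in> measurable (borel \<Otimes>\<^sub>M borel \<Otimes>\<^sub>M ?P) (borel \<Otimes>\<^sub>M ?P)"
            by measurable
          show ?thesis using measurable_compose[OF 2 T(1)] by (simp add: R_def case_prod_unfold)
        qed
        moreover have "preserving ?P (R s u)" for s u
          unfolding R_def using preserving_comp[OF T(2) T'(2)] .
        moreover have "x \<gamma> s ** (x \<beta> u ** xprod bs t) = x \<beta> u ** xprod bs (R s u t)" if t: "t \<in> space ?P" for s u t
        proof -
          have "T' (\<sigma> * s * u) t \<in> space ?P"
            using T'(2)[of "\<sigma> * s * u"] t by (auto simp: preserving_def dest: measurable_space)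
          then have "xprod bs (R s u t) = x \<gamma> s ** (x (\<gamma> + \<beta>) (\<sigma> * s * u) ** xprod bs t)"
            unfolding R_def using T(3) T'(3) t by metis
          then show ?thesis using \<sigma>[of s u] by (simp add: matrix_mul_assoc)
        qed
        ultimately show ?thesis by blast
      next
        case False
        define R where "R s u t = T s t" for s and u :: 'a and t
        have "(\<lambda>(s, u, t). R s u t) \<in> measurable (borel \<Otimes>\<^sub>M borel \<Otimes>\<^sub>M ?P) ?P"
        proof -
          have 1: "(\<lambda>p. (fst p, snd (snd p))) \<in> measurable (borel \<Otimes>\<^sub>M borel \<Otimes>\<^sub>M ?P) (borel \<Otimes>\<^sub>M ?P)"
            by measurable
          show ?thesis using measurable_compose[OF 1 T(1)] by (simp add: R_def case_prod_unfold)
        qed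
        moreover have "x \<gamma> s ** (x \<beta> u ** xprod bs t) = x \<beta> u ** xprod bs (R s u t)" if t: "t \<in> space ?P" for s u t
          using root_elem_commute[OF \<gamma>' \<beta>(1) False, of s u] T(3)[OF t, of s]
          by (metis R_def matrix_mul_assoc)
        ultimately show ?thesis using T(2) by (intro exI[of _ R]) (auto simp: R_def[abs_def])
      qed
    qed
    then obtain R where R: "(\<lambda>(s, u, t). R s u t) \<in> measurable (borel \<Otimes>\<^sub>M borel \<Otimes>\<^sub>M ?P) ?P"
       "\<And>s u. preserving ?P (R s u)"
       "\<And>s u t. t \<in> space ?P \<Longrightarrow> x \<gamma> s ** (x \<beta> u ** xprod bs t) = x \<beta> u ** xprod bs (R s u t)"
      by blast
    define T where "T s t = (R s (t \<beta>) (restrict t ?S))(\<beta> := t \<beta>)" for s t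
    have restr: "(\<lambda>t. restrict t ?S) \<in> measurable ?P' ?P" by (rule measurable_restrict_subset) auto
    have meas: "(\<lambda>(s, t). T s t) \<in> measurable (borel \<Otimes>\<^sub>M ?P') ?P'"
      unfolding T_def case_prod_unfold
    proof (rule measurable_fun_upd[of _ ?S])
      have m\<beta>: "(\<lambda>p. snd p \<beta>) \<in> borel_measurable (borel \<Otimes>\<^sub>M ?P')"
        using measurable_compose[OF measurable_snd meas_\<beta>] .
      then show "(\<lambda>p. snd p \<beta>) \<in> measurable (borel \<Otimes>\<^sub>M ?P') dc"
        by (simp add: measurable_cong_sets[OF refl sets_dc])
      have "(\<lambda>p. (fst p, snd p \<beta>, restrict (snd p) ?S)) \<in> measurable (borel \<Otimes>\<^sub>M ?P') (borel \<Otimes>\<^sub>M borel \<Otimes>\<^sub>M ?P)"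
        using m\<beta> measurable_compose[OF measurable_snd restr] by (intro measurable_Pair measurable_fst)
      from measurable_compose[OF this R(1)]
      show "(\<lambda>p. R (fst p) (snd p \<beta>) (restrict (snd p) ?S)) \<in> measurable (borel \<Otimes>\<^sub>M ?P') ?P" by simp
    qed simp
    have "preserving ?P' (T s)" for s
      unfolding preserving_def
    proof (intro conjI ballI)
      show T: "T s \<in> measurable ?P' ?P'" using measurable_Pair2[OF meas, of s] by simp
      fix h :: "(int^6 \<Rightarrow> 'a) \<Rightarrow> ennreal" assume h: "h \<in> borel_measurable ?P'"
      have restrict: "restrict (t(\<beta> := u)) ?S = t" if "t \<in> space ?P" for t u
        using that \<beta>(2) by (auto simp: space_coord_space extensional_def restrict_def fun_eq_iff)
      have "(\<integral>\<^sup>+ t. h (T s t) \<partial>?P') = (\<integral>\<^sup>+ u. \<integral>\<^sup>+ t. h (T s (t(\<beta> := u))) \<partial>?P \<partial>dc)"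
        using product_nn_integral_insert_rev[OF _ \<beta>(2), of "\<lambda>t. h (T s t)"] measurable_compose[OF T h] by simp
      also have "\<dots> = (\<integral>\<^sup>+ u. \<integral>\<^sup>+ t. h ((R s u t)(\<beta> := u)) \<partial>?P \<partial>dc)"
        by (intro nn_integral_cong) (simp add: T_def restrict)
      also have "\<dots> = (\<integral>\<^sup>+ u. \<integral>\<^sup>+ t. h (t(\<beta> := u)) \<partial>?P \<partial>dc)"
      proof (rule nn_integral_cong)
        fix u
        have "(\<lambda>t. t(\<beta> := u)) \<in> measurable ?P ?P'" by (rule measurable_fun_upd[of _ ?S]) auto
        from preserving_nn_integral[OF R(2) measurable_compose[OF this h]]
        show "(\<integral>\<^sup>+ t. h ((R s u t)(\<beta> := u)) \<partial>?P) = (\<integral>\<^sup>+ t. h (t(\<beta> := u)) \<partial>?P)" .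
      qed
      also have "\<dots> = (\<integral>\<^sup>+ t. h t \<partial>?P')"
        using product_nn_integral_insert_rev[OF _ \<beta>(2) h] by simp
      finally show "(\<integral>\<^sup>+ t. h (T s t) \<partial>?P') = (\<integral>\<^sup>+ t. h t \<partial>?P')" .
    qed
    moreover have "x \<gamma> s ** xprod (\<beta> # bs) t = xprod (\<beta> # bs) (T s t)" if t: "t \<in> space ?P'" for s t
    proof -
      have "restrict t ?S \<in> space ?P" using measurable_space[OF restr t] .
      then have "x \<gamma> s ** (x \<beta> (t \<beta>) ** xprod bs (restrict t ?S)) = x \<beta> (t \<beta>) ** xprod bs (R s (t \<beta>) (restrict t ?S))"
        by (rule R(3))
      moreover have "xprod bs (restrict t ?S) = xprod bs t" by (rule xprod_cong) simp
      moreover have "xprod bs (R s (t \<beta>) (restrict t ?S)) = xprod bs (T s t)"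
        using \<beta>(2) by (intro xprod_cong) (auto simp: T_def)
      ultimately show ?thesis by (simp add: T_def)
    qed
    ultimately show ?thesis using meas by auto
  qed
qed simp

lemma span_xprod:
  assumes "adapted bs" "g \<in> root_subgroup_span bs"
  shows "\<exists>T. preserving (coord_space (set bs)) T \<and>
    (\<forall>t\<in>space (coord_space (set bs)). g ** xprod bs t = xprod bs (T t))"
  using assms(2) adapted_positive_roots[OF assms(1)]
proof (induction rule: root_subgroup_span_induct)
  case one
  show ?case by (intro exI[of _ "\<lambda>t. t"]) (simp add: preserving_def)
next
  case (root_elem \<beta> s)
  then show ?case using root_elem_xprod[OF assms(1), of \<beta>] by blast
next
  case (mult g h)
  then obtain T T' where T: "preserving (coord_space (set bs)) T" "\<And>t. t \<in> space (coord_space (set bs)) \<Longrightarrow> g ** xprod bs t = xprod bs (T t)"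
    and T': "preserving (coord_space (set bs)) T'" "\<And>t. t \<in> space (coord_space (set bs)) \<Longrightarrow> h ** xprod bs t = xprod bs (T' t)"
    by blast
  have "(g ** h) ** xprod bs t = xprod bs (T (T' t))" if t: "t \<in> space (coord_space (set bs))" for t
  proof -
    have "T' t \<in> space (coord_space (set bs))" using T'(1) t by (auto simp: preserving_def dest: measurable_space)
    then show ?thesis using T(2) T'(2)[OF t] by (simp flip: matrix_mul_assoc)
  qed
  then show ?case using preserving_comp[OF T(1) T'(1)] by blast
qed

lemma root_subgroup_span_eq:
  assumes "adapted bs"
  shows "root_subgroup_span bs = xprod bs ` space (coord_space (set bs))"
proof (intro equalityI subsetI)
  fix g assume g: "g \<in> root_subgroup_span bs"
  obtain T where T: "preserving (coord_space (set bs)) T"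
    "\<And>t. t \<in> space (coord_space (set bs)) \<Longrightarrow> g ** xprod bs t = xprod bs (T t)"
    using span_xprod[OF assms g] by blast
  define t0 where "t0 = (restrict (\<lambda>_. 0) (set bs) :: int^6 \<Rightarrow> 'a)"
  have t0: "t0 \<in> space (coord_space (set bs))" by (simp add: t0_def space_coord_space)
  have "xprod bs' t = mat 1" if "\<And>\<beta>. \<beta> \<in> set bs' \<Longrightarrow> t \<beta> = 0" for bs' t using that by (induction bs') auto
  then have "xprod bs t0 = mat 1" by (simp add: t0_def)
  then have "g = xprod bs (T t0)" using T(2)[OF t0] by simp
  moreover have "T t0 \<in> space (coord_space (set bs))" using T(1) t0 by (auto simp: preserving_def dest: measurable_space)
  ultimately show "g \<in> xprod bs ` space (coord_space (set bs))" by blast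
qed (use xprod_in_span in auto)

lemma congruent_1_root_elem:
  assumes "\<beta> \<in> positive_roots" "s \<in> max_ideal_power n"
  shows "congruent_1 n (x \<beta> s)"
proof -
  have "s * E \<beta> $ i $ j \<in> max_ideal_power n" for i j
    using E_nth_cases[OF assms(1), of i j] assms(2) max_ideal_power_minus by auto
  moreover have "(x \<beta> s - mat 1) $ i $ j = s * E \<beta> $ i $ j" for i j
    by (simp add: root_elem_def mat_scale_nth)
  ultimately show ?thesis by (auto simp only: congruent_1_def)
qed

text \<open>
  Congruence subgroups contain boxes in the coordinates; for the integral points the converse holds too.
\<close>

lemma congruent_1_xprod:
  assumes "set bs \<subseteq> positive_roots" "\<And>\<beta>. \<beta> \<in> set bs \<Longrightarrow> t \<beta> \<in> max_ideal_power n"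
  shows "congruent_1 n (xprod bs t)" and "congruent_1 n (xprod_inv bs t)"
  using assms
  by (induction bs) (auto intro!: congruent_1_mult congruent_1_root_elem max_ideal_power_minus)

text \<open>
  The coordinates are successively read off from entries of integral matrices up to sign.
\<close>

lemma xcoord_integral:
  "congruent_1 0 g \<Longrightarrow> set bs \<subseteq> positive_roots \<Longrightarrow> \<beta> \<in> set bs \<Longrightarrow> xcoord bs g \<beta> \<in> ring_of_integers"
proof (induction bs arbitrary: g)
  case (Cons \<gamma> bs)
  have \<gamma>: "\<gamma> \<in> positive_roots" using Cons.prems by simp
  have "absv (coefficient \<gamma> g) \<le> 1"
    using Cons.prems(1) E_nth_cases[OF \<gamma>, of "fst (entry_of \<gamma>)" "snd (entry_of \<gamma>)"]
    by (auto simp: coefficient_def congruent_1_0 ring_of_integers_def)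
  then have coeff: "coefficient \<gamma> g \<in> ring_of_integers" by (simp add: ring_of_integers_def)
  show ?case
  proof (cases "\<beta> = \<gamma>")
    case False
    have "congruent_1 0 (x \<gamma> (- coefficient \<gamma> g) ** g)"
      using coeff Cons.prems(1) \<gamma>
      by (intro congruent_1_mult congruent_1_root_elem max_ideal_power_minus) (simp_all add: max_ideal_power_0)
    then show ?thesis using Cons False by simp
  qed (use coeff in simp)
qed simp

lemma xprod_inv_cong: "(\<And>\<beta>. \<beta> \<in> set bs \<Longrightarrow> t \<beta> = t' \<beta>) \<Longrightarrow> xprod_inv bs t = xprod_inv bs t'"
  by (induction bs) auto

text \<open>
  The product of the additive Haar measures is invariant under left translations, which are measure
  preserving in coordinates, and it gives the integral points, which are those with integral coordinates,
  volume one. By uniqueness it is the normalized Haar measure.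
\<close>

theorem haar_measure_xprod:
  assumes bs: "adapted bs"
    and H: "group H" and carrier: "carrier H = root_subgroup_span bs"
    and mult: "\<And>g h. g \<otimes>\<^bsub>H\<^esub> h = g ** h" and one: "\<one>\<^bsub>H\<^esub> = mat 1"
    and M: "haar_measure H M" "emeasure M (integral_points H) = 1"
  shows "M = distr (coord_space (set bs)) (restrict_space borel (carrier H)) (xprod bs)"
proof -
  interpret H: group H by (rule H)
  let ?P = "coord_space (set bs)"
  let ?R = "restrict_space borel (carrier H)"
  let ?N = "distr ?P ?R (xprod bs)"
  have pos: "set bs \<subseteq> positive_roots" using bs by (rule adapted_positive_roots)
  have carrier': "carrier H = xprod bs ` space ?P" unfolding carrier by (rule root_subgroup_span_eq[OF bs])
  have inv: "inv\<^bsub>H\<^esub> g = xprod_inv bs (xcoord bs g)" if g: "g \<in> carrier H" for g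
  proof -
    obtain t where t: "t \<in> space ?P" "g = xprod bs t" using g carrier' by blast
    have "xprod_inv bs (xcoord bs g) = xprod_inv bs t"
      unfolding t(2) xcoord_xprod[OF bs] by (rule xprod_inv_cong) simp
    then have left: "xprod_inv bs (xcoord bs g) ** g = mat 1" using xprod_inverse[OF pos, of t] t(2) by simp
    have right: "g ** inv\<^bsub>H\<^esub> g = mat 1" using H.r_inv[OF g] by (simp add: mult one)
    have "xprod_inv bs (xcoord bs g) = xprod_inv bs (xcoord bs g) ** (g ** inv\<^bsub>H\<^esub> g)" by (simp add: right)
    also have "\<dots> = inv\<^bsub>H\<^esub> g" by (simp add: matrix_mul_assoc left)
    finally show ?thesis ..
  qed
  \<comment> \<open>The condition on the inverse makes these subgroups without any appeal to determinants.\<close>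
  define K where "K n = {g \<in> carrier H. congruent_1 n g \<and> congruent_1 n (inv\<^bsub>H\<^esub> g)}" for n
  have K: "subgroup (K n) H" for n
  proof (rule H.subgroupI)
    show "K n \<noteq> {}"
      using H.one_closed H.inv_one by (auto simp: K_def one intro!: exI[of _ "mat 1"])
    show "g \<otimes>\<^bsub>H\<^esub> h \<in> K n" if "g \<in> K n" "h \<in> K n" for g h
      using that H.m_closed[of g h] H.inv_mult_group[of g h]
      by (auto simp: K_def mult intro!: congruent_1_mult)
  qed (auto simp: K_def)
  have K0: "K 0 = integral_points H" by (auto simp: K_def integral_points_def congruent_1_0)
  have opens: "\<exists>V. open V \<and> g <#\<^bsub>H\<^esub> K n = V \<inter> carrier H" if g: "g \<in> carrier H" for g n
  proof (intro exI conjI)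
    \<comment> \<open>The inverse is a continuous function of the coordinates, hence so is the condition on it.\<close>
    let ?V = "(\<lambda>h. inv\<^bsub>H\<^esub> g ** h) -` {k. congruent_1 n k} \<inter>
      (\<lambda>h. xprod_inv bs (xcoord bs h) ** g) -` {k. congruent_1 n k}"
    show "open ?V"
      by (intro open_Int open_vimage open_congruent_1 continuous_on_matrix_mult continuous_on_xprod_inv
          continuous_on_xcoord continuous_on_const continuous_on_id)
    have inv_coset: "inv\<^bsub>H\<^esub> (inv\<^bsub>H\<^esub> g \<otimes>\<^bsub>H\<^esub> h) = inv\<^bsub>H\<^esub> h \<otimes>\<^bsub>H\<^esub> g" if "h \<in> carrier H" for h
      using g that by (simp add: H.inv_mult_group)
    have "h \<in> g <#\<^bsub>H\<^esub> K n \<longleftrightarrow> congruent_1 n (inv\<^bsub>H\<^esub> g ** h) \<and> congruent_1 n (inv\<^bsub>H\<^esub> h ** g)"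
      if h: "h \<in> carrier H" for h
    proof -
      have "h \<in> g <#\<^bsub>H\<^esub> K n \<longleftrightarrow> inv\<^bsub>H\<^esub> g ** h \<in> K n"
        using h by (simp add: H.mem_l_coset_iff[OF K g] mult)
      then show ?thesis using h inv_coset[OF h] H.m_closed[OF H.inv_closed[OF g] h]
        by (simp add: K_def mult)
    qed
    moreover have "g <#\<^bsub>H\<^esub> K n \<subseteq> carrier H" using H.mem_l_coset_iff[OF K g] by blast
    ultimately show "g <#\<^bsub>H\<^esub> K n = ?V \<inter> carrier H" by (auto simp: inv)
  qed
  have coset_sets: "g <#\<^bsub>H\<^esub> K n \<in> sets ?R" if g: "g \<in> carrier H" for g n
  proof -
    obtain V where V: "open V" "g <#\<^bsub>H\<^esub> K n = V \<inter> carrier H" using opens[OF g] by blast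
    show ?thesis unfolding sets_restrict_space V(2) using V(1) by (intro image_eqI[of _ _ V]) auto
  qed
  have K_sets: "K n \<in> sets ?R" for n
  proof -
    have "\<one>\<^bsub>H\<^esub> <#\<^bsub>H\<^esub> K n = K n" by (rule H.lcos_mult_one) (auto simp: K_def)
    then show ?thesis using coset_sets[OF H.one_closed, of n] by simp
  qed
  have meas: "xprod bs \<in> measurable ?P ?R"
  proof (rule measurable_restrict_space2)
    show "xprod bs \<in> space ?P \<rightarrow> carrier H" unfolding carrier' by blast
    show "xprod bs \<in> borel_measurable ?P"
      by (rule borel_measurable_xprod) (rule measurable_coordinate)
  qed
  have N_eq: "emeasure ?N X = (\<integral>\<^sup>+ t. indicator X (xprod bs t) \<partial>?P)" if "X \<in> sets ?R" for X
    using nn_integral_distr[OF meas, of "indicator X"] that by simp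
  have congr_set: "xprod bs t \<in> K n" if "t \<in> space ?P" "\<And>\<beta>. \<beta> \<in> set bs \<Longrightarrow> t \<beta> \<in> max_ideal_power n" for t n
  proof -
    have "xprod bs t \<in> carrier H" using that(1) carrier' by blast
    moreover have "xprod_inv bs (xcoord bs (xprod bs t)) = xprod_inv bs t"
      unfolding xcoord_xprod[OF bs] by (rule xprod_inv_cong) simp
    ultimately show ?thesis
      using congruent_1_xprod[OF pos that(2)] by (simp add: K_def inv)
  qed
  have box: "(\<integral>\<^sup>+ t. indicator (PiE (set bs) (\<lambda>_. max_ideal_power n)) t \<partial>?P)
      = (\<Prod>\<beta>\<in>set bs. emeasure dc (max_ideal_power n))"
    "PiE (set bs) (\<lambda>_. max_ideal_power n) \<in> sets ?P" for n
  proof -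
    have *: "max_ideal_power n \<in> sets (borel :: 'a measure)" using borel_open[OF open_max_ideal_power, of n] by simp
    show "PiE (set bs) (\<lambda>_. max_ideal_power n) \<in> sets ?P"
      by (rule sets_PiM_I_finite) (simp_all add: *)
    then show "(\<integral>\<^sup>+ t. indicator (PiE (set bs) (\<lambda>_. max_ideal_power n)) t \<partial>?P)
      = (\<Prod>\<beta>\<in>set bs. emeasure dc (max_ideal_power n))"
      using emeasure_PiM[of "set bs" "\<lambda>_. max_ideal_power n"] * by simp
  qed
  have in_box: "t \<in> PiE (set bs) (\<lambda>_. max_ideal_power n) \<longleftrightarrow> t \<in> space ?P \<and> (\<forall>\<beta>\<in>set bs. t \<beta> \<in> max_ideal_power n)" for t n
    by (auto simp: space_coord_space PiE_def)
  show ?thesis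
  proof (rule haar_measure_eqI[OF H K])
    show "K n \<subseteq> K m" if "m \<le> n" for m n
      using max_ideal_power_le[OF _ that] by (auto simp: K_def congruent_1_def)
    show "\<exists>n. g <#\<^bsub>H\<^esub> K n \<subseteq> U" if U: "open U" "g \<in> U" and g: "g \<in> carrier H" for U g
    proof -
      have "open ((\<lambda>k. g ** k) -` U)"
        using U(1) by (intro open_vimage continuous_on_matrix_mult continuous_on_const continuous_on_id)
      moreover have "mat 1 \<in> (\<lambda>k. g ** k) -` U" using U(2) by simp
      ultimately obtain n where n: "\<And>k. congruent_1 n k \<Longrightarrow> k \<in> (\<lambda>k. g ** k) -` U"
        using congruent_1_neighbourhood by blast
      then have "g <#\<^bsub>H\<^esub> K n \<subseteq> U" by (auto simp: l_coset_def K_def mult)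
      then show ?thesis by blast
    qed
    show "emeasure M (K 0) = 1" using M(2) by (simp only: K0)
    show "sets ?N = sets ?R" by simp
    show "invariant_on_cosets H K ?N"
      unfolding invariant_on_cosets_def
    proof (intro conjI ballI allI)
      fix g n assume g: "g \<in> carrier H"
      show "g <#\<^bsub>H\<^esub> K n \<in> sets ?N" using coset_sets[OF g] by simp
      have "inv\<^bsub>H\<^esub> g \<in> root_subgroup_span bs" using H.inv_closed[OF g] carrier by simp
      then obtain T where T: "preserving ?P T"
        "\<And>t. t \<in> space ?P \<Longrightarrow> inv\<^bsub>H\<^esub> g ** xprod bs t = xprod bs (T t)"
        using span_xprod[OF bs] by blast
      have "xprod bs t \<in> g <#\<^bsub>H\<^esub> K n \<longleftrightarrow> xprod bs (T t) \<in> K n" if t: "t \<in> space ?P" for t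
      proof -
        have "xprod bs t \<in> carrier H" using t carrier' by blast
        then show ?thesis using T(2)[OF t] by (simp add: H.mem_l_coset_iff[OF K g] mult)
      qed
      then have "emeasure ?N (g <#\<^bsub>H\<^esub> K n) = (\<integral>\<^sup>+ t. indicator (K n) (xprod bs (T t)) \<partial>?P)"
        unfolding N_eq[OF coset_sets[OF g]] by (intro nn_integral_cong) (simp add: indicator_def)
      also have "\<dots> = (\<integral>\<^sup>+ t. indicator (K n) (xprod bs t) \<partial>?P)"
      proof -
        have "(\<lambda>t. indicator (K n) (xprod bs t) :: ennreal) \<in> borel_measurable ?P"
          using measurable_compose[OF meas borel_measurable_indicator[OF K_sets]] .
        from preserving_nn_integral[OF T(1) this] show ?thesis .
      qed
      finally show "emeasure ?N (g <#\<^bsub>H\<^esub> K n) = emeasure ?N (K n)" by (simp add: N_eq[OF K_sets])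
    next
      fix n
      have "0 < (\<Prod>\<beta>\<in>set bs. emeasure dc (max_ideal_power n))"
      proof -
        have "0 < emeasure dc (max_ideal_power n)"
          using emeasure_open_pos[OF open_max_ideal_power, of n] max_ideal_power_zero[of n] by blast
        then show ?thesis by (simp add: zero_less_iff_neq_zero)
      qed
      also have "\<dots> \<le> emeasure ?N (K n)"
        unfolding N_eq[OF K_sets] box(1)[symmetric]
        by (rule nn_integral_mono) (use congr_set in \<open>auto simp: indicator_def in_box\<close>)
      finally show "0 < emeasure ?N (K n)" .
    next
      have "xprod bs t \<in> K 0 \<longleftrightarrow> t \<in> PiE (set bs) (\<lambda>_. max_ideal_power 0)" if t: "t \<in> space ?P" for t
      proof
        assume "xprod bs t \<in> K 0"
        then have "xcoord bs (xprod bs t) \<beta> \<in> ring_of_integers" if "\<beta> \<in> set bs" for \<beta>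
          using that pos by (intro xcoord_integral) (simp_all add: K_def)
        then show "t \<in> PiE (set bs) (\<lambda>_. max_ideal_power 0)"
          using t unfolding in_box by (simp add: xcoord_xprod[OF bs] max_ideal_power_0)
      qed (use congr_set t in \<open>simp add: in_box\<close>)
      then have "emeasure ?N (K 0) = (\<integral>\<^sup>+ t. indicator (PiE (set bs) (\<lambda>_. max_ideal_power 0)) t \<partial>?P)"
        unfolding N_eq[OF K_sets] by (intro nn_integral_cong) (simp add: indicator_def)
      also have "\<dots> = 1" unfolding box(1) by (simp add: max_ideal_power_0 normalized)
      finally show "emeasure ?N (K 0) = 1" .
    qed
  qed (use opens M in auto)
qed

text \<open>
  A unipotent group of this kind may be replaced by its space of coordinates.
\<close>

lemma change_of_variables_xprod:
  assumes bs: "adapted bs"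
    and H: "group H" and carrier: "carrier H = root_subgroup_span bs"
    and mult: "\<And>g h. g \<otimes>\<^bsub>H\<^esub> h = g ** h" and one: "\<one>\<^bsub>H\<^esub> = mat 1"
    and M: "haar_measure H M" "emeasure M (integral_points H) = 1"
  shows "change_of_variables (coord_space (set bs)) M (xprod bs) (\<lambda>_. 1)"
    and "change_of_variables M (coord_space (set bs)) (xcoord bs) (\<lambda>_. 1)"
    and "distr (coord_space (set bs)) M (xprod bs) = M"
    and "xprod bs \<in> measurable (coord_space (set bs)) M" and "xcoord bs \<in> measurable M (coord_space (set bs))"
    and "t \<in> space (coord_space (set bs)) \<Longrightarrow> xcoord bs (xprod bs t) = t"
    and "g \<in> space M \<Longrightarrow> xprod bs (xcoord bs g) = g"
proof -
  let ?P = "coord_space (set bs)"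
  let ?R = "restrict_space borel (carrier H)"
  have carrier': "carrier H = xprod bs ` space ?P" unfolding carrier by (rule root_subgroup_span_eq[OF bs])
  have M_eq: "M = distr ?P ?R (xprod bs)" by (rule haar_measure_xprod[OF assms])
  have sets_M: "sets M = sets ?R" by (subst M_eq) simp
  have space_M: "space M = carrier H" using M(1) by (simp add: haar_measure_def)
  show meas: "xprod bs \<in> measurable ?P M"
    unfolding measurable_cong_sets[OF refl sets_M]
  proof (rule measurable_restrict_space2)
    show "xprod bs \<in> space ?P \<rightarrow> carrier H" unfolding carrier' by blast
    show "xprod bs \<in> borel_measurable ?P"
      by (rule borel_measurable_xprod) (rule measurable_coordinate)
  qed
  show meas': "xcoord bs \<in> measurable M ?P"
    unfolding measurable_cong_sets[OF sets_M refl] by (rule measurable_restrict_space1[OF measurable_xcoord])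
  show distr: "distr ?P M (xprod bs) = M"
    using M_eq distr_cong[OF refl sets_M, of ?P "xprod bs" "xprod bs"] by simp
  show inverse: "xcoord bs (xprod bs t) = t" if "t \<in> space ?P" for t
    using that by (simp add: xcoord_xprod[OF bs] space_coord_space extensional_restrict)
  show inverse': "xprod bs (xcoord bs g) = g" if "g \<in> space M" for g
    using that inverse unfolding space_M carrier' by auto
  show "change_of_variables ?P M (xprod bs) (\<lambda>_. 1)"
    by (rule change_of_variables_iso(1)[OF meas meas' distr]) (simp_all add: inverse inverse')
  show "change_of_variables M ?P (xcoord bs) (\<lambda>_. 1)"
    by (rule change_of_variables_iso(2)[OF meas meas' distr]) (simp_all add: inverse inverse')
qed

end

section \<open>The unipotent groups of the maximal parabolic\<close>

definition levi_roots :: "(int^6) list" where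
  "levi_roots = map vector (levi_list_4 @ levi_list_0)"

definition radical_roots :: "(int^6) list" where
  "radical_roots = map vector radical_list"

lemma positive_root_list_second:
  "\<forall>l\<in>set (levi_list_4 @ levi_list_0). l ! 1 = 0" "\<forall>l\<in>set radical_list. l ! 1 > 0"
  by code_simp+

lemma vector_nth_list:
  assumes "length l = 6"
  shows "(vector l :: int^6) $ 2 = l ! 1" "(vector l :: int^6) $ 4 = l ! 3" "height (vector l) = sum_list l"
  using assms by (auto elim!: length_6E simp: height_def sum_UNIV_6)

lemma set_levi_roots: "set levi_roots = {\<beta> \<in> positive_roots. \<beta> $ 2 = 0}"
  and set_radical_roots: "set radical_roots = {\<beta> \<in> positive_roots. \<beta> $ 2 > 0}"
proof -
  have split: "set positive_root_list = set (levi_list_4 @ levi_list_0) \<union> set radical_list"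
    by (simp add: positive_root_list_def Un_assoc)
  have nth2: "(vector l :: int^6) $ 2 = l ! 1" if "l \<in> set positive_root_list" for l
    using that positive_root_list_length vector_nth_list(1) by blast
  have "(vector l :: int^6) $ 2 = 0" if "l \<in> set (levi_list_4 @ levi_list_0)" for l
  proof -
    have "l \<in> set positive_root_list" unfolding split using that by blast
    then show ?thesis using nth2[of l] positive_root_list_second(1) that by simp
  qed
  moreover have "(vector l :: int^6) $ 2 > 0" if "l \<in> set radical_list" for l
  proof -
    have "l \<in> set positive_root_list" unfolding split using that by blast
    then show ?thesis using nth2[of l] positive_root_list_second(2) that by simp
  qed
  ultimately show "set levi_roots = {\<beta> \<in> positive_roots. \<beta> $ 2 = 0}"
    "set radical_roots = {\<beta> \<in> positive_roots. \<beta> $ 2 > 0}"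
    unfolding positive_roots_eq split levi_roots_def radical_roots_def set_map
    by (fastforce)+
qed

text \<open>
  The same condition as \<open>adapted\<close> in a form that can be evaluated.
\<close>

fun list_adapted :: "int list list \<Rightarrow> bool" where
  "list_adapted [] \<longleftrightarrow> True"
| "list_adapted (l # ls) \<longleftrightarrow> l \<in> set positive_root_list \<and> l \<notin> set ls \<and>
     (\<forall>m\<in>set ls. (sum_list l \<le> sum_list m \<or> l ! 3 \<noteq> 0 \<and> m ! 3 = 0) \<and>
       (list_add l m \<in> set positive_root_list \<longrightarrow> list_add l m \<in> set ls)) \<and> list_adapted ls"

lemma list_adapted_levi: "list_adapted (levi_list_4 @ levi_list_0)"
  and list_adapted_radical: "list_adapted radical_list"
  by code_simp+

lemma list_adapted_subset: "list_adapted ls \<Longrightarrow> set ls \<subseteq> set positive_root_list"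
  by (induction ls) auto

lemma vector_positive_root_iff:
  "length l = 6 \<Longrightarrow> vector l \<in> positive_roots \<longleftrightarrow> l \<in> set positive_root_list"
  using positive_root_list_length vector_list_ops(4) unfolding positive_roots_eq by blast

lemma adapted_map_vector: "list_adapted ls \<Longrightarrow> adapted (map vector ls)"
proof (induction ls)
  case (Cons l ls)
  have ls: "list_adapted ls" "set ls \<subseteq> set positive_root_list"
    using Cons.prems list_adapted_subset[of ls] by auto
  have len: "length m = 6" if "m \<in> set (l # ls)" for m
    using that Cons.prems ls(2) positive_root_list_length by auto
  have len_add: "length (list_add l m) = 6" if "m \<in> set ls" for m
    using len[of l] len[of m] that by (simp add: list_add_def)
  have "vector l \<notin> (vector ` set ls :: (int^6) set)"
  proof
    assume "vector l \<in> (vector ` set ls :: (int^6) set)"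
    then obtain m where "m \<in> set ls" "vector l = (vector m :: int^6)" by blast
    then have "l \<in> set ls" using vector_list_ops(4)[OF len[of l] len[of m]] by simp
    then show False using Cons.prems by simp
  qed
  moreover have "(height (vector l) \<le> height (vector m) \<or> (vector l :: int^6) $ 4 \<noteq> 0 \<and> (vector m :: int^6) $ 4 = 0) \<and>
      (vector l + vector m \<in> positive_roots \<longrightarrow> vector l + vector m \<in> (vector ` set ls :: (int^6) set))"
    if m: "m \<in> set ls" for m
  proof -
    have lens: "length l = 6" "length m = 6" using len[of l] len[of m] m by simp_all
    show ?thesis
      using Cons.prems m vector_positive_root_iff[OF len_add[OF m]]
      unfolding vector_list_ops(1)[OF lens] vector_nth_list[OF lens(1)] vector_nth_list[OF lens(2)] by auto
  qed
  moreover have "vector l \<in> positive_roots" using Cons.prems by (simp add: positive_roots_eq)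
  ultimately show ?case using Cons.IH[OF ls(1)] by simp
qed simp

lemma adapted_levi: "adapted levi_roots" and adapted_radical: "adapted radical_roots"
  unfolding levi_roots_def radical_roots_def
  by (rule adapted_map_vector, rule list_adapted_levi list_adapted_radical)+

lemma levi_positive: "set levi_roots \<subseteq> positive_roots" and radical_positive: "set radical_roots \<subseteq> positive_roots"
  by (rule adapted_positive_roots, rule adapted_levi adapted_radical)+

lemma distinct_levi: "distinct levi_roots" and distinct_radical: "distinct radical_roots"
proof -
  have "distinct bs" if "adapted bs" for bs using that by (induction bs) auto
  then show "distinct levi_roots" "distinct radical_roots" using adapted_levi adapted_radical by auto
qed

lemma uminus_roots: "\<beta> \<in> roots \<Longrightarrow> - \<beta> \<in> roots"
proof (induction rule: roots.induct)
  case (simple i)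
  have "(cartan *v simple_root i) $ i = 2"
    using root_weight_simple_root[of i] by (simp add: root_weight_def cartan_def)
  then have "simple_root i - (cartan *v simple_root i) $ i *s simple_root i = - simple_root i"
    by (simp add: vec_eq_iff)
  then show ?case using roots.reflect[OF roots.simple, of i i] by (simp only:)
next
  case (reflect \<beta> i)
  have "- (\<beta> - (cartan *v \<beta>) $ i *s simple_root i) = - \<beta> - (cartan *v (- \<beta>)) $ i *s simple_root i"
    by (simp add: vec_eq_iff matrix_vector_mult_def sum_negf)
  then show ?case using roots.reflect[OF reflect.IH, of i] by simp
qed

text \<open>
  The grading of the weights by the coefficient of \<open>\<alpha>\<^sub>2\<close>. It identifies \<open>U\<^sub>M = U \<inter> M\<close>: elements of \<open>M\<close> preserve the grading, elements of \<open>U\<close> are upper triangular for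
  it, and taking the graded part is multiplicative on upper triangular matrices and kills root elements of \<open>N\<close>.
\<close>

definition weight_level_2 :: "int^6 \<Rightarrow> int" where
  "weight_level_2 \<delta> = \<delta> $ 1 + 2 * \<delta> $ 2 + 2 * \<delta> $ 3 + 3 * \<delta> $ 4 + 2 * \<delta> $ 5 + \<delta> $ 6"

abbreviation level :: "weight \<Rightarrow> int" where
  "level \<nu> \<equiv> weight_level_2 (Rep_weight \<nu>)"

lemma weight_level_2_simps:
  "weight_level_2 (\<delta> + \<delta>') = weight_level_2 \<delta> + weight_level_2 \<delta>'"
  "weight_level_2 (\<delta> - \<delta>') = weight_level_2 \<delta> - weight_level_2 \<delta>'"
  "weight_level_2 (root_weight \<beta>) = \<beta> $ 2"
  by (simp_all add: weight_level_2_def root_weight_nth)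

definition level_upper :: "'a::zero ^ weight ^ weight \<Rightarrow> bool" where
  "level_upper g \<longleftrightarrow> (\<forall>\<mu> \<nu>. level \<mu> < level \<nu> \<longrightarrow> g $ \<mu> $ \<nu> = 0)"

definition level_part :: "'a::zero ^ weight ^ weight \<Rightarrow> 'a ^ weight ^ weight" where
  "level_part g = (\<chi> \<mu> \<nu>. if level \<mu> = level \<nu> then g $ \<mu> $ \<nu> else 0)"

text \<open>
  Matrices that preserve the grading are those that commute with this diagonal matrix, so that they form a group.
\<close>

definition level_matrix :: "'a::field_char_0 ^ weight ^ weight" where
  "level_matrix = (\<chi> \<mu> \<nu>. if \<mu> = \<nu> then of_int (level \<nu>) else 0)"

lemma level_upper_mult:
  fixes g h :: "'a::semiring_1 ^ weight ^ weight"
  assumes "level_upper g" "level_upper h"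
  shows "level_upper (g ** h)" and "level_part (g ** h) = level_part g ** level_part h"
proof -
  have zero: "g $ \<mu> $ \<kappa> * h $ \<kappa> $ \<nu> = 0" if "level \<mu> < level \<kappa> \<or> level \<kappa> < level \<nu>" for \<mu> \<nu> \<kappa>
    using assms that unfolding level_upper_def by auto
  have "(g ** h) $ \<mu> $ \<nu> = 0" if "level \<mu> < level \<nu>" for \<mu> \<nu>
    unfolding matrix_matrix_mult_def vec_lambda_beta using that
    by (intro sum.neutral ballI zero) linarith
  then show "level_upper (g ** h)" by (simp add: level_upper_def)
  have "(level_part (g ** h)) $ \<mu> $ \<nu> = (level_part g ** level_part h) $ \<mu> $ \<nu>" for \<mu> \<nu>
  proof (cases "level \<mu> = level \<nu>")
    case True
    have "(\<Sum>\<kappa>\<in>UNIV. g $ \<mu> $ \<kappa> * h $ \<kappa> $ \<nu>) = (\<Sum>\<kappa>\<in>UNIV. level_part g $ \<mu> $ \<kappa> * level_part h $ \<kappa> $ \<nu>)"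
    proof (rule sum.cong[OF refl])
      fix \<kappa> show "g $ \<mu> $ \<kappa> * h $ \<kappa> $ \<nu> = level_part g $ \<mu> $ \<kappa> * level_part h $ \<kappa> $ \<nu>"
        using True zero[of \<mu> \<kappa> \<nu>] by (cases "level \<kappa> = level \<nu>") (auto simp: level_part_def neq_iff)
    qed
    moreover have "level_part (g ** h) $ \<mu> $ \<nu> = (g ** h) $ \<mu> $ \<nu>" using True by (simp add: level_part_def)
    ultimately show ?thesis by (simp add: matrix_matrix_mult_def)
  next
    case False
    have "(\<Sum>\<kappa>\<in>UNIV. level_part g $ \<mu> $ \<kappa> * level_part h $ \<kappa> $ \<nu>) = 0"
      using False by (intro sum.neutral) (auto simp: level_part_def)
    moreover have "level_part (g ** h) $ \<mu> $ \<nu> = 0" using False by (simp add: level_part_def)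
    ultimately show ?thesis by (simp add: matrix_matrix_mult_def)
  qed
  then show "level_part (g ** h) = level_part g ** level_part h" by (simp add: vec_eq_iff)
qed

lemma commutes_level_matrix_iff:
  fixes g :: "'a::field_char_0 ^ weight ^ weight"
  shows "g ** level_matrix = level_matrix ** g \<longleftrightarrow> (\<forall>\<mu> \<nu>. level \<mu> \<noteq> level \<nu> \<longrightarrow> g $ \<mu> $ \<nu> = 0)"
proof -
  have "(g ** level_matrix) $ \<mu> $ \<nu> = g $ \<mu> $ \<nu> * of_int (level \<nu>)"
    "(level_matrix ** g) $ \<mu> $ \<nu> = of_int (level \<mu>) * g $ \<mu> $ \<nu>" for \<mu> \<nu>
    by (simp_all add: matrix_matrix_mult_def level_matrix_def if_distrib[of "\<lambda>x. x * _"]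
        if_distrib[of "\<lambda>x. _ * x"] cong: if_cong)
  then have "g ** level_matrix = level_matrix ** g \<longleftrightarrow>
      (\<forall>\<mu> \<nu>. g $ \<mu> $ \<nu> * of_int (level \<nu>) = of_int (level \<mu>) * g $ \<mu> $ \<nu>)"
    by (simp add: vec_eq_iff)
  also have "\<dots> \<longleftrightarrow> (\<forall>\<mu> \<nu>. level \<mu> \<noteq> level \<nu> \<longrightarrow> g $ \<mu> $ \<nu> = 0)"
    by (intro all_cong1) (auto simp: mult.commute[of "of_int _"])
  finally show ?thesis .
qed

context chevalley_haar
begin

lemma E_level:
  assumes "\<beta> \<in> positive_roots" "E \<beta> $ \<mu> $ \<nu> \<noteq> 0"
  shows "level \<mu> = level \<nu> + \<beta> $ 2"
  using assms E_nth_eq_0_iff[OF assms(1), of \<mu> \<nu>] by (simp add: weight_level_2_simps)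

text \<open>
  Negative root vectors are known from the Chevalley relations only, hence the induction.
\<close>

lemma E_uminus_level:
  "\<beta> \<in> positive_roots \<Longrightarrow> E (- \<beta>) $ \<mu> $ \<nu> \<noteq> 0 \<Longrightarrow> level \<mu> = level \<nu> - \<beta> $ 2"
proof (induction arbitrary: \<mu> \<nu> rule: positive_root_induct)
  case (simple i)
  have "E (- simple_root i) = lowering i" using chevalley_system by (simp add: chevalley_system_def)
  then have "Rep_weight \<mu> = Rep_weight \<nu> - root_weight (simple_root i)"
    using simple by (simp add: lowering_def root_weight_simple_root split: if_splits)
  then show ?case by (simp add: weight_level_2_simps)
next
  case (add \<gamma> i)
  let ?C = "E (- \<gamma>) ** E (- simple_root i) - E (- simple_root i) ** E (- \<gamma>)"
  have "- \<gamma> \<in> roots" "- simple_root i \<in> roots" "- \<gamma> + - simple_root i \<in> roots"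
    using add.hyps uminus_roots[of \<gamma>] uminus_roots[of "simple_root i"] uminus_roots[of "\<gamma> + simple_root i"]
    by (simp_all add: positive_roots_roots roots.simple add.commute)
  then have "?C \<in> {E (- \<gamma> + - simple_root i), - E (- \<gamma> + - simple_root i)}"
    using chevalley_system unfolding chevalley_system_def by blast
  then have "?C \<in> {E (- (\<gamma> + simple_root i)), - E (- (\<gamma> + simple_root i))}"
    by (simp only: minus_add_distrib)
  moreover have "Y $ \<mu> $ \<nu> = 0 \<longleftrightarrow> X $ \<mu> $ \<nu> = 0" if "X \<in> {Y, - Y}" for X Y :: "'a ^ weight ^ weight"
    using that by auto
  ultimately have "?C $ \<mu> $ \<nu> \<noteq> 0" using add.prems by blast
  then have "(E (- \<gamma>) ** E (- simple_root i)) $ \<mu> $ \<nu> \<noteq> 0 \<or> (E (- simple_root i) ** E (- \<gamma>)) $ \<mu> $ \<nu> \<noteq> 0"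
    by auto
  moreover have "\<exists>\<kappa>. A $ \<mu> $ \<kappa> \<noteq> 0 \<and> B $ \<kappa> $ \<nu> \<noteq> 0" if "(A ** B) $ \<mu> $ \<nu> \<noteq> 0" for A B :: "'a ^ weight ^ weight"
  proof (rule ccontr)
    assume "\<nexists>\<kappa>. A $ \<mu> $ \<kappa> \<noteq> 0 \<and> B $ \<kappa> $ \<nu> \<noteq> 0"
    then have "(\<Sum>\<kappa>\<in>UNIV. A $ \<mu> $ \<kappa> * B $ \<kappa> $ \<nu>) = 0" by (intro sum.neutral) auto
    then show False using that by (simp add: matrix_matrix_mult_def)
  qed
  moreover have "level \<mu> = level \<nu> - simple_root i $ 2" if "E (- simple_root i) $ \<mu> $ \<nu> \<noteq> 0" for \<mu> \<nu>
  proof -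
    have "E (- simple_root i) = lowering i" using chevalley_system by (simp add: chevalley_system_def)
    then have "Rep_weight \<mu> = Rep_weight \<nu> - root_weight (simple_root i)"
      using that by (simp add: lowering_def root_weight_simple_root split: if_splits)
    then show ?thesis by (simp add: weight_level_2_simps)
  qed
  ultimately show ?case using add.IH by fastforce
qed

definition level_centralizer :: "('a ^ weight ^ weight) set" where
  "level_centralizer = {g \<in> carrier (E6_group E). g ** level_matrix = level_matrix ** g}"

lemma subgroup_level_centralizer: "subgroup level_centralizer (E6_group E)"
proof (rule E6.subgroupI)
  show "level_centralizer \<noteq> {}"
    using E6.one_closed by (auto simp: level_centralizer_def intro!: exI[of _ "mat 1"])
  fix g assume g: "g \<in> level_centralizer"
  then have gc: "g \<in> carrier (E6_group E)" by (simp add: level_centralizer_def)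
  let ?g' = "inv\<^bsub>E6_group E\<^esub> g"
  have inv: "?g' ** g = mat 1" "g ** ?g' = mat 1" using E6.l_inv[OF gc] E6.r_inv[OF gc] by simp_all
  have "?g' ** level_matrix = ?g' ** (level_matrix ** g) ** ?g'"
    using inv(2) by (simp add: matrix_mul_assoc[symmetric])
  also have "\<dots> = ?g' ** (g ** level_matrix) ** ?g'" using g by (simp add: level_centralizer_def)
  also have "\<dots> = level_matrix ** ?g'" using inv(1) by (simp add: matrix_mul_assoc)
  finally show "?g' \<in> level_centralizer" using gc by (simp add: level_centralizer_def)
next
  fix g h assume "g \<in> level_centralizer" "h \<in> level_centralizer"
  then have c: "g \<in> carrier (E6_group E)" "h \<in> carrier (E6_group E)"
    and comm: "g ** level_matrix = level_matrix ** g" "h ** level_matrix = level_matrix ** h"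
    by (simp_all add: level_centralizer_def)
  have "(g ** h) ** level_matrix = g ** (h ** level_matrix)" by (simp add: matrix_mul_assoc)
  also have "\<dots> = (g ** level_matrix) ** h" by (simp add: comm(2) matrix_mul_assoc)
  also have "\<dots> = level_matrix ** (g ** h)" by (simp add: comm(1) matrix_mul_assoc)
  finally show "g \<otimes>\<^bsub>E6_group E\<^esub> h \<in> level_centralizer"
    using E6.m_closed[OF c] by (simp add: level_centralizer_def)
qed (auto simp: level_centralizer_def)

lemma levi_M_subset: "carrier (levi_M E) \<subseteq> level_centralizer"
proof -
  have restr: "carrier (subgroup_generated (E6_group E) S) \<subseteq> level_centralizer"
    if "carrier (E6_group E) \<inter> S \<subseteq> level_centralizer" for S
    using E6.subgroup_generated_minimal[OF subgroup_level_centralizer that] by simp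
  have "g ** level_matrix = level_matrix ** g" if "g \<in> {torus_elem i t | i t. t \<noteq> 0}" for g :: "'a ^ weight ^ weight"
    using that unfolding commutes_level_matrix_iff by (auto simp: torus_elem_def)
  then have "carrier (torus_A E) \<subseteq> level_centralizer"
    unfolding torus_A_def by (intro restr) (auto simp: level_centralizer_def)
  moreover have "x \<beta> t ** level_matrix = level_matrix ** x \<beta> t" if \<beta>: "\<beta> \<in> roots" "\<beta> $ 2 = 0" for \<beta> t
  proof -
    have "E \<beta> $ \<mu> $ \<nu> = 0" if "level \<mu> \<noteq> level \<nu>" for \<mu> \<nu>
    proof (cases "\<beta> \<in> positive_roots")
      case True
      then show ?thesis using E_level[OF True, of \<mu> \<nu>] \<beta>(2) that by auto
    next
      case False
      then have "- \<beta> \<in> positive_roots" using roots_subset \<beta>(1) unfolding positive_roots_eq by force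
      then show ?thesis using E_uminus_level[of "- \<beta>" \<mu> \<nu>] \<beta>(2) that by auto
    qed
    then show ?thesis unfolding commutes_level_matrix_iff by (auto simp: root_elem_nth)
  qed
  ultimately show ?thesis
    unfolding levi_M_def by (intro restr) (auto simp: level_centralizer_def)
qed

lemma carrier_unipotent_U: "carrier (unipotent_U E) = root_subgroup_span (levi_roots @ radical_roots)"
proof -
  have "set (levi_roots @ radical_roots) = positive_roots"
    by (auto simp: set_levi_roots set_radical_roots positive_roots_def less_le)
  then show ?thesis
    using carrier_subgroup_generated_root_elems[of "levi_roots @ radical_roots"] by (simp add: unipotent_U_def)
qed

lemma level_part_U:
  assumes "g \<in> root_subgroup_span (levi_roots @ radical_roots)"
  shows "level_upper g \<and> level_part g \<in> root_subgroup_span levi_roots"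
proof -
  have "set (levi_roots @ radical_roots) \<subseteq> positive_roots" using levi_positive radical_positive by simp
  with assms show ?thesis
  proof (induction rule: root_subgroup_span_induct)
    case one
    have "level_part (mat 1 :: 'a ^ weight ^ weight) = mat 1"
      by (auto simp: vec_eq_iff level_part_def mat_def)
    then show ?case using generate.one[of "E6_group E"]
      by (simp add: level_upper_def root_subgroup_span_def) (auto simp: mat_def)
  next
    case (root_elem \<beta> t)
    then have \<beta>: "\<beta> \<in> positive_roots" using levi_positive radical_positive by auto
    then have nonneg: "\<beta> $ 2 \<ge> 0" by (simp add: positive_roots_def)
    have "level_upper (x \<beta> t)"
      using E_level[OF \<beta>] nonneg by (fastforce simp: level_upper_def root_elem_nth)
    moreover have "level_part (x \<beta> t) = (if \<beta> $ 2 = 0 then x \<beta> t else mat 1)"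
    proof -
      have "E \<beta> $ \<nu> $ \<nu> = 0" if "\<beta> $ 2 \<noteq> 0" for \<nu> using E_level[OF \<beta>, of \<nu> \<nu>] that by auto
      then show ?thesis using E_level[OF \<beta>] by (auto simp: vec_eq_iff level_part_def root_elem_nth mat_def)
    qed
    moreover have "x \<beta> t \<in> root_subgroup_span levi_roots" if "\<beta> $ 2 = 0"
      using that \<beta> unfolding root_subgroup_span_def set_levi_roots by (intro generate.incl) auto
    moreover have "mat 1 \<in> root_subgroup_span levi_roots"
      using generate.one[of "E6_group E"] by (simp add: root_subgroup_span_def)
    ultimately show ?case by simp
  next
    case (mult g h)
    then show ?case
      using level_upper_mult[of g h] generate.eng[of "level_part g" "E6_group E" _ "level_part h"]
      by (simp add: root_subgroup_span_def)
  qed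
qed

text \<open>
  An element of \<open>U \<inter> M\<close> equals its own graded part, which lies in the group generated by the positive
  roots of the Levi subgroup.
\<close>

lemma carrier_unipotent_U_M: "carrier (unipotent_U_M E) = root_subgroup_span levi_roots"
proof (intro equalityI subsetI)
  fix g assume "g \<in> carrier (unipotent_U_M E)"
  then have g: "g \<in> carrier (unipotent_U E)" "g \<in> level_centralizer"
    using levi_M_subset by (auto simp: unipotent_U_M_def)
  have "\<forall>\<mu> \<nu>. level \<mu> \<noteq> level \<nu> \<longrightarrow> g $ \<mu> $ \<nu> = 0"
    using g(2) unfolding level_centralizer_def commutes_level_matrix_iff by blast
  then have "level_part g = g" by (auto simp: level_part_def vec_eq_iff)
  then show "g \<in> root_subgroup_span levi_roots" using level_part_U[of g] g(1) carrier_unipotent_U by simp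
next
  fix g assume g: "g \<in> root_subgroup_span levi_roots"
  have "root_subgroup_span levi_roots \<subseteq> root_subgroup_span (levi_roots @ radical_roots)"
    unfolding root_subgroup_span_def by (rule E6.mono_generate) auto
  moreover have "root_subgroup_span levi_roots \<subseteq> carrier (levi_M E)"
    unfolding root_subgroup_span_def levi_M_def carrier_subgroup_generated
    by (rule E6.mono_generate) (auto simp: set_levi_roots positive_roots_def root_elem_E6)
  ultimately show "g \<in> carrier (unipotent_U_M E)"
    using g carrier_unipotent_U by (auto simp: unipotent_U_M_def)
qed

lemma group_unipotent_U_M: "group (unipotent_U_M E)"
proof -
  have "subgroup (root_subgroup_span levi_roots) (E6_group E)"
    unfolding root_subgroup_span_def using root_elem_E6 levi_positive by (intro E6.generate_is_subgroup) blast
  then have "group (E6_group E\<lparr>carrier := root_subgroup_span levi_roots\<rparr>)" by (rule E6.subgroup_imp_group)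
  moreover have "unipotent_U_M E = E6_group E\<lparr>carrier := root_subgroup_span levi_roots\<rparr>"
    using carrier_unipotent_U_M by (simp add: unipotent_U_M_def)
  ultimately show ?thesis by simp
qed

lemma unipotent_U_M_simps: "g \<otimes>\<^bsub>unipotent_U_M E\<^esub> h = g ** h" "\<one>\<^bsub>unipotent_U_M E\<^esub> = mat 1"
  by (simp_all add: unipotent_U_M_def)

lemma carrier_radical_N: "carrier (radical_N E) = root_subgroup_span radical_roots"
  unfolding radical_N_def set_radical_roots[symmetric]
  by (rule carrier_subgroup_generated_root_elems[OF radical_positive])

lemma group_radical_N: "group (radical_N E)"
  unfolding radical_N_def by simp

lemma radical_N_simps: "g \<otimes>\<^bsub>radical_N E\<^esub> h = g ** h" "\<one>\<^bsub>radical_N E\<^esub> = mat 1"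
  by (simp_all add: radical_N_def)

lemmas change_of_variables_U_M =
  change_of_variables_xprod[OF adapted_levi group_unipotent_U_M carrier_unipotent_U_M unipotent_U_M_simps]

lemmas change_of_variables_N =
  change_of_variables_xprod[OF adapted_radical group_radical_N carrier_radical_N radical_N_simps]

end

section \<open>The conjugation action on the radical\<close>

text \<open>
  Elements of \<open>N\<close> are unipotent for the grading. Their entries one level above the diagonal are additive, which
  is the projection of the Heisenberg group \<open>N\<close> to the quotient by its centre.
\<close>

definition level_unipotent :: "'a::zero_neq_one ^ weight ^ weight \<Rightarrow> bool" where
  "level_unipotent n \<longleftrightarrow> (\<forall>\<mu> \<nu>. level \<mu> \<le> level \<nu> \<longrightarrow> n $ \<mu> $ \<nu> = (if \<mu> = \<nu> then 1 else 0))"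

lemma level_unipotent_mult_nth:
  fixes g h :: "'a::field ^ weight ^ weight"
  assumes "level_unipotent g" "level_unipotent h" "level \<mu> \<le> level \<nu> + 1" "\<mu> \<noteq> \<nu>"
  shows "(g ** h) $ \<mu> $ \<nu> = g $ \<mu> $ \<nu> + h $ \<mu> $ \<nu>"
proof -
  have diag: "g $ \<kappa> $ \<kappa> = 1" "h $ \<kappa> $ \<kappa> = 1" for \<kappa> using assms(1,2) by (auto simp: level_unipotent_def)
  have "g $ \<mu> $ \<kappa> * h $ \<kappa> $ \<nu> = 0" if "\<kappa> \<noteq> \<mu>" "\<kappa> \<noteq> \<nu>" for \<kappa>
  proof (cases "level \<mu> \<le> level \<kappa>")
    case True
    then show ?thesis using assms(1) that by (simp add: level_unipotent_def)
  next
    case False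
    then have "level \<kappa> \<le> level \<nu>" using assms(3) by linarith
    then show ?thesis using assms(2) that by (simp add: level_unipotent_def)
  qed
  then have "(\<Sum>\<kappa>\<in>UNIV. g $ \<mu> $ \<kappa> * h $ \<kappa> $ \<nu>) = (\<Sum>\<kappa>\<in>{\<mu>, \<nu>}. g $ \<mu> $ \<kappa> * h $ \<kappa> $ \<nu>)"
    by (intro sum.mono_neutral_right) auto
  then show ?thesis using assms(4) diag by (simp add: matrix_matrix_mult_def)
qed

lemma level_unipotent_mult:
  fixes g h :: "'a::field ^ weight ^ weight"
  assumes "level_unipotent g" "level_unipotent h"
  shows "level_unipotent (g ** h)"
  unfolding level_unipotent_def
proof (intro allI impI)
  fix \<mu> \<nu> assume le: "level \<mu> \<le> level \<nu>"
  show "(g ** h) $ \<mu> $ \<nu> = (if \<mu> = \<nu> then 1 else 0)"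
  proof (cases "\<mu> = \<nu>")
    case False
    then show ?thesis
      using level_unipotent_mult_nth[OF assms _ False] assms le by (simp add: level_unipotent_def)
  next
    case True
    have "g $ \<nu> $ \<kappa> * h $ \<kappa> $ \<nu> = 0" if "\<kappa> \<noteq> \<nu>" for \<kappa>
      using assms that by (cases "level \<nu> \<le> level \<kappa>") (auto simp: level_unipotent_def)
    then have "(\<Sum>\<kappa>\<in>UNIV. g $ \<nu> $ \<kappa> * h $ \<kappa> $ \<nu>) = (\<Sum>\<kappa>\<in>{\<nu>}. g $ \<nu> $ \<kappa> * h $ \<kappa> $ \<nu>)"
      by (intro sum.mono_neutral_right) auto
    then show ?thesis using True assms by (simp add: matrix_matrix_mult_def level_unipotent_def)
  qed
qed

text \<open>
  The 20 roots of \<open>N\<close> other than the highest one.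
\<close>

definition graded_roots :: "(int^6) set" where
  "graded_roots = {\<delta> \<in> positive_roots. \<delta> $ 2 = 1}"

lemma graded_radical: "\<delta> \<in> graded_roots \<Longrightarrow> \<delta> \<in> set radical_roots"
  by (simp add: graded_roots_def set_radical_roots)

context chevalley_haar
begin

lemma level_unipotent_root_elem: "\<delta> \<in> set radical_roots \<Longrightarrow> level_unipotent (x \<delta> s)"
  using E_level[of \<delta>] by (fastforce simp: level_unipotent_def root_elem_nth set_radical_roots)

lemma level_unipotent_span: "n \<in> root_subgroup_span radical_roots \<Longrightarrow> level_unipotent n"
proof -
  assume "n \<in> root_subgroup_span radical_roots"
  then show ?thesis using radical_positive
    by (induction rule: root_subgroup_span_induct)
       (auto simp: level_unipotent_root_elem level_unipotent_mult, auto simp: level_unipotent_def mat_def)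
qed

lemma entry_of_neq: "\<delta> \<in> positive_roots \<Longrightarrow> fst (entry_of \<delta>) \<noteq> snd (entry_of \<delta>)"
  using entry_of[of \<delta>] height_pos[of \<delta>] weight_height_simps(4)[of \<delta>] weight_height_simps(1) by fastforce

lemma coefficient_mult_add:
  assumes "level_unipotent g" "level_unipotent h" "\<delta> \<in> graded_roots"
  shows "coefficient \<delta> (g ** h) = coefficient \<delta> g + coefficient \<delta> h"
proof -
  have \<delta>: "\<delta> \<in> positive_roots" "\<delta> $ 2 = 1" using assms(3) by (auto simp: graded_roots_def)
  have "level (fst (entry_of \<delta>)) = level (snd (entry_of \<delta>)) + 1"
    using entry_of[OF \<delta>(1)] \<delta>(2) by (simp add: weight_level_2_simps)
  then show ?thesis
    using level_unipotent_mult_nth[OF assms(1,2), of "fst (entry_of \<delta>)" "snd (entry_of \<delta>)"] entry_of_neq[OF \<delta>(1)]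
    unfolding coefficient_def by (auto simp: distrib_left)
qed

lemma coefficient_one: "\<delta> \<in> positive_roots \<Longrightarrow> coefficient \<delta> (mat 1) = 0"
  using entry_of_neq[of \<delta>] by (simp add: coefficient_def mat_def)

lemma coefficient_root_elem:
  assumes "\<delta> \<in> positive_roots" "\<delta>' \<in> positive_roots"
  shows "coefficient \<delta> (x \<delta>' s) = (if \<delta> = \<delta>' then s else 0)"
proof (cases "\<delta> = \<delta>'")
  case True
  then show ?thesis using E_entry_square[OF assms(1)] entry_of_neq[OF assms(1)]
    by (simp add: coefficient_def root_elem_nth mult.left_commute)
next
  case False
  then have "root_weight \<delta> \<noteq> root_weight \<delta>'" using root_weight_inj[OF assms] by blast
  then have "E \<delta>' $ fst (entry_of \<delta>) $ snd (entry_of \<delta>) = 0"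
    using E_nth_eq_0_iff[OF assms(2)] entry_of[OF assms(1)] by simp
  then show ?thesis using False entry_of_neq[OF assms(1)] by (simp add: coefficient_def root_elem_nth)
qed

lemma coefficient_xprod:
  assumes "\<delta> \<in> graded_roots" "set bs \<subseteq> set radical_roots" "distinct bs"
  shows "coefficient \<delta> (xprod bs t) = (if \<delta> \<in> set bs then t \<delta> else 0)"
  using assms(2,3)
proof (induction bs)
  case (Cons \<beta> bs)
  have "coefficient \<delta> (x \<beta> (t \<beta>) ** xprod bs t) = coefficient \<delta> (x \<beta> (t \<beta>)) + coefficient \<delta> (xprod bs t)"
    using Cons.prems by (intro coefficient_mult_add level_unipotent_root_elem level_unipotent_span xprod_in_span assms(1)) auto
  then show ?case
    using Cons assms(1) radical_positive by (auto simp: coefficient_root_elem graded_roots_def subset_iff)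
qed (use assms(1) in \<open>simp add: coefficient_one graded_roots_def\<close>)

lemma xcoord_graded:
  assumes "n \<in> root_subgroup_span radical_roots" "\<delta> \<in> graded_roots"
  shows "xcoord radical_roots n \<delta> = coefficient \<delta> n"
proof -
  obtain t where t: "n = xprod radical_roots t"
    using assms(1) root_subgroup_span_eq[OF adapted_radical] by blast
  show ?thesis
    using coefficient_xprod[OF assms(2) subset_refl distinct_radical] graded_radical[OF assms(2)]
    unfolding t xcoord_xprod[OF adapted_radical] by simp
qed

definition structure_constant :: "int^6 \<Rightarrow> int^6 \<Rightarrow> 'a" where
  "structure_constant \<beta> \<delta> = (SOME \<sigma>. \<sigma> \<in> {1, - 1} \<and>
     (\<forall>s t. x \<beta> s ** x \<delta> t = x \<delta> t ** (x \<beta> s ** x (\<beta> + \<delta>) (\<sigma> * s * t))))"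

lemma structure_constant:
  assumes "\<beta> \<in> positive_roots" "\<delta> \<in> positive_roots" "\<beta> + \<delta> \<in> positive_roots"
  shows "structure_constant \<beta> \<delta> \<in> {1, - 1}"
    and "x \<beta> s ** x \<delta> t = x \<delta> t ** (x \<beta> s ** x (\<beta> + \<delta>) (structure_constant \<beta> \<delta> * s * t))"
proof -
  have "\<exists>\<sigma>. \<sigma> \<in> {1, - 1} \<and> (\<forall>s t. x \<beta> s ** x \<delta> t = x \<delta> t ** (x \<beta> s ** x (\<beta> + \<delta>) (\<sigma> * s * t)))"
    using root_elem_commutator[OF assms] by blast
  from someI_ex[OF this]
  show "structure_constant \<beta> \<delta> \<in> {1, - 1}"
    "x \<beta> s ** x \<delta> t = x \<delta> t ** (x \<beta> s ** x (\<beta> + \<delta>) (structure_constant \<beta> \<delta> * s * t))"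
    unfolding structure_constant_def by blast+
qed

text \<open>
  The element \<open>x \<beta> (- s)\<close> cancels because \<open>2 \<beta> + \<delta>\<close> is never a root.
\<close>

lemma conjugate_root_elem:
  assumes "\<beta> \<in> set levi_roots" "\<delta> \<in> set radical_roots"
  shows "x \<beta> s ** x \<delta> r ** x \<beta> (- s) =
    (if \<beta> + \<delta> \<in> positive_roots then x \<delta> r ** x (\<beta> + \<delta>) (structure_constant \<beta> \<delta> * s * r) else x \<delta> r)"
proof -
  have \<beta>: "\<beta> \<in> positive_roots" and \<delta>: "\<delta> \<in> positive_roots"
    using assms by (auto simp: set_levi_roots set_radical_roots)
  show ?thesis
  proof (cases "\<beta> + \<delta> \<in> positive_roots")
    case True
    have "inner_root \<beta> (\<beta> + \<delta>) = 1"
      using True add_positive_root_iff[OF \<beta> \<delta>] inner_root_self[OF \<beta>] by (simp add: pairing_add_right)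
    then have "\<beta> + (\<beta> + \<delta>) \<notin> positive_roots" using add_positive_root_iff[OF \<beta> True] by simp
    then have comm: "x \<beta> s ** x (\<beta> + \<delta>) r' = x (\<beta> + \<delta>) r' ** x \<beta> s" for r'
      by (rule root_elem_commute[OF \<beta> True])
    have "x \<beta> s ** x \<delta> r ** x \<beta> (- s)
        = x \<delta> r ** x (\<beta> + \<delta>) (structure_constant \<beta> \<delta> * s * r) ** (x \<beta> s ** x \<beta> (- s))"
      unfolding structure_constant(2)[OF \<beta> \<delta> True, of s r] comm by (simp only: matrix_mul_assoc)
    then show ?thesis using True by (simp add: root_elem_inverse(1)[OF \<beta>])
  next
    case False
    have "x \<beta> s ** x \<delta> r ** x \<beta> (- s) = x \<delta> r ** (x \<beta> s ** x \<beta> (- s))"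
      unfolding root_elem_commute[OF \<beta> \<delta> False] by (simp only: matrix_mul_assoc)
    then show ?thesis using False by (simp add: root_elem_inverse(1)[OF \<beta>])
  qed
qed

text \<open>
  A root element of \<open>U\<^sub>M\<close> acts linearly on the quotient of \<open>N\<close> by its centre, by an elementary operation
  that adds multiples of the coordinates \<open>\<delta> - \<beta>\<close> to the coordinates \<open>\<delta>\<close>. By additivity this needs to be checked on root
  elements only.
\<close>

lemma conjugate_radical:
  assumes \<beta>: "\<beta> \<in> set levi_roots" and n: "n \<in> root_subgroup_span radical_roots"
  shows "x \<beta> s ** n ** x \<beta> (- s) \<in> root_subgroup_span radical_roots \<and>
    (\<forall>\<delta>\<in>graded_roots. coefficient \<delta> (x \<beta> s ** n ** x \<beta> (- s)) = coefficient \<delta> n +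
       (if \<delta> - \<beta> \<in> set radical_roots then structure_constant \<beta> (\<delta> - \<beta>) * s * coefficient (\<delta> - \<beta>) n else 0))"
  using n radical_positive
proof (induction rule: root_subgroup_span_induct)
  case one
  have "x \<beta> s ** mat 1 ** x \<beta> (- s) = mat 1" using \<beta> by (simp add: root_elem_inverse set_levi_roots)
  then show ?case
    using generate.one[of "E6_group E"] radical_positive
    by (auto simp: root_subgroup_span_def coefficient_one graded_roots_def)
next
  case (root_elem \<delta>' r)
  have pos: "\<beta> \<in> positive_roots" "\<beta> $ 2 = 0" "\<delta>' \<in> positive_roots" "\<delta>' $ 2 > 0"
    using \<beta> root_elem by (auto simp: set_levi_roots set_radical_roots)
  have in_span: "x \<gamma> r' \<in> root_subgroup_span radical_roots" if "\<gamma> \<in> set radical_roots" for \<gamma> r'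
    using that unfolding root_subgroup_span_def by (intro generate.incl) auto
  show ?case
  proof (cases "\<beta> + \<delta>' \<in> positive_roots")
    case True
    then have rad: "\<beta> + \<delta>' \<in> set radical_roots" using pos by (simp add: set_radical_roots)
    let ?r = "structure_constant \<beta> \<delta>' * s * r"
    have eq: "x \<beta> s ** x \<delta>' r ** x \<beta> (- s) = x \<delta>' r ** x (\<beta> + \<delta>') ?r"
      using conjugate_root_elem[OF \<beta> root_elem] True by simp
    have "coefficient \<delta> (x \<delta>' r ** x (\<beta> + \<delta>') ?r) = coefficient \<delta> (x \<delta>' r) +
       (if \<delta> - \<beta> \<in> set radical_roots then structure_constant \<beta> (\<delta> - \<beta>) * s * coefficient (\<delta> - \<beta>) (x \<delta>' r) else 0)"
      if \<delta>: "\<delta> \<in> graded_roots" for \<delta>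
    proof -
      have \<delta>p: "\<delta> \<in> positive_roots" using \<delta> by (simp add: graded_roots_def)
      have iff: "\<delta> = \<beta> + \<delta>' \<longleftrightarrow> \<delta> - \<beta> = \<delta>'" by (auto simp: algebra_simps)
      have "coefficient \<delta> (x \<delta>' r ** x (\<beta> + \<delta>') ?r) = coefficient \<delta> (x \<delta>' r) + coefficient \<delta> (x (\<beta> + \<delta>') ?r)"
        using root_elem rad \<delta> by (intro coefficient_mult_add level_unipotent_root_elem)
      also have "coefficient \<delta> (x (\<beta> + \<delta>') ?r) = (if \<delta> - \<beta> = \<delta>' then ?r else 0)"
        unfolding coefficient_root_elem[OF \<delta>p True] iff ..
      also have "\<dots> = (if \<delta> - \<beta> \<in> set radical_roots then structure_constant \<beta> (\<delta> - \<beta>) * s * coefficient (\<delta> - \<beta>) (x \<delta>' r) else 0)"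
        using root_elem radical_positive by (auto simp: coefficient_root_elem subset_iff)
      finally show ?thesis .
    qed
    moreover have "x \<delta>' r ** x (\<beta> + \<delta>') ?r \<in> root_subgroup_span radical_roots"
      using generate.eng[of _ "E6_group E"] in_span[OF root_elem, of r] in_span[OF rad, of ?r]
      by (force simp: root_subgroup_span_def)
    ultimately show ?thesis unfolding eq by blast
  next
    case False
    have eq: "x \<beta> s ** x \<delta>' r ** x \<beta> (- s) = x \<delta>' r"
      using conjugate_root_elem[OF \<beta> root_elem] False by simp
    have "coefficient (\<delta> - \<beta>) (x \<delta>' r) = 0" if "\<delta> \<in> graded_roots" "\<delta> - \<beta> \<in> set radical_roots" for \<delta>
    proof -
      have "\<delta> - \<beta> \<noteq> \<delta>'" using that(1) False by (auto simp: graded_roots_def)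
      then show ?thesis using that(2) root_elem radical_positive by (auto simp: coefficient_root_elem subset_iff)
    qed
    then show ?thesis unfolding eq using in_span[OF root_elem] by auto
  qed
next
  case (mult g h)
  have "x \<beta> s ** (g ** h) ** x \<beta> (- s) = x \<beta> s ** g ** (x \<beta> (- s) ** x \<beta> s) ** h ** x \<beta> (- s)"
    using \<beta> by (simp add: root_elem_inverse set_levi_roots matrix_mul_assoc)
  then have eq: "x \<beta> s ** (g ** h) ** x \<beta> (- s) = (x \<beta> s ** g ** x \<beta> (- s)) ** (x \<beta> s ** h ** x \<beta> (- s))"
    by (simp only: matrix_mul_assoc)
  \<comment> \<open>Subtracting a root of the Levi subgroup does not change the coefficient of \<open>\<alpha>\<^sub>2\<close>.\<close>
  have "\<delta> - \<beta> \<in> graded_roots" if "\<delta> \<in> graded_roots" "\<delta> - \<beta> \<in> set radical_roots" for \<delta>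
    using that \<beta> by (simp add: graded_roots_def set_levi_roots set_radical_roots)
  moreover have "level_unipotent (x \<beta> s ** g ** x \<beta> (- s))" "level_unipotent (x \<beta> s ** h ** x \<beta> (- s))"
    "level_unipotent g" "level_unipotent h"
    using mult by (auto intro: level_unipotent_span)
  moreover have "(x \<beta> s ** g ** x \<beta> (- s)) ** (x \<beta> s ** h ** x \<beta> (- s)) \<in> root_subgroup_span radical_roots"
    using mult generate.eng[of _ "E6_group E"] by (force simp: root_subgroup_span_def)
  ultimately show ?case
    using mult unfolding eq by (auto simp: coefficient_mult_add algebra_simps)
qed

text \<open>
  The iteration of these elementary operations, for a product of root elements with coordinates \<open>a\<close>.
\<close>

fun conjugation_action :: "(int^6) list \<Rightarrow> (int^6 \<Rightarrow> 'a) \<Rightarrow> (int^6 \<Rightarrow> 'a) \<Rightarrow> int^6 \<Rightarrow> 'a" where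
  "conjugation_action [] a y \<delta> = y \<delta>"
| "conjugation_action (\<beta> # bs) a y \<delta> = conjugation_action bs a y \<delta> +
     (if \<delta> - \<beta> \<in> set radical_roots
      then structure_constant \<beta> (\<delta> - \<beta>) * a \<beta> * conjugation_action bs a y (\<delta> - \<beta>) else 0)"

lemma conjugate_xprod:
  assumes "set bs \<subseteq> set levi_roots" "n \<in> root_subgroup_span radical_roots"
  shows "xprod bs a ** n ** xprod_inv bs a \<in> root_subgroup_span radical_roots \<and>
    (\<forall>\<delta>\<in>graded_roots. coefficient \<delta> (xprod bs a ** n ** xprod_inv bs a) =
       conjugation_action bs a (\<lambda>\<delta>. coefficient \<delta> n) \<delta>)"
  using assms(1)
proof (induction bs)
  case (Cons \<beta> bs)
  let ?n = "xprod bs a ** n ** xprod_inv bs a"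
  have IH: "?n \<in> root_subgroup_span radical_roots"
    "\<And>\<delta>. \<delta> \<in> graded_roots \<Longrightarrow> coefficient \<delta> ?n = conjugation_action bs a (\<lambda>\<delta>. coefficient \<delta> n) \<delta>"
    using Cons by auto
  have \<beta>: "\<beta> \<in> set levi_roots" using Cons.prems by simp
  have eq: "xprod (\<beta> # bs) a ** n ** xprod_inv (\<beta> # bs) a = x \<beta> (a \<beta>) ** ?n ** x \<beta> (- a \<beta>)"
    by (simp add: matrix_mul_assoc)
  have "\<delta> - \<beta> \<in> graded_roots" if "\<delta> \<in> graded_roots" "\<delta> - \<beta> \<in> set radical_roots" for \<delta>
    using that \<beta> by (simp add: graded_roots_def set_levi_roots set_radical_roots)
  then show ?case
    using conjugate_radical[OF \<beta> IH(1), of "a \<beta>"] IH(2) unfolding eq by simp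
qed (use assms(2) in simp)

end

section \<open>Coordinates of the orbit map as sums over chains of roots\<close>

definition list_sub :: "int list \<Rightarrow> int list \<Rightarrow> int list" where
  "list_sub l m = map2 (-) l m"

definition levi_list :: "int list list" where
  "levi_list = levi_list_4 @ levi_list_0"

definition gamma_list :: "int list list" where
  "gamma_list = [[1,2,2,3,2,1], [1,1,2,3,2,1], [1,1,2,2,2,1], [1,1,1,2,1,1], [0,1,1,2,1,0], [0,1,0,0,0,0]]"

text \<open>
  The monomials in a coordinate of \<open>u \<cdot> n \<cdot> u\<inverse>\<close>: each is given by a subsequence of the roots of
  \<open>U\<^sub>M\<close> whose successive subtraction from \<open>l\<close> leads through roots to one of \<open>\<gamma>\<^sub>1, \<dots>, \<gamma>\<^sub>5\<close>.
\<close>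

fun list_paths :: "int list list \<Rightarrow> int list \<Rightarrow> (int list list \<times> int list) list" where
  "list_paths [] l = (if l \<in> set (tl gamma_list) then [([], l)] else [])"
| "list_paths (b # bs) l = list_paths bs l @
     (if list_sub l b \<in> set radical_list
      then map (\<lambda>q. (b # fst q, snd q)) (list_paths bs (list_sub l b)) else [])"

text \<open>
  The bijection between the coordinates of \<open>U\<^sub>M\<close> and those coordinates of \<open>N\<close> that are not
  among the \<open>\<gamma>\<^sub>i\<close>. A root that contains \<open>\<alpha>\<^sub>4\<close> is added to \<open>\<gamma>\<^sub>5\<close>. The roots of \<open>A\<^sub>2 \<times> A\<^sub>2\<close>
  act on a 3 by 3 matrix with diagonal \<open>c\<^sub>4, c\<^sub>3, c\<^sub>2\<close>, and elimination uses \<open>c\<^sub>4\<close> as the pivot for its row and column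
  (four roots), then \<open>c\<^sub>3\<close> (two roots).
\<close>

definition list_pivot :: "int list \<Rightarrow> int list" where
  "list_pivot b = (if b ! 3 = 1 then [0,1,0,0,0,0]
     else if b \<in> {[0,0,1,0,0,0], [0,0,0,0,1,0]} then [1,1,1,2,1,1] else [0,1,1,2,1,0])"

definition list_target :: "int list \<Rightarrow> int list" where
  "list_target b = list_add b (list_pivot b)"

text \<open>
  The monomial of the coordinate \<open>l\<close> in which the variable matched with \<open>l\<close> occurs.
\<close>

definition leading_path :: "int list \<Rightarrow> int list list \<times> int list" where
  "leading_path l = (case find (\<lambda>b. list_target b = l) levi_list of
     None \<Rightarrow> ([], l) | Some b \<Rightarrow> ([b], list_pivot b))"

text \<open>
  Coordinates of \<open>U\<^sub>M\<close> are renamed to their targets, so that source and target of the orbit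
  map are indexed by the same set of roots.
\<close>

definition path_variables :: "int list list \<times> int list \<Rightarrow> int list list" where
  "path_variables q = snd q # map list_target (fst q)"

text \<open>
  Along the coefficient of \<open>\<alpha>\<^sub>4\<close>: first \<open>\<gamma>\<^sub>5\<close> and the piece of dimension 9 next to it, then the 3 by 3
  matrix in the order of Gauss elimination, each pivot followed by its row and column, and at last \<open>\<gamma>\<^sub>1\<close>.
\<close>

definition elimination_order :: "int list list" where
  "elimination_order = [0,1,0,0,0,0] # map list_target levi_list_4 @
     [0,1,1,2,1,0] # map list_target [[1,0,0,0,0,0], [0,0,0,0,0,1], [1,0,1,0,0,0], [0,0,0,0,1,1]] @
     [1,1,1,2,1,1] # map list_target [[0,0,1,0,0,0], [0,0,0,0,1,0]] @ [[1,1,2,2,2,1], [1,1,2,3,2,1]]"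

abbreviation highest_root :: "int list" where
  "highest_root \<equiv> [1,2,2,3,2,1]"

text \<open>
  The matched variable occurs in the coordinate linearly, in one monomial only, with a coefficient
  that depends on earlier variables; all other monomials consist of earlier variables.
\<close>

definition admissible_paths ::
  "(int list list \<times> int list) list \<Rightarrow> int list list \<times> int list \<Rightarrow> int list list \<Rightarrow> bool" where
  "admissible_paths qs q0 later \<longleftrightarrow> count_list qs q0 = 1 \<and>
     (\<forall>q\<in>set qs. q \<noteq> q0 \<longrightarrow> (\<forall>v\<in>set (path_variables q). length v = 6 \<and> v \<notin> set later)) \<and>
     (fst q0 \<noteq> [] \<longrightarrow> snd q0 \<notin> set later)"

fun eliminates :: "int list list \<Rightarrow> bool" where
  "eliminates [] \<longleftrightarrow> True"
| "eliminates (l # ls) \<longleftrightarrow>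
     admissible_paths (list_paths levi_list l) (leading_path l) (l # ls @ [highest_root]) \<and> eliminates ls"

text \<open>
  The triangularity of the orbit map in the 20 coordinates other than the central one.
\<close>

lemma eliminates_elimination_order: "eliminates elimination_order"
  by code_simp

lemma map_leading_path: "map leading_path elimination_order =
    ([], [0,1,0,0,0,0]) # map (\<lambda>b. ([b], [0,1,0,0,0,0])) levi_list_4 @
    ([], [0,1,1,2,1,0]) # map (\<lambda>b. ([b], [0,1,1,2,1,0])) [[1,0,0,0,0,0], [0,0,0,0,0,1], [1,0,1,0,0,0], [0,0,0,0,1,1]] @
    ([], [1,1,1,2,1,1]) # map (\<lambda>b. ([b], [1,1,1,2,1,1])) [[0,0,1,0,0,0], [0,0,0,0,1,0]] @
    [([], [1,1,2,2,2,1]), ([], [1,1,2,3,2,1])]"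
  by code_simp

lemma elimination_order_facts:
  "set (elimination_order @ [highest_root]) = set radical_list"
  "distinct (elimination_order @ [highest_root])"
  "\<forall>l\<in>set elimination_order. length l = 6 \<and> l ! 1 = 1"
  by code_simp+

lemma leading_path_highest_root: "leading_path highest_root = ([], highest_root)"
  by code_simp

lemma leading_path_cases:
  "\<forall>l\<in>set elimination_order. leading_path l = ([], l) \<or>
     (\<exists>b\<in>set levi_list. leading_path l = ([b], list_pivot b) \<and> list_target b = l \<and>
        list_sub l b = list_pivot b \<and> list_pivot b \<in> set radical_list)"
  by code_simp

lemma targets_gammas:
  "set (map list_target levi_list @ gamma_list) = set radical_list"
  "distinct (map list_target levi_list @ gamma_list)"
  by code_simp+

lemma levi_list_length: "\<forall>b\<in>set levi_list. length b = 6" "\<forall>l\<in>set radical_list. length l = 6"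
    "\<forall>b\<in>set levi_list. length (list_target b) = 6"
  by code_simp+

lemma highest_root_add: "\<forall>l\<in>set positive_root_list. list_add l highest_root \<notin> set positive_root_list"
  by code_simp

definition to_list :: "int^6 \<Rightarrow> int list" where
  "to_list \<delta> = [\<delta> $ 1, \<delta> $ 2, \<delta> $ 3, \<delta> $ 4, \<delta> $ 5, \<delta> $ 6]"

lemma to_list_vector [simp]: "length l = 6 \<Longrightarrow> to_list (vector l) = l"
  by (elim length_6E) (simp add: to_list_def)

definition target_root :: "int^6 \<Rightarrow> int^6" where
  "target_root \<beta> = vector (list_target (to_list \<beta>))"

lemma vector_list_sub:
  "length l = 6 \<Longrightarrow> length m = 6 \<Longrightarrow> vector l - vector m = (vector (list_sub l m) :: int^6)"
  by (elim length_6E) (simp add: list_sub_def vector_6_diff)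

lemma vector_radical_iff:
  "length l = 6 \<Longrightarrow> vector l \<in> set radical_roots \<longleftrightarrow> l \<in> set radical_list"
  using levi_list_length(2) vector_list_ops(4) unfolding radical_roots_def by auto

lemma sum_list_split:
  fixes f :: "'b \<Rightarrow> 'c::semiring_1"
  shows "(\<Sum>q\<leftarrow>qs. f q) = of_nat (count_list qs a) * f a + (\<Sum>q\<leftarrow>filter (\<lambda>q. q \<noteq> a) qs. f q)"
  by (induction qs) (auto simp: algebra_simps)

context chevalley_haar
begin

fun path_sign :: "int list \<Rightarrow> int list list \<Rightarrow> 'a" where
  "path_sign l [] = 1"
| "path_sign l (b # p) = structure_constant (vector b) (vector (list_sub l b)) * path_sign (list_sub l b) p"

definition path_term :: "int list \<Rightarrow> (int^6 \<Rightarrow> 'a) \<Rightarrow> int list list \<times> int list \<Rightarrow> 'a" where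
  "path_term l t q = path_sign l (fst q) * (\<Prod>b\<leftarrow>fst q. t (vector (list_target b))) * t (vector (snd q))"

text \<open>
  Expansion of the iterated elementary operations into monomials.
\<close>

lemma conjugation_action_paths:
  assumes a: "\<And>b. b \<in> set levi_list \<Longrightarrow> a (vector b) = t (vector (list_target b))"
    and y: "\<And>l. l \<in> set radical_list \<Longrightarrow> l ! 1 = 1 \<Longrightarrow> y (vector l) = (if l \<in> set (tl gamma_list) then t (vector l) else 0)"
    and bs: "set bs \<subseteq> set levi_list" and l: "l \<in> set radical_list" "l ! 1 = 1"
  shows "conjugation_action (map vector bs) a y (vector l) = (\<Sum>q\<leftarrow>list_paths bs l. path_term l t q)"
  using bs l
proof (induction bs arbitrary: l)
  case Nil
  then show ?case by (simp add: y path_term_def)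
next
  case (Cons b bs)
  have len: "length b = 6" "length l = 6" using Cons.prems levi_list_length by auto
  have sub: "vector l - vector b = (vector (list_sub l b) :: int^6)" by (rule vector_list_sub[OF len(2,1)])
  have len': "length (list_sub l b) = 6" using len by (simp add: list_sub_def)
  have IH: "conjugation_action (map vector bs) a y (vector l) = (\<Sum>q\<leftarrow>list_paths bs l. path_term l t q)"
    using Cons by auto
  show ?case
  proof (cases "list_sub l b \<in> set radical_list")
    case True
    have "b ! 1 = 0" using Cons.prems(1) positive_root_list_second(1) by (simp add: levi_list_def)
    then have "list_sub l b ! 1 = 1" using len Cons.prems(3) by (simp add: list_sub_def)
    then have IH': "conjugation_action (map vector bs) a y (vector (list_sub l b))
        = (\<Sum>q\<leftarrow>list_paths bs (list_sub l b). path_term (list_sub l b) t q)"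
      using Cons True by auto
    have "path_term l t (b # fst q, snd q) = structure_constant (vector b) (vector (list_sub l b)) *
        a (vector b) * path_term (list_sub l b) t q" for q
      using a Cons.prems(1) by (simp add: path_term_def mult_ac)
    then have "(\<Sum>q\<leftarrow>list_paths bs (list_sub l b). path_term l t (b # fst q, snd q))
        = structure_constant (vector b) (vector (list_sub l b)) * a (vector b) *
          conjugation_action (map vector bs) a y (vector (list_sub l b))"
      by (simp add: IH' sum_list_const_mult)
    then show ?thesis
      using True IH len' by (simp add: sub vector_radical_iff comp_def)
  next
    case False
    then show ?thesis using IH len' by (simp add: sub vector_radical_iff)
  qed
qed

definition levi_elem :: "(int^6 \<Rightarrow> 'a) \<Rightarrow> 'a ^ weight ^ weight" where
  "levi_elem t = xprod levi_roots (\<lambda>\<beta>. t (target_root \<beta>))"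

text \<open>
  The map \<open>Phi\<close> with both arguments packed into one family indexed by the roots of \<open>N\<close>.
\<close>

definition orbit_elem :: "(int^6 \<Rightarrow> 'a) \<Rightarrow> 'a ^ weight ^ weight" where
  "orbit_elem t = levi_elem t ** xprod (map gamma [0..<6]) t ** xprod_inv levi_roots (\<lambda>\<beta>. t (target_root \<beta>))"

lemma n_dot_eq: "n_dot E (\<lambda>i. t (gamma i)) = xprod (map gamma [0..<6]) t"
  by (simp add: n_dot_def xprod_def foldr_map comp_def)

lemma Phi_eq: "Phi E (levi_elem t, \<lambda>i. t (gamma i)) = orbit_elem t"
  unfolding Phi_def orbit_elem_def levi_elem_def prod.case E6_simps n_dot_eq inv_xprod[OF levi_positive] ..

lemma set_gammas: "set (map gamma [0..<6]) = vector ` set gamma_list" "distinct (map gamma [0..<6])"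
  "set (map gamma [0..<6]) \<subseteq> set radical_roots"
proof -
  have "map gamma [0..<6] = map vector gamma_list"
    by (simp add: upt_rec[of _ 6] gamma_def gamma_list_def numeral_eq_Suc)
  moreover have "distinct (map vector gamma_list :: (int^6) list)"
    by (simp add: gamma_list_def vector_6_eq_iff)
  moreover have "set gamma_list \<subseteq> set radical_list" using targets_gammas(1) by auto
  ultimately show "set (map gamma [0..<6]) = vector ` set gamma_list" "distinct (map gamma [0..<6])"
    "set (map gamma [0..<6]) \<subseteq> set radical_roots"
    by (auto simp: radical_roots_def)
qed

lemma orbit_elem_span: "orbit_elem t \<in> root_subgroup_span radical_roots"
  unfolding orbit_elem_def levi_elem_def
  using conjugate_xprod[OF subset_refl xprod_in_span[OF set_gammas(3)]] by blast

lemma vector_graded: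
  assumes "l \<in> set radical_list" "l ! 1 = 1"
  shows "vector l \<in> graded_roots"
proof -
  have "vector l \<in> set radical_roots" using assms(1) by (simp add: radical_roots_def)
  moreover have "length l = 6" using assms(1) levi_list_length(2) by blast
  ultimately show ?thesis using assms(2) vector_nth_list(1)[of l] by (simp add: graded_roots_def set_radical_roots)
qed

lemma orbit_coordinate_paths:
  assumes l: "l \<in> set radical_list" "l ! 1 = 1"
  shows "xcoord radical_roots (orbit_elem t) (vector l) = (\<Sum>q\<leftarrow>list_paths levi_list l. path_term l t q)"
proof -
  have n: "xprod (map gamma [0..<6]) t \<in> root_subgroup_span radical_roots" by (rule xprod_in_span[OF set_gammas(3)])
  have "xcoord radical_roots (orbit_elem t) (vector l) = coefficient (vector l) (orbit_elem t)"
    by (rule xcoord_graded[OF orbit_elem_span vector_graded[OF l]])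
  also have "\<dots> = conjugation_action levi_roots (\<lambda>\<beta>. t (target_root \<beta>))
      (\<lambda>\<delta>. coefficient \<delta> (xprod (map gamma [0..<6]) t)) (vector l)"
    unfolding orbit_elem_def levi_elem_def using conjugate_xprod[OF subset_refl n] vector_graded[OF l] by blast
  also have "\<dots> = (\<Sum>q\<leftarrow>list_paths levi_list l. path_term l t q)"
    unfolding levi_roots_def levi_list_def[symmetric]
  proof (rule conjugation_action_paths[OF _ _ subset_refl l])
    show "t (target_root (vector b)) = t (vector (list_target b))" if "b \<in> set levi_list" for b
      using that levi_list_length(1) by (simp add: target_root_def)
    fix m assume m: "m \<in> set radical_list" "m ! 1 = 1"
    have "vector m \<in> (vector ` set gamma_list :: (int^6) set) \<longleftrightarrow> m \<in> set gamma_list"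
    proof
      assume "vector m \<in> (vector ` set gamma_list :: (int^6) set)"
      then obtain m' where m': "m' \<in> set gamma_list" "vector m = (vector m' :: int^6)" by blast
      have "length m' = 6" using m'(1) targets_gammas(1) levi_list_length(2) by auto
      then show "m \<in> set gamma_list" using m' m(1) levi_list_length(2) vector_list_ops(4)[of m m'] by auto
    qed simp
    moreover have "m \<in> set gamma_list \<longleftrightarrow> m \<in> set (tl gamma_list)"
      using m(2) by (auto simp: gamma_list_def)
    ultimately show "coefficient (vector m) (xprod (map gamma [0..<6]) t)
        = (if m \<in> set (tl gamma_list) then t (vector m) else 0)"
      using coefficient_xprod[OF vector_graded[OF m] set_gammas(3,2)] unfolding set_gammas(1) by simp
  qed
  finally show ?thesis .
qed

lemma highest_root_central:
  assumes "\<beta> \<in> positive_roots"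
  shows "x (vector highest_root) r ** x \<beta> s = x \<beta> s ** x (vector highest_root) r"
proof -
  have hr: "vector highest_root \<in> positive_roots"
    by (simp add: vector_positive_root_iff positive_root_list_def radical_list_def)
  obtain l where l: "l \<in> set positive_root_list" "\<beta> = vector l" using assms by (auto simp: positive_roots_eq)
  have len: "length l = 6" "length highest_root = 6" using positive_root_list_length l(1) by simp_all
  have "vector highest_root + \<beta> = vector (list_add l highest_root)"
    unfolding l(2) add.commute[of "vector highest_root"] by (rule vector_list_ops(1)[OF len])
  moreover have "length (list_add l highest_root) = 6" using len by (simp add: list_add_def)
  ultimately have "vector highest_root + \<beta> \<notin> positive_roots"
    using highest_root_add l(1) by (simp add: vector_positive_root_iff)
  then show ?thesis by (rule root_elem_commute[OF hr assms])
qed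

lemma highest_root_central_xprod:
  assumes "set bs \<subseteq> positive_roots"
  shows "x (vector highest_root) r ** xprod bs t = xprod bs t ** x (vector highest_root) r"
  using assms
proof (induction bs)
  case (Cons \<beta> bs)
  have "x (vector highest_root) r ** (x \<beta> (t \<beta>) ** xprod bs t)
      = x \<beta> (t \<beta>) ** (x (vector highest_root) r ** xprod bs t)"
    using highest_root_central[of \<beta> r "t \<beta>"] Cons.prems by (simp add: matrix_mul_assoc)
  also have "x (vector highest_root) r ** xprod bs t = xprod bs t ** x (vector highest_root) r"
    using Cons by simp
  finally show ?case by (simp add: matrix_mul_assoc)
qed simp

text \<open>
  The highest root is the last one in the ordering, and its root subgroup is central.
\<close>

lemma xcoord_highest_root:
  assumes "n \<in> root_subgroup_span radical_roots"
  shows "xcoord radical_roots (x (vector highest_root) r ** n) (vector highest_root)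
    = r + xcoord radical_roots n (vector highest_root)"
proof -
  let ?\<gamma> = "vector highest_root :: int^6"
  obtain t where t: "n = xprod radical_roots t"
    using assms root_subgroup_span_eq[OF adapted_radical] by blast
  obtain bs where bs: "radical_roots = bs @ [?\<gamma>]" by (simp add: radical_roots_def radical_list_def)
  have \<gamma>: "?\<gamma> \<in> positive_roots" "?\<gamma> \<notin> set bs" "set bs \<subseteq> positive_roots"
    using radical_positive distinct_radical unfolding bs by auto
  have "xprod bs (t(?\<gamma> := r + t ?\<gamma>)) = xprod bs t" using \<gamma>(2) by (intro xprod_cong) auto
  then have "xprod radical_roots (t(?\<gamma> := r + t ?\<gamma>)) = xprod bs t ** (x ?\<gamma> r ** x ?\<gamma> (t ?\<gamma>))"
    unfolding bs xprod_append by (simp add: root_elem_add[OF \<gamma>(1)])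
  also have "\<dots> = x ?\<gamma> r ** n"
    unfolding t bs xprod_append using highest_root_central_xprod[OF \<gamma>(3), of r t] by (simp add: matrix_mul_assoc)
  finally have "x ?\<gamma> r ** n = xprod radical_roots (t(?\<gamma> := r + t ?\<gamma>))" ..
  moreover have "?\<gamma> \<in> set radical_roots" unfolding bs by simp
  ultimately show ?thesis unfolding t by (simp add: xcoord_xprod[OF adapted_radical])
qed

text \<open>
  The coordinate of the centre is complicated, as the group law of the Heisenberg group enters. But the
  variable \<open>c\<^sub>0\<close> occurs in no other coordinate, and in this one only as a translation, which has Jacobian one
  whatever the other terms are.
\<close>

lemma orbit_coordinate_highest_root:
  "xcoord radical_roots (orbit_elem t) (vector highest_root)
     = t (vector highest_root) + xcoord radical_roots (orbit_elem (t(vector highest_root := 0))) (vector highest_root)"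
proof -
  let ?\<gamma> = "vector highest_root :: int^6"
  let ?t = "t(?\<gamma> := 0)"
  let ?u = "\<lambda>t. xprod levi_roots (\<lambda>\<beta>. t (target_root \<beta>))" and ?u' = "\<lambda>t. xprod_inv levi_roots (\<lambda>\<beta>. t (target_root \<beta>))"
  have "target_root \<beta> \<noteq> ?\<gamma>" if \<beta>: "\<beta> \<in> set levi_roots" for \<beta>
  proof -
    obtain b where b: "b \<in> set levi_list" "\<beta> = vector b" using \<beta> by (auto simp: levi_roots_def levi_list_def)
    have "list_target b \<noteq> highest_root" using targets_gammas(2) b(1) by (force simp: gamma_list_def)
    moreover have "length (list_target b) = 6" "length b = 6" using levi_list_length b(1) by blast+
    ultimately show ?thesis unfolding b(2) target_root_def by (simp add: vector_list_ops(4))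
  qed
  then have u: "?u ?t = ?u t" "?u' ?t = ?u' t"
    by (auto intro!: xprod_cong xprod_inv_cong)
  define gs where "gs = map gamma [1..<6]"
  have gs: "map gamma [0..<6] = ?\<gamma> # gs" by (simp add: gs_def upt_rec[of 0 6] gamma_def)
  have "?\<gamma> \<notin> set gs" using set_gammas(2) unfolding gs by simp
  then have g: "xprod gs ?t = xprod gs t" by (intro xprod_cong) auto
  have "orbit_elem t = ?u t ** (x ?\<gamma> (t ?\<gamma>) ** xprod gs t) ** ?u' t"
    by (simp add: orbit_elem_def levi_elem_def gs)
  also have "\<dots> = (x ?\<gamma> (t ?\<gamma>) ** ?u t) ** xprod gs t ** ?u' t"
    using highest_root_central_xprod[OF levi_positive, of "t ?\<gamma>" "\<lambda>\<beta>. t (target_root \<beta>)"]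
    by (simp add: matrix_mul_assoc)
  also have "\<dots> = x ?\<gamma> (t ?\<gamma>) ** orbit_elem ?t"
    unfolding orbit_elem_def levi_elem_def gs u xprod_simps g by (simp add: matrix_mul_assoc)
  finally show ?thesis using xcoord_highest_root[OF orbit_elem_span] by simp
qed

end

section \<open>Triangularity of the orbit map and its Jacobian\<close>

lemma eliminates_count:
  "eliminates ls \<Longrightarrow> l \<in> set ls \<Longrightarrow> count_list (list_paths levi_list l) (leading_path l) = 1"
  by (induction ls) (auto simp: admissible_paths_def)

definition orbit_coordinates :: "(int^6) list" where
  "orbit_coordinates = map vector (elimination_order @ [highest_root])"

lemma orbit_coordinates:
  "set orbit_coordinates = set radical_roots" "distinct orbit_coordinates"
proof -
  show eq: "set orbit_coordinates = set radical_roots"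
    unfolding orbit_coordinates_def radical_roots_def set_map elimination_order_facts(1) ..
  have "card (set orbit_coordinates) = 21"
    unfolding eq distinct_card[OF distinct_radical] by (simp add: radical_roots_def radical_list_def)
  moreover have "length orbit_coordinates = 21"
    by (simp add: orbit_coordinates_def elimination_order_def levi_list_4_def)
  ultimately show "distinct orbit_coordinates" by (intro card_distinct) simp
qed

lemma target_root_radical:
  assumes "\<beta> \<in> set levi_roots"
  shows "target_root \<beta> \<in> set radical_roots"
proof -
  obtain b where b: "b \<in> set levi_list" "\<beta> = vector b"
    using assms by (auto simp: levi_roots_def levi_list_def)
  have "list_target b \<in> set radical_list" using targets_gammas(1) b(1) by auto
  moreover have "length b = 6" using levi_list_length(1) b(1) by blast
  ultimately show ?thesis unfolding b(2) by (simp add: target_root_def radical_roots_def)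
qed

context normalized_haar
begin

text \<open>
  A product of two product measures is the product measure over the disjoint union of the index sets, here
  after an embedding of both in a common index set.
\<close>

lemma change_of_variables_reindex_pair:
  fixes p :: "'i \<Rightarrow> 'k" and r :: "'j \<Rightarrow> 'k"
  assumes fin: "finite I" "finite J" and inj: "inj_on p I" "inj_on r J"
    and disj: "p ` I \<inter> r ` J = {}" and K: "K = p ` I \<union> r ` J"
  defines "R \<equiv> \<lambda>(a, c). \<lambda>k\<in>K. if k \<in> p ` I then a (inv_into I p k) else c (inv_into J r k)"
  shows "change_of_variables ((\<Pi>\<^sub>M i\<in>I. dc) \<Otimes>\<^sub>M (\<Pi>\<^sub>M j\<in>J. dc)) (\<Pi>\<^sub>M k\<in>K. dc) R (\<lambda>_. 1)"
proof -
  let ?A = "\<Pi>\<^sub>M i\<in>I. dc" and ?C = "\<Pi>\<^sub>M j\<in>J. dc" and ?P = "\<Pi>\<^sub>M k\<in>K. dc"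
  define S where "S = (\<lambda>t :: 'k \<Rightarrow> 'a. (\<lambda>i\<in>I. t (p i), \<lambda>j\<in>J. t (r j)))"
  have p: "inv_into I p (p i) = i" if "i \<in> I" for i using inj(1) that by simp
  have r: "inv_into J r (r j) = j" "r j \<notin> p ` I" if "j \<in> J" for j using inj(2) disj that by auto
  have R_nth: "i \<in> I \<Longrightarrow> R z (p i) = fst z i" "j \<in> J \<Longrightarrow> R z (r j) = snd z j" for z i j
    using p r by (auto simp: R_def K case_prod_unfold)
  have R_ext: "R z \<in> extensional K" for z by (simp add: R_def case_prod_unfold)
  have R_meas: "R \<in> measurable (?A \<Otimes>\<^sub>M ?C) ?P"
    unfolding R_def case_prod_unfold
  proof (rule measurable_restrict)
    fix k assume "k \<in> K"
    then consider i where "i \<in> I" "k = p i" | j where "j \<in> J" "k = r j" unfolding K by blast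
    then show "(\<lambda>z. if k \<in> p ` I then fst z (inv_into I p k) else snd z (inv_into J r k)) \<in> measurable (?A \<Otimes>\<^sub>M ?C) dc"
    proof cases
      case 1
      then have "(\<lambda>z. fst z i) \<in> measurable (?A \<Otimes>\<^sub>M ?C) dc"
        by (intro measurable_compose[OF measurable_fst measurable_component_singleton])
      then show ?thesis using 1 p by simp
    next
      case 2
      then have "(\<lambda>z. snd z j) \<in> measurable (?A \<Otimes>\<^sub>M ?C) dc"
        by (intro measurable_compose[OF measurable_snd measurable_component_singleton])
      then show ?thesis using 2 r by simp
    qed
  qed
  have S_meas: "S \<in> measurable ?P (?A \<Otimes>\<^sub>M ?C)"
    unfolding S_def by (intro measurable_Pair measurable_restrict measurable_component_singleton) (auto simp: K)
  have space_A: "space ?A = extensional I" "space ?C = extensional J" "space ?P = extensional K"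
    by (simp_all add: space_PiM PiE_def)
  have "distr (?A \<Otimes>\<^sub>M ?C) ?P R = ?P"
  proof (rule PiM_eqI)
    fix B assume "\<And>k. k \<in> K \<Longrightarrow> B k \<in> sets dc"
    then have B: "B (p i) \<in> sets dc" "B (r j) \<in> sets dc" "PiE K B \<in> sets ?P" if "i \<in> I" "j \<in> J" for i j
      using that fin K by (auto intro!: sets_PiM_I_finite)
    have B': "PiE I (\<lambda>i. B (p i)) \<in> sets ?A" "PiE J (\<lambda>j. B (r j)) \<in> sets ?C" "PiE K B \<in> sets ?P"
      using \<open>\<And>k. k \<in> K \<Longrightarrow> B k \<in> sets dc\<close> fin K by (auto intro!: sets_PiM_I_finite)
    have iff: "R z \<in> PiE K B \<longleftrightarrow> z \<in> PiE I (\<lambda>i. B (p i)) \<times> PiE J (\<lambda>j. B (r j))"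
      if z: "z \<in> space (?A \<Otimes>\<^sub>M ?C)" for z
    proof -
      have "R z \<in> PiE K B \<longleftrightarrow> (\<forall>k\<in>K. R z k \<in> B k)" using R_ext by (auto simp: PiE_def Pi_def)
      also have "\<dots> \<longleftrightarrow> (\<forall>i\<in>I. fst z i \<in> B (p i)) \<and> (\<forall>j\<in>J. snd z j \<in> B (r j))"
        unfolding K by (simp add: ball_Un R_nth)
      also have "\<dots> \<longleftrightarrow> z \<in> PiE I (\<lambda>i. B (p i)) \<times> PiE J (\<lambda>j. B (r j))"
        using z by (auto simp: space_pair_measure space_A PiE_def Pi_def mem_Times_iff)
      finally show ?thesis .
    qed
    have "PiE I (\<lambda>i. B (p i)) \<times> PiE J (\<lambda>j. B (r j)) \<subseteq> space (?A \<Otimes>\<^sub>M ?C)"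
      unfolding space_pair_measure
      by (intro Sigma_mono sets.sets_into_space[OF B'(1)] sets.sets_into_space[OF B'(2)])
    then have "R -` PiE K B \<inter> space (?A \<Otimes>\<^sub>M ?C) = PiE I (\<lambda>i. B (p i)) \<times> PiE J (\<lambda>j. B (r j))"
      (is "?V = ?B")
    proof (intro equalityI subsetI)
      fix z assume "z \<in> ?V"
      then have "z \<in> space (?A \<Otimes>\<^sub>M ?C)" "R z \<in> PiE K B" by simp_all
      then show "z \<in> ?B" by (rule iff[THEN iffD1])
    next
      fix z assume z: "z \<in> ?B"
      with \<open>?B \<subseteq> space (?A \<Otimes>\<^sub>M ?C)\<close> have space: "z \<in> space (?A \<Otimes>\<^sub>M ?C)" by (rule subsetD)
      from iff[OF this, THEN iffD2, OF z] space show "z \<in> ?V" by simp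
    qed
    then have "emeasure (distr (?A \<Otimes>\<^sub>M ?C) ?P R) (PiE K B)
        = emeasure ?A (PiE I (\<lambda>i. B (p i))) * emeasure ?C (PiE J (\<lambda>j. B (r j)))"
      using B' sigma_finite_measure.emeasure_pair_measure_Times[OF sigma_finite[OF fin(2)] B'(1,2)]
      by (simp add: emeasure_distr[OF R_meas])
    also have "\<dots> = (\<Prod>i\<in>I. emeasure dc (B (p i))) * (\<Prod>j\<in>J. emeasure dc (B (r j)))"
      using \<open>\<And>k. k \<in> K \<Longrightarrow> B k \<in> sets dc\<close> fin K
      by (subst (1 2) emeasure_PiM) auto
    also have "\<dots> = (\<Prod>k\<in>K. emeasure dc (B k))"
      unfolding K using fin disj inj by (simp add: prod.union_disjoint prod.reindex)
    finally show "emeasure (distr (?A \<Otimes>\<^sub>M ?C) ?P R) (PiE K B) = (\<Prod>k\<in>K. emeasure dc (B k))" .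
  qed (use fin K in auto)
  moreover have "S (R z) = z" if "z \<in> space (?A \<Otimes>\<^sub>M ?C)" for z
  proof -
    have "fst z \<in> extensional I" "snd z \<in> extensional J"
      using that by (auto simp: space_pair_measure space_A)
    then have "(\<lambda>i\<in>I. R z (p i)) = fst z" "(\<lambda>j\<in>J. R z (r j)) = snd z"
      by (auto simp: fun_eq_iff R_nth restrict_def extensional_def)
    then show ?thesis by (simp add: S_def)
  qed
  moreover have "R (S t) = t" if "t \<in> space ?P" for t
  proof
    fix k
    have t: "t \<in> extensional K" using that by (simp add: space_A)
    show "R (S t) k = t k"
    proof (cases "k \<in> K")
      case True
      then consider i where "i \<in> I" "k = p i" | j where "j \<in> J" "k = r j" unfolding K by blast
      then show ?thesis by cases (simp_all add: R_nth S_def)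
    next
      case False
      then show ?thesis using R_ext[of "S t"] t by (simp add: extensional_def)
    qed
  qed
  ultimately show ?thesis by (rule change_of_variables_iso(1)[OF R_meas S_meas])
qed

end

context chevalley_haar
begin

lemma path_term_cong:
  assumes "\<And>v. v \<in> set (path_variables q) \<Longrightarrow> t (vector v) = t' (vector v)"
  shows "path_term l t q = path_term l t' q"
proof -
  have eq: "map (\<lambda>b. t (vector (list_target b))) (fst q) = map (\<lambda>b. t' (vector (list_target b))) (fst q)"
    using assms by (auto simp: path_variables_def)
  have "t (vector (snd q)) = t' (vector (snd q))" using assms by (simp add: path_variables_def)
  then show ?thesis unfolding path_term_def eq by (rule arg_cong)
qed

text \<open>
  Up to sign, the pivot by which the matched variable is multiplied.
\<close>

definition leading_coefficient :: "int^6 \<Rightarrow> (int^6 \<Rightarrow> 'a) \<Rightarrow> 'a" where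
  "leading_coefficient \<delta> t = (let q = leading_path (to_list \<delta>) in
     if fst q = [] then 1 else structure_constant (vector (hd (fst q))) (vector (snd q)) * t (vector (snd q)))"

text \<open>
  For the highest root everything except the translation is collected here, with \<open>c\<^sub>0\<close> set to zero to make the
  independence of \<open>c\<^sub>0\<close> evident.
\<close>

definition lower_terms :: "int^6 \<Rightarrow> (int^6 \<Rightarrow> 'a) \<Rightarrow> 'a" where
  "lower_terms \<delta> t =
     (if \<delta> = vector highest_root then xcoord radical_roots (orbit_elem (t(\<delta> := 0))) \<delta>
      else \<Sum>q\<leftarrow>filter (\<lambda>q. q \<noteq> leading_path (to_list \<delta>)) (list_paths levi_list (to_list \<delta>)).
             path_term (to_list \<delta>) t q)"

lemma elimination_orderD:
  assumes "l \<in> set elimination_order"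
  shows "length l = 6" "l ! 1 = 1" "l \<in> set radical_list" "vector l \<noteq> (vector highest_root :: int^6)"
proof -
  show l: "length l = 6" "l ! 1 = 1" "l \<in> set radical_list"
    using assms elimination_order_facts(1,3) by auto
  have "l \<noteq> highest_root" using l(2) by auto
  then show "vector l \<noteq> (vector highest_root :: int^6)" using vector_list_ops(4)[OF l(1), of highest_root] by simp
qed

lemma orbit_coordinate:
  assumes "\<delta> \<in> set orbit_coordinates"
  shows "xcoord radical_roots (orbit_elem t) \<delta> = leading_coefficient \<delta> t * t \<delta> + lower_terms \<delta> t"
proof (cases "\<delta> = vector highest_root")
  case True
  then show ?thesis using orbit_coordinate_highest_root[of t]
    by (simp add: leading_coefficient_def lower_terms_def leading_path_highest_root)
next
  case False
  then obtain l where l: "l \<in> set elimination_order" "\<delta> = vector l"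
    using assms by (auto simp: orbit_coordinates_def)
  note len = elimination_orderD[OF l(1)]
  have "path_term l t (leading_path l) = leading_coefficient \<delta> t * t \<delta>"
    using leading_path_cases l len(1) by (auto simp: path_term_def leading_coefficient_def)
  moreover have "xcoord radical_roots (orbit_elem t) \<delta> = (\<Sum>q\<leftarrow>list_paths levi_list l. path_term l t q)"
    unfolding l(2) by (rule orbit_coordinate_paths[OF len(3,2)])
  moreover have "count_list (list_paths levi_list l) (leading_path l) = 1"
    by (rule eliminates_count[OF eliminates_elimination_order l(1)])
  ultimately show ?thesis
    using False sum_list_split[of "path_term l t" "list_paths levi_list l" "leading_path l"] l(2) len(1)
    by (simp add: lower_terms_def)
qed

lemma triangular_orbit_coordinates:
  assumes "eliminates ls" "set ls \<subseteq> set elimination_order"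
  shows "triangular leading_coefficient (map vector (ls @ [highest_root]))"
    and "triangular lower_terms (map vector (ls @ [highest_root]))"
proof -
  have "triangular leading_coefficient (map vector (ls @ [highest_root])) \<and>
      triangular lower_terms (map vector (ls @ [highest_root]))"
    using assms
  proof (induction ls)
    case Nil
    have upd: "t(vector highest_root := 0) = t'(vector highest_root := 0)"
      if "\<forall>i. i \<noteq> vector highest_root \<longrightarrow> t i = t' i" for t t' :: "int^6 \<Rightarrow> 'a"
      using that by auto
    then have "lower_terms (vector highest_root) t = lower_terms (vector highest_root) t'"
      if "\<forall>i. i \<noteq> vector highest_root \<longrightarrow> t i = t' i" for t t'
      using upd[OF that] by (simp add: lower_terms_def)
    then show ?case by (auto simp: leading_coefficient_def leading_path_highest_root)
  next
    case (Cons l ls)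
    have l: "l \<in> set elimination_order" using Cons.prems by simp
    note len = elimination_orderD[OF l]
    let ?K = "map vector ((l # ls) @ [highest_root]) :: (int^6) list"
    have agree: "t (vector v) = t' (vector v)"
      if "\<forall>i. i \<notin> set ?K \<longrightarrow> t i = t' i" "length v = 6" "v \<notin> set (l # ls @ [highest_root])"
      for t t' :: "int^6 \<Rightarrow> 'a" and v
    proof -
      have "vector v \<noteq> (vector m :: int^6)" if m: "m \<in> set (l # ls @ [highest_root])" for m
      proof -
        have "length m = 6" using m Cons.prems(2) elimination_orderD(1) by auto
        then show ?thesis using vector_list_ops(4)[OF \<open>length v = 6\<close>] \<open>v \<notin> _\<close> m by metis
      qed
      then have "vector v \<notin> set ?K" by auto
      then show ?thesis using that(1) by blast
    qed
    have lead: "leading_coefficient (vector l) t = leading_coefficient (vector l) t'"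
      if tt: "\<forall>i. i \<notin> set ?K \<longrightarrow> t i = t' i" for t t'
    proof (cases "fst (leading_path l) = []")
      case False
      have "snd (leading_path l) \<in> set radical_list" using leading_path_cases l False by force
      then have "length (snd (leading_path l)) = 6" using levi_list_length(2) by blast
      then have "t (vector (snd (leading_path l))) = t' (vector (snd (leading_path l)))"
        using False Cons.prems(1) by (intro agree[OF tt]) (auto simp: admissible_paths_def)
      then show ?thesis using len(1) by (simp add: leading_coefficient_def Let_def)
    qed (simp add: leading_coefficient_def len(1))
    have lower: "lower_terms (vector l) t = lower_terms (vector l) t'"
      if tt: "\<forall>i. i \<notin> set ?K \<longrightarrow> t i = t' i" for t t'
    proof -
      have "path_term l t q = path_term l t' q"
        if q: "q \<in> set (list_paths levi_list l)" "q \<noteq> leading_path l" for q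
        using Cons.prems(1) q by (intro path_term_cong agree[OF tt]) (auto simp: admissible_paths_def)
      then have eq: "map (path_term l t) (filter (\<lambda>q. q \<noteq> leading_path l) (list_paths levi_list l))
          = map (path_term l t') (filter (\<lambda>q. q \<noteq> leading_path l) (list_paths levi_list l))"
        by (intro map_cong refl) auto
      show ?thesis using len(1,4) by (simp add: lower_terms_def eq)
    qed
    show ?case using Cons lead lower by simp
  qed
  then show "triangular leading_coefficient (map vector (ls @ [highest_root]))"
    "triangular lower_terms (map vector (ls @ [highest_root]))" by blast+
qed

lemma borel_measurable_xprod_inv:
  "(\<And>\<beta>. \<beta> \<in> set bs \<Longrightarrow> (\<lambda>z. t z \<beta>) \<in> borel_measurable M) \<Longrightarrow> (\<lambda>z. xprod_inv bs (t z)) \<in> borel_measurable M"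
proof (induction bs)
  case (Cons \<beta> bs)
  then have "(\<lambda>z. 0 - t z \<beta>) \<in> borel_measurable M"
    by (intro borel_measurable_padic_diff borel_measurable_const) simp
  then show ?case
    using Cons by (auto intro!: borel_measurable_matrix_mult borel_measurable_root_elem)
qed simp

lemma measurable_orbit_coordinate:
  assumes "\<delta> \<in> set radical_roots"
  shows "(\<lambda>t. xcoord radical_roots (orbit_elem t) \<delta>) \<in> borel_measurable (coord_space (set radical_roots))"
proof -
  have "orbit_elem \<in> borel_measurable (coord_space (set radical_roots))"
    unfolding orbit_elem_def[abs_def] levi_elem_def
    using target_root_radical set_gammas(3)
    by (intro borel_measurable_matrix_mult borel_measurable_xprod borel_measurable_xprod_inv measurable_coordinate) auto
  from measurable_compose[OF this measurable_xcoord]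
  have "(\<lambda>t. xcoord radical_roots (orbit_elem t)) \<in> measurable (coord_space (set radical_roots)) (coord_space (set radical_roots))" .
  from measurable_compose[OF this measurable_coordinate[OF assms]] show ?thesis .
qed

lemma leading_path_radical:
  assumes "l \<in> set (elimination_order @ [highest_root])" "fst (leading_path l) \<noteq> []"
  shows "vector (hd (fst (leading_path l))) \<in> positive_roots" "vector (snd (leading_path l)) \<in> set radical_roots"
    "vector (hd (fst (leading_path l))) + vector (snd (leading_path l)) \<in> positive_roots"
proof -
  obtain b where b: "b \<in> set levi_list" "leading_path l = ([b], list_pivot b)" "list_target b = l"
    "list_pivot b \<in> set radical_list"
    using leading_path_cases leading_path_highest_root assms by fastforce
  have len: "length b = 6" "length (list_pivot b) = 6" using levi_list_length b by blast+
  have "b \<in> set positive_root_list" "l \<in> set positive_root_list"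
    using b(1) assms(1) elimination_order_facts(1) by (auto simp: levi_list_def positive_root_list_def)
  moreover have "vector b + vector (list_pivot b) = (vector l :: int^6)"
    using vector_list_ops(1)[OF len] b(3) by (simp add: list_target_def)
  ultimately show "vector (hd (fst (leading_path l))) \<in> positive_roots" "vector (snd (leading_path l)) \<in> set radical_roots"
    "vector (hd (fst (leading_path l))) + vector (snd (leading_path l)) \<in> positive_roots"
    using b(2,4) by (simp_all add: positive_roots_eq radical_roots_def)
qed

lemma absv_leading_coefficient:
  assumes "l \<in> set (elimination_order @ [highest_root])"
  shows "absv (leading_coefficient (vector l) t) =
    (if fst (leading_path l) = [] then 1 else absv (t (vector (snd (leading_path l)))))"
proof (cases "fst (leading_path l) = []")
  case False
  have "structure_constant (vector (hd (fst (leading_path l)))) (vector (snd (leading_path l))) \<in> {1, - 1}"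
    using leading_path_radical[OF assms False] radical_positive by (intro structure_constant(1)) auto
  moreover have "length l = 6" using assms elimination_orderD(1) by auto
  ultimately show ?thesis using False by (auto simp: leading_coefficient_def Let_def absv_mult)
qed (use assms elimination_orderD(1) in \<open>auto simp: leading_coefficient_def\<close>)

text \<open>
  The exponents count how often each pivot is used: nine times \<open>c\<^sub>5\<close>, four times \<open>c\<^sub>4\<close>, twice \<open>c\<^sub>3\<close>.
\<close>

lemma prod_leading_coefficient:
  "(\<Prod>\<delta>\<in>set orbit_coordinates. absv (leading_coefficient \<delta> t)) =
     absv (t (gamma 3)) ^ 2 * absv (t (gamma 4)) ^ 4 * absv (t (gamma 5)) ^ 9"
proof -
  let ?F = "\<lambda>q. if fst q = [] then 1 else absv (t (vector (snd q)))"
  have "(\<Prod>\<delta>\<in>set orbit_coordinates. absv (leading_coefficient \<delta> t))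
      = (\<Prod>\<delta>\<leftarrow>orbit_coordinates. absv (leading_coefficient \<delta> t))"
    by (rule prod.distinct_set_conv_list[OF orbit_coordinates(2)])
  also have "\<dots> = prod_list (map (\<lambda>l. ?F (leading_path l)) (elimination_order @ [highest_root]))"
    unfolding orbit_coordinates_def map_map comp_def
    by (intro arg_cong[of _ _ prod_list] map_cong refl absv_leading_coefficient)
  also have "\<dots> = prod_list (map ?F (map leading_path elimination_order))"
    by (simp add: leading_path_highest_root comp_def)
  also have "\<dots> = absv (t (gamma 3)) ^ 2 * absv (t (gamma 4)) ^ 4 * absv (t (gamma 5)) ^ 9"
    unfolding map_leading_path by (simp add: levi_list_4_def gamma_def eval_nat_numeral mult_ac)
  finally show ?thesis .
qed

lemma leading_coefficient_regular:
  assumes "\<delta> \<in> set orbit_coordinates"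
  shows "leading_coefficient \<delta> \<in> borel_measurable (coord_space (set radical_roots))"
    and "AE t in coord_space (set radical_roots). leading_coefficient \<delta> t \<noteq> 0"
proof -
  obtain l where l: "l \<in> set (elimination_order @ [highest_root])" "\<delta> = vector l"
    using assms by (auto simp: orbit_coordinates_def)
  have len: "length l = 6" using l(1) elimination_orderD(1) by auto
  let ?P = "coord_space (set radical_roots)"
  show "leading_coefficient \<delta> \<in> borel_measurable ?P"
  proof (cases "fst (leading_path l) = []")
    case True
    then show ?thesis using len l(2) by (simp add: leading_coefficient_def[abs_def])
  next
    case False
    then show ?thesis using len l(2) leading_path_radical(2)[OF l(1)]
      by (auto simp: leading_coefficient_def[abs_def] Let_def
          intro!: borel_measurable_padic_times measurable_coordinate)
  qed
  show "AE t in ?P. leading_coefficient \<delta> t \<noteq> 0"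
  proof (cases "fst (leading_path l) = []")
    case True
    then show ?thesis using len l(2) by (simp add: leading_coefficient_def)
  next
    case False
    then have "AE t in ?P. t (vector (snd (leading_path l))) \<noteq> 0"
      using leading_path_radical(2)[OF l(1)] by (intro AE_coordinate_nonzero) auto
    then show ?thesis
    proof eventually_elim
      case (elim t)
      then have "absv (leading_coefficient \<delta> t) \<noteq> 0"
        using False by (simp add: l(2) absv_leading_coefficient[OF l(1)])
      then show ?case by simp
    qed
  qed
qed

lemma lower_terms_measurable:
  assumes "\<delta> \<in> set orbit_coordinates"
  shows "lower_terms \<delta> \<in> borel_measurable (coord_space (set radical_roots))"
proof -
  let ?P = "coord_space (set radical_roots)"
  have \<delta>: "\<delta> \<in> set radical_roots" using assms orbit_coordinates(1) by blast
  have "lower_terms \<delta> = (\<lambda>t. xcoord radical_roots (orbit_elem t) \<delta> - leading_coefficient \<delta> t * t \<delta>)"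
    using orbit_coordinate[OF assms] by (simp add: fun_eq_iff)
  also have "\<dots> \<in> borel_measurable ?P"
    by (intro borel_measurable_padic_diff borel_measurable_padic_times measurable_orbit_coordinate \<delta>
        leading_coefficient_regular(1) assms measurable_coordinate)
  finally show ?thesis .
qed

lemma change_of_variables_orbit:
  "change_of_variables (coord_space (set radical_roots)) (coord_space (set radical_roots))
     (\<lambda>t. xcoord radical_roots (orbit_elem t)) (\<lambda>t. ennreal (J_Phi (\<lambda>i. t (gamma i))))"
proof -
  let ?P = "coord_space (set radical_roots)"
  note tri = triangular_orbit_coordinates[OF eliminates_elimination_order subset_refl, folded orbit_coordinates_def]
  have "change_of_variables ?P ?P
    (\<lambda>t \<delta>. if \<delta> \<in> set orbit_coordinates then leading_coefficient \<delta> t * t \<delta> + lower_terms \<delta> t else t \<delta>)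
    (\<lambda>t. ennreal (\<Prod>\<delta>\<in>set orbit_coordinates. absv (leading_coefficient \<delta> t)))"
    using orbit_coordinates
    by (intro change_of_variables_triangular tri leading_coefficient_regular lower_terms_measurable) auto
  then show ?thesis
  proof (rule change_of_variables_cong)
    fix t assume "t \<in> space ?P"
    then have t: "t \<in> extensional (set radical_roots)" by (simp add: space_coord_space)
    show "(\<lambda>\<delta>. if \<delta> \<in> set orbit_coordinates then leading_coefficient \<delta> t * t \<delta> + lower_terms \<delta> t else t \<delta>)
        = xcoord radical_roots (orbit_elem t)"
      using orbit_coordinate t xcoord_extensional[of radical_roots "orbit_elem t"] orbit_coordinates(1)
      by (auto simp: fun_eq_iff extensional_def)
    show "ennreal (\<Prod>\<delta>\<in>set orbit_coordinates. absv (leading_coefficient \<delta> t)) = ennreal (J_Phi (\<lambda>i. t (gamma i)))"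
      unfolding prod_leading_coefficient J_Phi_def ..
  qed
qed

text \<open>
  The map \<open>Phi\<close> factors through coordinates on \<open>U\<^sub>M\<close>, the renaming of variables, the triangular map and the
  product map onto \<open>N\<close>. All steps but the third one preserve measures.
\<close>

theorem change_of_variables_Phi:
  assumes dn: "haar_measure (radical_N E) dn" "emeasure dn (integral_points (radical_N E)) = 1"
    and du: "haar_measure (unipotent_U_M E) du" "emeasure du (integral_points (unipotent_U_M E)) = 1"
  shows "change_of_variables (du \<Otimes>\<^sub>M (\<Pi>\<^sub>M i\<in>{..5}. dc)) dn (Phi E) (\<lambda>(u, c). ennreal (J_Phi c))"
proof -
  let ?L = "coord_space (set levi_roots)" and ?P = "coord_space (set radical_roots)"
  let ?C = "\<Pi>\<^sub>M i\<in>{..5::nat}. dc"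
  note U = change_of_variables_U_M[OF du]
  \<comment> \<open>The coordinate of \<open>u\<close> at \<open>\<beta>\<close> is renamed to \<open>target_root \<beta>\<close>, and \<open>c\<^sub>i\<close> to \<open>\<gamma>\<^sub>i\<close>.\<close>
  define R where "R = (\<lambda>(a, c). \<lambda>\<delta>\<in>set radical_roots. if \<delta> \<in> target_root ` set levi_roots
    then a (inv_into (set levi_roots) target_root \<delta>) else c (inv_into {..5} gamma \<delta>) :: 'a)"
  have gamma_image: "gamma ` {..5} = vector ` set gamma_list" "inj_on gamma {..5}"
  proof -
    have "{..5} = set [0..<6::nat]" by auto
    then show "gamma ` {..5} = vector ` set gamma_list" "inj_on gamma {..5}"
      using set_gammas(1,2) by (simp_all add: distinct_map)
  qed
  have target_image: "target_root ` set levi_roots = vector ` set (map list_target levi_list)"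
    using levi_list_length(1)
    by (force simp: levi_roots_def levi_list_def[symmetric] target_root_def image_image)
  have inj_vector: "inj_on (vector :: int list \<Rightarrow> int^6) (set radical_list)"
    using levi_list_length(2) vector_list_ops(4) by (auto simp: inj_on_def)
  have inj_target: "inj_on target_root (set levi_roots)"
  proof (rule eq_card_imp_inj_on)
    have "set (map list_target levi_list) \<subseteq> set radical_list" using targets_gammas(1) by auto
    then have "card (target_root ` set levi_roots) = card (set (map list_target levi_list))"
      unfolding target_image by (intro card_image inj_on_subset[OF inj_vector])
    also have "\<dots> = length levi_list" using targets_gammas(2) distinct_card[of "map list_target levi_list"] by simp
    also have "\<dots> = card (set levi_roots)"
      using distinct_card[OF distinct_levi] by (simp add: levi_roots_def levi_list_def)
    finally show "card (target_root ` set levi_roots) = card (set levi_roots)" .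
  qed simp
  have disj: "target_root ` set levi_roots \<inter> gamma ` {..5} = {}"
  proof -
    have "set (map list_target levi_list) \<inter> set gamma_list = {}" using targets_gammas(2) by auto
    moreover have "vector ` (set (map list_target levi_list) \<inter> set gamma_list)
        = (vector ` set (map list_target levi_list) \<inter> vector ` set gamma_list :: (int^6) set)"
      by (rule inj_on_image_Int[OF inj_vector]) (use targets_gammas(1) in auto)
    ultimately show ?thesis unfolding target_image gamma_image by simp
  qed
  have union: "set radical_roots = target_root ` set levi_roots \<union> gamma ` {..5}"
    unfolding target_image gamma_image image_Un[symmetric] set_append[symmetric] targets_gammas(1)
    by (simp add: radical_roots_def)
  have 1: "change_of_variables (du \<Otimes>\<^sub>M ?C) (?L \<Otimes>\<^sub>M ?C) (\<lambda>(u, c). (xcoord levi_roots u, c)) (\<lambda>_. 1)"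
  proof (rule change_of_variables_iso(2)[where T = "\<lambda>(a, c). (xprod levi_roots a, c)"])
    show "(\<lambda>(a, c). (xprod levi_roots a, c)) \<in> measurable (?L \<Otimes>\<^sub>M ?C) (du \<Otimes>\<^sub>M ?C)"
      unfolding case_prod_unfold
      by (intro measurable_Pair measurable_compose[OF measurable_fst U(4)] measurable_snd)
    show "(\<lambda>(u, c). (xcoord levi_roots u, c)) \<in> measurable (du \<Otimes>\<^sub>M ?C) (?L \<Otimes>\<^sub>M ?C)"
      unfolding case_prod_unfold
      by (intro measurable_Pair measurable_compose[OF measurable_fst U(5)] measurable_snd)
    have "sigma_finite_measure (distr ?C ?C (\<lambda>c. c))" using sigma_finite[of "{..5::nat}"] by simp
    from pair_measure_distr[OF U(4) measurable_ident_sets[OF refl] this]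
    show "distr (?L \<Otimes>\<^sub>M ?C) (du \<Otimes>\<^sub>M ?C) (\<lambda>(a, c). (xprod levi_roots a, c)) = du \<Otimes>\<^sub>M ?C"
      by (simp add: U(3))
  qed (auto simp: space_pair_measure U(6,7))
  have 2: "change_of_variables (?L \<Otimes>\<^sub>M ?C) ?P R (\<lambda>_. 1)"
    unfolding R_def
    by (rule change_of_variables_reindex_pair[OF _ _ inj_target gamma_image(2) disj union]) simp_all
  note comp = change_of_variables_comp[OF change_of_variables_comp[OF change_of_variables_comp[OF 1 2]
      change_of_variables_orbit] change_of_variables_N(1)[OF dn]]
  show ?thesis
  proof (rule change_of_variables_cong[OF comp])
    fix z assume z: "z \<in> space (du \<Otimes>\<^sub>M ?C)"
    obtain u c where uc: "z = (u, c)" by fastforce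
    have u: "u \<in> space du" using z uc by (simp add: space_pair_measure)
    define t where "t = R (xcoord levi_roots u, c)"
    have t_target: "t (target_root \<beta>) = xcoord levi_roots u \<beta>" if "\<beta> \<in> set levi_roots" for \<beta>
      using that inj_target union by (auto simp: t_def R_def)
    have t_gamma: "t (gamma i) = c i" if "i \<le> 5" for i
      using that gamma_image(2) union disj by (auto simp: t_def R_def)
    have "levi_elem t = xprod levi_roots (xcoord levi_roots u)"
      unfolding levi_elem_def by (intro xprod_cong t_target)
    then have levi: "levi_elem t = u" using U(7)[OF u] by simp
    have "n_dot E (\<lambda>i. t (gamma i)) = n_dot E c"
      using t_gamma by (simp add: n_dot_def upt_rec[of _ 6])
    then have Phi: "Phi E (u, c) = orbit_elem t"
      using Phi_eq[of t] levi by (simp add: Phi_def)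
    have J: "J_Phi (\<lambda>i. t (gamma i)) = J_Phi c" by (simp add: J_Phi_def t_gamma)
    have R_z: "R (case z of (u, c) \<Rightarrow> (xcoord levi_roots u, c)) = t" by (simp add: uc t_def)
    have "xprod radical_roots (xcoord radical_roots (orbit_elem t)) = orbit_elem t"
    proof -
      obtain s where s: "orbit_elem t = xprod radical_roots s"
        using orbit_elem_span root_subgroup_span_eq[OF adapted_radical] by blast
      have "xprod radical_roots (restrict s (set radical_roots)) = xprod radical_roots s" by (rule xprod_cong) simp
      then show ?thesis unfolding s xcoord_xprod[OF adapted_radical] .
    qed
    then show "xprod radical_roots (xcoord radical_roots (orbit_elem (R (case z of (u, c) \<Rightarrow> (xcoord levi_roots u, c)))))
        = Phi E z"
      unfolding R_z by (simp add: uc Phi)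
    show "1 * 1 * ennreal (J_Phi (\<lambda>i. R (case z of (u, c) \<Rightarrow> (xcoord levi_roots u, c)) (gamma i))) * 1
        = (case z of (u, c) \<Rightarrow> ennreal (J_Phi c))"
      unfolding R_z J by (simp add: uc)
  qed
qed

end

theorem proposition3p6:
  fixes E :: "int^6 \<Rightarrow> 'a::padic_field ^ weight ^ weight"
    and dn du :: "('a ^ weight ^ weight) measure"
    and dc :: "'a measure"
  assumes "chevalley_system E"
    and "haar_measure (radical_N E) dn"
    and "emeasure dn (integral_points (radical_N E)) = 1"
    and "haar_measure (unipotent_U_M E) du"
    and "emeasure du (integral_points (unipotent_U_M E)) = 1"
    and "haar_measure additive_group dc"
    and "emeasure dc ring_of_integers = 1"
  shows "pullback_measure (du \<Otimes>\<^sub>M (\<Pi>\<^sub>M i\<in>{..5}. dc)) (Phi E) dn =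
    density (du \<Otimes>\<^sub>M (\<Pi>\<^sub>M i\<in>{..5}. dc)) (\<lambda>(u, c). ennreal (J_Phi c))"
proof -
  interpret chevalley_haar dc E using assms(1,6,7) by unfold_locales
  show ?thesis by (rule pullback_measure_eq_density[OF change_of_variables_Phi[OF assms(2-5)]])
qed

end
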